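(* Let $n\ge 1$, let $B$ be a commutative associative finitely generated unital algebra over $\mathbb C$, and let $\tau=(A\rtimes \mathrm{Der}A)\otimes B$ where $A=\mathbb C[t_1^{\pm1},\dots,t_n^{\pm1}]$. Let $V$ be an irreducible weight module for $\tau$ with finite dimensional weight spaces. Assume that the action of $A\otimes B$ on $V$ is associative and that $1.v=v$ for all $v\in V$. Then there exist a dominant integral weight $\mu$ of $\mathfrak{sl}_n$, a scalar $c\in\mathbb C$, a vector $\alpha\in\mathbb C^n$ and an algebra homomorphism $\psi:B\to\mathbb C$ such that $V\simeq F^\alpha(\mu,c)=V(\mu,c)\otimes A$ as $\tau$-modules, where the action of $\tau$ on $F^\alpha(\mu,c)$ is given by $$D(u,r)b.(v\otimes t^m)=\psi(b)\Big\{(u,m+\alpha)\,v\otimes t^{m+r}+\sum_{i,j=1}^n (u_ir_jE_{ji}v)\otimes t^{m+r}\Big\},$$ $$t^rb.(v\otimes t^m)=\psi(b)\,v\otimes t^{r+m},$$ for all $u\in\mathbb C^n$, $r,m\in\mathbb Z^n$, $b\in B$, $v\in V(\mu,c)$.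
   Context: All vector spaces, algebras and tensor products are over $\mathbb C$. $(\cdot,\cdot)$ is the bilinear form on $\mathbb C^n$ with $(e_i,e_j)=\delta_{ij}$. For $r\in\mathbb Z^n$, $t^r=t_1^{r_1}\cdots t_n^{r_n}\in A$. $\mathrm{Der}A$ is the Lie algebra of derivations of $A$; for $u\in\mathbb C^n$, $r\in\mathbb Z^n$, $D(u,r)=\sum_i u_i t^r t_i\frac{d}{dt_i}$, and $[D(u,r),D(v,s)]=D(w,r+s)$ with $w=(u,s)v-(v,r)u$. $A\rtimes\mathrm{Der}A$ is the Lie algebra with additional brackets $[t^r,t^s]=0$, $[D(u,r),t^s]=(u,s)t^{r+s}$. $\tau=(A\rtimes \mathrm{Der}A)\otimes B$ has bracket $[X\otimes b,Y\otimes b']=[X,Y]\otimes bb'$; write $D(u,r)b=D(u,r)\otimes b$ and $t^rb=t^r\otimes b$. Let $\mathfrak h=\mathrm{span}\{D(u,0):u\in\mathbb C^n\}$ and $H=\mathbb C\,t^0\oplus\mathfrak h$, identified with $H\otimes 1\subset\tau$. A $\tau$-module $V$ is a weight module if $V=\bigoplus_{\lambda\in H^*}V_\lambda$ with $V_\lambda=\{v\in V:hv=\lambda(h)v\ \forall h\in H\}$; the $V_\lambda$ are the weight spaces. The action of $A\otimes B$ is associative if $(t^rb).((t^sb').v)=(t^{r+s}bb').v$ for all $r,s,b,b',v$; the $1$ in $1.v=v$ is $t^0\otimes 1$. $\mathfrak{gl}_n=\mathfrak{sl}_n\oplus\mathbb C I$, where $I$ is the identity matrix, and $E_{ji}$ are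 the matrix units. For a dominant integral weight $\mu$ of $\mathfrak{sl}_n$, $V(\mu)$ is the corresponding finite dimensional irreducible $\mathfrak{sl}_n$-module, and $V(\mu,c)$ is the irreducible $\mathfrak{gl}_n$-module obtained from $V(\mu)$ by letting $I$ act by the scalar $c$. (For $n=1$, $\mathfrak{sl}_1=0$, $\mu$ is trivial and $V(\mu,c)$ is the one-dimensional $\mathfrak{gl}_1$-module on which $E_{11}=I$ acts by $c$.) *)

theory Defs
  imports "HOL-Analysis.Analysis" "HOL-Library.Poly_Mapping"
begin

section \<open>Complex vector spaces and commutative algebras\<close>

class complex_vector = ab_group_add +
  fixes scaleC :: "complex \<Rightarrow> 'a \<Rightarrow> 'a"  (infixr \<open>*\<^sub>C\<close> 75)
  assumes scaleC_add_right: "c *\<^sub>C (x + y) = c *\<^sub>C x + c *\<^sub>C y"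
    and scaleC_add_left: "(c + d) *\<^sub>C x = c *\<^sub>C x + d *\<^sub>C x"
    and scaleC_scaleC: "c *\<^sub>C d *\<^sub>C x = (c * d) *\<^sub>C x"
    and scaleC_one: "1 *\<^sub>C x = x"

global_interpretation cvs: vector_space "scaleC :: complex \<Rightarrow> 'a \<Rightarrow> 'a::complex_vector"
  by unfold_locales (simp_all add: scaleC_add_right scaleC_add_left scaleC_scaleC scaleC_one)

abbreviation clinear :: "('a::complex_vector \<Rightarrow> 'b::complex_vector) \<Rightarrow> bool"
  where "clinear \<equiv> Vector_Spaces.linear scaleC scaleC"

lemma clinear_iff:
  "clinear f \<longleftrightarrow> (\<forall>x y. f (x + y) = f x + f y) \<and> (\<forall>c x. f (c *\<^sub>C x) = c *\<^sub>C f x)"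
  by (auto simp: Vector_Spaces.linear_def module_hom_def module_hom_axioms_def
      cvs.vector_space_axioms cvs.module_axioms)

lemma clinearI:
  "(\<And>x y. f (x + y) = f x + f y) \<Longrightarrow> (\<And>c x. f (c *\<^sub>C x) = c *\<^sub>C f x) \<Longrightarrow> clinear f"
  by (simp add: clinear_iff)

lemma clinear_add: "clinear f \<Longrightarrow> f (x + y) = f x + f y"
  and clinear_scale: "clinear f \<Longrightarrow> f (c *\<^sub>C x) = c *\<^sub>C f x"
  by (simp_all add: clinear_iff)

lemma clinear_diff: "clinear f \<Longrightarrow> f (x - y) = f x - f y"
  and clinear_minus: "clinear f \<Longrightarrow> f (- x) = - f x"
  and clinear_zero: "clinear f \<Longrightarrow> f 0 = 0"
proof -
  assume f: "clinear f"
  show z: "f 0 = 0" using clinear_scale[OF f, of 0 0] by simp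
  show m: "f (- x) = - f x" for x
    using clinear_add[OF f, of x "- x"] z by (simp add: eq_neg_iff_add_eq_0 add.commute)
  show "f (x - y) = f x - f y"
    using clinear_add[OF f, of x "- y"] m by simp
qed

definition finite_dim :: "'a::complex_vector set \<Rightarrow> bool"
  where "finite_dim V \<longleftrightarrow> (\<exists>S. finite S \<and> V \<subseteq> cvs.span S)"

class complex_comm_algebra_1 = complex_vector + comm_ring_1 +
  assumes scaleC_mult_left: "(c *\<^sub>C x) * y = c *\<^sub>C (x * y)"

lemma scaleC_mult_right: "x * (c *\<^sub>C y) = c *\<^sub>C (x * y)" for x :: "'a::complex_comm_algebra_1"
  by (metis mult.commute scaleC_mult_left)

definition subalgebra :: "'a::complex_comm_algebra_1 set \<Rightarrow> bool"
  where "subalgebra T \<longleftrightarrow> cvs.subspace T \<and> 1 \<in> T \<and> (\<forall>x\<in>T. \<forall>y\<in>T. x * y \<in> T)"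

definition finitely_generated_algebra :: "'a::complex_comm_algebra_1 itself \<Rightarrow> bool"
  where "finitely_generated_algebra _ \<longleftrightarrow>
    (\<exists>S :: 'a set. finite S \<and> subalgebra hull S = UNIV)"

instantiation complex :: complex_comm_algebra_1
begin
definition "scaleC_complex c (x :: complex) = c * x"
instance by standard (simp_all add: scaleC_complex_def algebra_simps)
end

definition algebra_hom ::
    "('a::complex_comm_algebra_1 \<Rightarrow> 'b::complex_comm_algebra_1) \<Rightarrow> bool"
  where "algebra_hom \<psi> \<longleftrightarrow> clinear \<psi> \<and> (\<forall>x y. \<psi> (x * y) = \<psi> x * \<psi> y) \<and> \<psi> 1 = 1"

instantiation vec :: (complex_vector, finite) complex_vector
begin
definition "scaleC_vec c (x :: 'a ^ 'b) = (\<chi> i. c *\<^sub>C (x $ i))"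
instance
  by standard (simp_all add: scaleC_vec_def vec_eq_iff scaleC_add_right scaleC_add_left
      scaleC_scaleC scaleC_one)
end

instantiation poly_mapping :: (type, complex_vector) complex_vector
begin
lift_definition scaleC_poly_mapping :: "complex \<Rightarrow> ('a \<Rightarrow>\<^sub>0 'b) \<Rightarrow> ('a \<Rightarrow>\<^sub>0 'b)"
  is "\<lambda>c f k. c *\<^sub>C f k"
  by (erule finite_subset[rotated]) auto
instance
  by standard (transfer, force simp: scaleC_add_right scaleC_add_left
      scaleC_scaleC scaleC_one)+
end

lemma lookup_scaleC: "Poly_Mapping.lookup (c *\<^sub>C f) k = c *\<^sub>C Poly_Mapping.lookup f k"
  by transfer simp

lemma scaleC_single: "c *\<^sub>C Poly_Mapping.single k x = Poly_Mapping.single k (c *\<^sub>C x)"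
  by (rule poly_mapping_eqI) (simp add: lookup_scaleC lookup_single when_def)

lemma poly_mapping_additive_induct [case_names single add]:
  assumes s: "\<And>k c. P (Poly_Mapping.single k c)"
    and a: "\<And>f g. P f \<Longrightarrow> P g \<Longrightarrow> P (f + g)"
  shows "P (f :: 'a \<Rightarrow>\<^sub>0 'b::ab_group_add)"
proof (induction f rule: Poly_Mapping.update_induct)
  case const
  show ?case using s[of undefined 0] by simp
next
  case (update f a b)
  have "Poly_Mapping.update a b f = f + Poly_Mapping.single a b"
    using update by (intro poly_mapping_eqI)
      (auto simp: lookup_update lookup_add lookup_single when_def in_keys_iff)
  then show ?case using update s a by metis
qed

instance poly_mapping :: (comm_monoid_add, complex_comm_algebra_1) complex_comm_algebra_1
proof
  fix c and x y :: "'a \<Rightarrow>\<^sub>0 'b"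
  show "(c *\<^sub>C x) * y = c *\<^sub>C (x * y)"
  proof (induction x rule: poly_mapping_additive_induct)
    case (single k a)
    show ?case
    proof (induction y rule: poly_mapping_additive_induct)
      case (single l b)
      then show ?case by (simp add: scaleC_single mult_single scaleC_mult_left)
    qed (simp add: distrib_left scaleC_add_right)
  qed (simp add: distrib_right scaleC_add_right)
qed


section \<open>Tensor products over the complex numbers\<close>

text \<open>The free vector space on \<open>'a \<times> 'b\<close> modulo the relations of bilinearity.\<close>

inductive_set tensor_relators :: "('a::complex_vector \<times> 'b::complex_vector \<Rightarrow>\<^sub>0 complex) set"
  where
    add_left: "Poly_Mapping.single (a + a', b) 1
      - (Poly_Mapping.single (a, b) 1 + Poly_Mapping.single (a', b) 1) \<in> tensor_relators"
  | add_right: "Poly_Mapping.single (a, b + b') 1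
      - (Poly_Mapping.single (a, b) 1 + Poly_Mapping.single (a, b') 1) \<in> tensor_relators"
  | scale_left: "Poly_Mapping.single (c *\<^sub>C a, b) 1
      - c *\<^sub>C Poly_Mapping.single (a, b) 1 \<in> tensor_relators"
  | scale_right: "Poly_Mapping.single (a, c *\<^sub>C b) 1
      - c *\<^sub>C Poly_Mapping.single (a, b) 1 \<in> tensor_relators"

definition tensor_rel :: "('a::complex_vector \<times> 'b::complex_vector \<Rightarrow>\<^sub>0 complex)
    \<Rightarrow> ('a \<times> 'b \<Rightarrow>\<^sub>0 complex) \<Rightarrow> bool"
  where "tensor_rel x y \<longleftrightarrow> x - y \<in> cvs.span tensor_relators"

lemma equivp_tensor_rel: "equivp tensor_rel"
proof (rule equivpI[OF reflpI sympI transpI]; unfold tensor_rel_def)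
  fix x y z :: "'a::complex_vector \<times> 'b::complex_vector \<Rightarrow>\<^sub>0 complex"
  show "x - x \<in> cvs.span tensor_relators" by (simp add: cvs.span_zero)
  assume xy: "x - y \<in> cvs.span tensor_relators"
  then have "- (x - y) \<in> cvs.span tensor_relators" by (rule cvs.span_neg)
  then show "y - x \<in> cvs.span tensor_relators" by simp
  assume "y - z \<in> cvs.span tensor_relators"
  with xy have "(x - y) + (y - z) \<in> cvs.span tensor_relators" by (rule cvs.span_add)
  then show "x - z \<in> cvs.span tensor_relators" by simp
qed

quotient_type (overloaded) ('a, 'b) tensor =
  "'a::complex_vector \<times> 'b::complex_vector \<Rightarrow>\<^sub>0 complex" / tensor_rel
  by (rule equivp_tensor_rel)

instantiation tensor :: (complex_vector, complex_vector) complex_vector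
begin
lift_definition zero_tensor :: "('a, 'b) tensor" is 0 .
lift_definition plus_tensor :: "('a, 'b) tensor \<Rightarrow> ('a, 'b) tensor \<Rightarrow> ('a, 'b) tensor" is "(+)"
  unfolding tensor_rel_def add_diff_add by (rule cvs.span_add)
lift_definition uminus_tensor :: "('a, 'b) tensor \<Rightarrow> ('a, 'b) tensor" is uminus
  unfolding tensor_rel_def minus_diff_minus by (rule cvs.span_neg)
lift_definition minus_tensor :: "('a, 'b) tensor \<Rightarrow> ('a, 'b) tensor \<Rightarrow> ('a, 'b) tensor" is "(-)"
proof -
  fix x x' y y' :: "'a \<times> 'b \<Rightarrow>\<^sub>0 complex"
  assume "tensor_rel x x'" "tensor_rel y y'"
  then have "(x - x') - (y - y') \<in> cvs.span tensor_relators"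
    unfolding tensor_rel_def by (rule cvs.span_diff)
  then show "tensor_rel (x - y) (x' - y')"
    unfolding tensor_rel_def by (simp add: algebra_simps)
qed
lift_definition scaleC_tensor :: "complex \<Rightarrow> ('a, 'b) tensor \<Rightarrow> ('a, 'b) tensor" is scaleC
  unfolding tensor_rel_def cvs.scale_right_diff_distrib[symmetric] by (rule cvs.span_scale)
instance
  by standard
    (transfer, simp add: algebra_simps scaleC_add_right scaleC_add_left scaleC_scaleC scaleC_one
      equivp_reflp[OF equivp_tensor_rel])+
end

lift_definition tensor :: "'a::complex_vector \<Rightarrow> 'b::complex_vector \<Rightarrow> ('a, 'b) tensor"
    (infixr \<open>\<otimes>\<^sub>C\<close> 76)
  is "\<lambda>a b. Poly_Mapping.single (a, b) 1" .

lemma tensor_add_left: "(a + a') \<otimes>\<^sub>C b = a \<otimes>\<^sub>C b + a' \<otimes>\<^sub>C b"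
  by transfer (unfold tensor_rel_def, intro cvs.span_base tensor_relators.add_left)

lemma tensor_add_right: "a \<otimes>\<^sub>C (b + b') = a \<otimes>\<^sub>C b + a \<otimes>\<^sub>C b'"
  by transfer (unfold tensor_rel_def, intro cvs.span_base tensor_relators.add_right)

lemma tensor_scale_left: "(c *\<^sub>C a) \<otimes>\<^sub>C b = c *\<^sub>C (a \<otimes>\<^sub>C b)"
  by transfer (unfold tensor_rel_def, intro cvs.span_base tensor_relators.scale_left)

lemma tensor_scale_right: "a \<otimes>\<^sub>C (c *\<^sub>C b) = c *\<^sub>C (a \<otimes>\<^sub>C b)"
  by transfer (unfold tensor_rel_def, intro cvs.span_base tensor_relators.scale_right)

lemma tensor_induct [case_names pure add]:
  assumes p: "\<And>a b. P (a \<otimes>\<^sub>C b)" and s: "\<And>x y. P x \<Longrightarrow> P y \<Longrightarrow> P (x + y)"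
  shows "P x"
proof -
  have "P (abs_tensor f)" for f
  proof (induction f rule: poly_mapping_additive_induct)
    case (single k c)
    have "abs_tensor (Poly_Mapping.single k c) = c *\<^sub>C (fst k \<otimes>\<^sub>C snd k)"
      by (simp add: tensor.abs_eq scaleC_tensor.abs_eq scaleC_single scaleC_complex_def)
    also have "\<dots> = (c *\<^sub>C fst k) \<otimes>\<^sub>C snd k"
      by (rule tensor_scale_left[symmetric])
    finally have "abs_tensor (Poly_Mapping.single k c) = (c *\<^sub>C fst k) \<otimes>\<^sub>C snd k" .
    then show ?case using p by simp
  next
    case (add f g)
    then show ?case using s by (metis plus_tensor.abs_eq)
  qed
  then show ?thesis by (metis tensor.abs_induct)
qed

definition cbilinear ::
    "('a::complex_vector \<Rightarrow> 'b::complex_vector \<Rightarrow> 'c::complex_vector) \<Rightarrow> bool"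
  where "cbilinear f \<longleftrightarrow> (\<forall>b. clinear (\<lambda>a. f a b)) \<and> (\<forall>a. clinear (f a))"

definition free_lift :: "('k \<Rightarrow> 'c::complex_vector) \<Rightarrow> ('k \<Rightarrow>\<^sub>0 complex) \<Rightarrow> 'c"
  where "free_lift g x = (\<Sum>k\<in>Poly_Mapping.keys x. Poly_Mapping.lookup x k *\<^sub>C g k)"

lemma free_lift_superset:
  assumes "finite K" "Poly_Mapping.keys x \<subseteq> K"
  shows "free_lift g x = (\<Sum>k\<in>K. Poly_Mapping.lookup x k *\<^sub>C g k)"
  unfolding free_lift_def using assms
  by (intro sum.mono_neutral_left) (auto simp: in_keys_iff)

lemma free_lift_single: "free_lift g (Poly_Mapping.single k c) = c *\<^sub>C g k"
  by (subst free_lift_superset[of "{k}"]) auto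

lemma clinear_free_lift: "clinear (free_lift g)"
proof (rule clinearI)
  fix x y :: "'a \<Rightarrow>\<^sub>0 complex" and c
  let ?K = "Poly_Mapping.keys x \<union> Poly_Mapping.keys y"
  have "Poly_Mapping.keys (x + y) \<subseteq> ?K" by (rule Poly_Mapping.keys_add)
  then show "free_lift g (x + y) = free_lift g x + free_lift g y"
    using free_lift_superset[of ?K "x + y" g] free_lift_superset[of ?K x g]
      free_lift_superset[of ?K y g]
    by (simp add: lookup_add scaleC_add_left sum.distrib)
  have "Poly_Mapping.keys (c *\<^sub>C x) \<subseteq> Poly_Mapping.keys x"
    by (auto simp: in_keys_iff lookup_scaleC)
  then show "free_lift g (c *\<^sub>C x) = c *\<^sub>C free_lift g x"
    using free_lift_superset[of "Poly_Mapping.keys x" "c *\<^sub>C x" g]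
      free_lift_superset[of "Poly_Mapping.keys x" x g]
    by (simp add: lookup_scaleC scaleC_complex_def cvs.scale_sum_right scaleC_scaleC)
qed

text \<open>The linear map out of the tensor product induced by a bilinear map.\<close>

lift_definition tensor_lift :: "('a::complex_vector \<Rightarrow> 'b::complex_vector \<Rightarrow> 'c::complex_vector)
    \<Rightarrow> ('a, 'b) tensor \<Rightarrow> 'c"
  is "\<lambda>f x. if cbilinear f then free_lift (\<lambda>(a, b). f a b) x else 0"
proof -
  fix f :: "'a \<Rightarrow> 'b \<Rightarrow> 'c" and x y :: "'a \<times> 'b \<Rightarrow>\<^sub>0 complex"
  assume xy: "tensor_rel x y"
  let ?L = "free_lift (\<lambda>(a, b). f a b)"
  show "(if cbilinear f then ?L x else 0) = (if cbilinear f then ?L y else 0)"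
  proof (cases "cbilinear f")
    case True
    then have f: "f (a + a') b = f a b + f a' b" "f a (b + b') = f a b + f a b'"
      "f (c *\<^sub>C a) b = c *\<^sub>C f a b" "f a (c *\<^sub>C b) = c *\<^sub>C f a b" for a a' b b' c
      by (auto simp: cbilinear_def clinear_iff)
    note L = clinear_free_lift[of "\<lambda>(a, b). f a b"]
    have "x - y \<in> cvs.span tensor_relators" using xy by (simp add: tensor_rel_def)
    then have "?L (x - y) = 0"
    proof (induction rule: cvs.span_induct_alt)
      case base
      then show ?case using clinear_zero[OF L] by simp
    next
      case (step c z w)
      have "?L z = 0" using step(1)
        by cases (simp_all add: clinear_diff[OF L] clinear_add[OF L] clinear_scale[OF L]
            free_lift_single f scaleC_one)
      then show ?case using step by (simp add: clinear_add[OF L] clinear_scale[OF L])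
    qed
    then show ?thesis by (simp add: clinear_diff[OF L])
  qed simp
qed

lemma tensor_lift_pure: "cbilinear f \<Longrightarrow> tensor_lift f (a \<otimes>\<^sub>C b) = f a b"
  by transfer (simp add: free_lift_single scaleC_one)

lemma clinear_tensor_lift: "clinear (tensor_lift f)"
proof (rule clinearI)
  show "tensor_lift f (x + y) = tensor_lift f x + tensor_lift f y" for x y
    by transfer (simp add: clinear_add[OF clinear_free_lift])
  show "tensor_lift f (c *\<^sub>C x) = c *\<^sub>C tensor_lift f x" for c x
    by transfer (simp add: clinear_scale[OF clinear_free_lift])
qed


section \<open>Lie algebras and their modules\<close>

class lie_algebra = complex_vector +
  fixes lie_bracket :: "'a \<Rightarrow> 'a \<Rightarrow> 'a"
  assumes lie_add_left: "lie_bracket (x + x') y = lie_bracket x y + lie_bracket x' y"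
    and lie_scale_left: "lie_bracket (c *\<^sub>C x) y = c *\<^sub>C lie_bracket x y"
    and lie_add_right: "lie_bracket x (y + y') = lie_bracket x y + lie_bracket x y'"
    and lie_scale_right: "lie_bracket x (c *\<^sub>C y) = c *\<^sub>C lie_bracket x y"
    and lie_alternating: "lie_bracket x x = 0"
    and lie_jacobi: "lie_bracket x (lie_bracket y z) + lie_bracket y (lie_bracket z x)
          + lie_bracket z (lie_bracket x y) = 0"

lemma lie_anticommute: "lie_bracket x y = - lie_bracket y (x :: 'a::lie_algebra)"
proof -
  have "lie_bracket (x + y) (x + y) = 0" by (rule lie_alternating)
  then have "lie_bracket x y + lie_bracket y x = 0"
    by (simp only: lie_add_left lie_add_right) (simp add: lie_alternating add.commute)
  then show ?thesis by (simp add: eq_neg_iff_add_eq_0)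
qed

text \<open>
  The Lie algebra is a subset \<open>g\<close> of a type, closed under the given bracket, so that the same
  notions serve for \<open>\<tau>\<close>, \<open>gl\<^sub>n\<close> and \<open>sl\<^sub>n\<close>.
\<close>

definition lie_module :: "'g::complex_vector set \<Rightarrow> ('g \<Rightarrow> 'g \<Rightarrow> 'g) \<Rightarrow>
    'm::complex_vector set \<Rightarrow> ('g \<Rightarrow> 'm \<Rightarrow> 'm) \<Rightarrow> bool"
  where "lie_module g br V act \<longleftrightarrow>
    cvs.subspace V \<and>
    (\<forall>x\<in>g. \<forall>v\<in>V. act x v \<in> V) \<and>
    (\<forall>x\<in>g. \<forall>v\<in>V. \<forall>w\<in>V. act x (v + w) = act x v + act x w) \<and>
    (\<forall>x\<in>g. \<forall>c. \<forall>v\<in>V. act x (c *\<^sub>C v) = c *\<^sub>C act x v) \<and>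
    (\<forall>x\<in>g. \<forall>y\<in>g. \<forall>v\<in>V. act (x + y) v = act x v + act y v) \<and>
    (\<forall>c. \<forall>x\<in>g. \<forall>v\<in>V. act (c *\<^sub>C x) v = c *\<^sub>C act x v) \<and>
    (\<forall>x\<in>g. \<forall>y\<in>g. \<forall>v\<in>V. act (br x y) v = act x (act y v) - act y (act x v))"

definition irreducible_module :: "'g set \<Rightarrow> 'm::complex_vector set \<Rightarrow> ('g \<Rightarrow> 'm \<Rightarrow> 'm) \<Rightarrow> bool"
  where "irreducible_module g V act \<longleftrightarrow>
    V \<noteq> {0} \<and>
    (\<forall>N. cvs.subspace N \<and> N \<subseteq> V \<and> (\<forall>x\<in>g. \<forall>v\<in>N. act x v \<in> N) \<longrightarrow> N = {0} \<or> N = V)"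

definition module_iso :: "'g set \<Rightarrow> 'm::complex_vector set \<Rightarrow> ('g \<Rightarrow> 'm \<Rightarrow> 'm) \<Rightarrow>
    'k::complex_vector set \<Rightarrow> ('g \<Rightarrow> 'k \<Rightarrow> 'k) \<Rightarrow> ('m \<Rightarrow> 'k) \<Rightarrow> bool"
  where "module_iso g V actV W actW \<phi> \<longleftrightarrow>
    bij_betw \<phi> V W \<and>
    (\<forall>v\<in>V. \<forall>w\<in>V. \<phi> (v + w) = \<phi> v + \<phi> w) \<and>
    (\<forall>c. \<forall>v\<in>V. \<phi> (c *\<^sub>C v) = c *\<^sub>C \<phi> v) \<and>
    (\<forall>x\<in>g. \<forall>v\<in>V. \<phi> (actV x v) = actW x (\<phi> v))"


section \<open>Derivations and the semidirect product \<open>A \<rtimes> Der A\<close>\<close>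

typedef (overloaded) 'a derivation =
  "{d :: 'a::complex_comm_algebra_1 \<Rightarrow> 'a.
      clinear d \<and> (\<forall>f g. d (f * g) = d f * g + f * d g)}"
  morphisms apply_der Derivation
  by (rule exI[of _ "\<lambda>_. 0"]) (simp add: clinear_iff)

setup_lifting type_definition_derivation

lemma clinear_apply_der: "clinear (apply_der d)"
  and apply_der_mult: "apply_der d (f * g) = apply_der d f * g + f * apply_der d g"
  using apply_der[of d] by auto

lemmas apply_der_add = clinear_add[OF clinear_apply_der]
  and apply_der_diff = clinear_diff[OF clinear_apply_der]
  and apply_der_scale = clinear_scale[OF clinear_apply_der]

lemma derivation_eqI: "(\<And>f. apply_der d f = apply_der e f) \<Longrightarrow> d = e"
  by (metis apply_der_inject ext)

instantiation derivation :: (complex_comm_algebra_1) lie_algebra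
begin
lift_definition zero_derivation :: "'a derivation" is "\<lambda>_. 0"
  by (simp add: clinear_iff)
lift_definition plus_derivation :: "'a derivation \<Rightarrow> 'a derivation \<Rightarrow> 'a derivation"
  is "\<lambda>d e f. d f + e f"
  by (simp add: clinear_iff algebra_simps scaleC_add_right)
lift_definition minus_derivation :: "'a derivation \<Rightarrow> 'a derivation \<Rightarrow> 'a derivation"
  is "\<lambda>d e f. d f - e f"
  by (simp add: clinear_iff algebra_simps cvs.scale_right_diff_distrib)
lift_definition uminus_derivation :: "'a derivation \<Rightarrow> 'a derivation"
  is "\<lambda>d f. - d f"
  by (simp add: clinear_iff algebra_simps)
lift_definition scaleC_derivation :: "complex \<Rightarrow> 'a derivation \<Rightarrow> 'a derivation"
  is "\<lambda>c d f. c *\<^sub>C d f"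
  by (simp add: clinear_iff algebra_simps scaleC_add_right scaleC_mult_left scaleC_mult_right
      cvs.scale_left_commute)
lift_definition lie_bracket_derivation :: "'a derivation \<Rightarrow> 'a derivation \<Rightarrow> 'a derivation"
  is "\<lambda>d e f. d (e f) - e (d f)"
  by (simp add: clinear_iff algebra_simps cvs.scale_right_diff_distrib)
lemma apply_der_simps:
  "apply_der 0 f = 0" "apply_der (d + e) f = apply_der d f + apply_der e f"
  "apply_der (d - e) f = apply_der d f - apply_der e f" "apply_der (- d) f = - apply_der d f"
  "apply_der (c *\<^sub>C d) f = c *\<^sub>C apply_der d f"
  "apply_der (lie_bracket d e) f = apply_der d (apply_der e f) - apply_der e (apply_der d f)"
  by (transfer, simp)+
instance
  by standard (rule derivation_eqI, simp add: apply_der_simps apply_der_add apply_der_diff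
      apply_der_scale algebra_simps scaleC_add_right scaleC_add_left scaleC_scaleC scaleC_one
      cvs.scale_right_diff_distrib)+
end

text \<open>A separate type, as the direct sum of the two Lie algebras would have another bracket.\<close>

context notes [[typedef_overloaded]] begin
datatype 'a semidirect =
  Semidirect (fun_part: "'a::complex_comm_algebra_1") (der_part: "'a derivation")
end

instantiation semidirect :: (complex_comm_algebra_1) lie_algebra
begin
definition "0 = Semidirect 0 0"
definition "x + y = Semidirect (fun_part x + fun_part y) (der_part x + der_part y)"
definition "x - y = Semidirect (fun_part x - fun_part y) (der_part x - der_part y)"
definition "- x = Semidirect (- fun_part x) (- der_part x)"
definition "c *\<^sub>C x = Semidirect (c *\<^sub>C fun_part x) (c *\<^sub>C der_part x)"
definition "lie_bracket x y =
  Semidirect (apply_der (der_part x) (fun_part y) - apply_der (der_part y) (fun_part x))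
    (lie_bracket (der_part x) (der_part y))"
instance
  by standard (simp_all add: zero_semidirect_def plus_semidirect_def minus_semidirect_def
      uminus_semidirect_def scaleC_semidirect_def lie_bracket_semidirect_def
      scaleC_add_right scaleC_add_left scaleC_scaleC scaleC_one
      lie_add_left lie_add_right lie_scale_left lie_scale_right lie_alternating
      lie_jacobi[unfolded add.assoc]
      apply_der_simps apply_der_add apply_der_diff apply_der_scale
      cvs.scale_right_diff_distrib algebra_simps)
end

abbreviation of_fun :: "'a::complex_comm_algebra_1 \<Rightarrow> 'a semidirect"
  where "of_fun f \<equiv> Semidirect f 0"

abbreviation of_der :: "'a::complex_comm_algebra_1 derivation \<Rightarrow> 'a semidirect"
  where "of_der d \<equiv> Semidirect 0 d"


section \<open>The Lie bracket on \<open>L \<otimes> B\<close>\<close>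

instantiation tensor :: (lie_algebra, complex_comm_algebra_1) lie_algebra
begin

definition "lie_bracket x y =
  tensor_lift (\<lambda>X b. tensor_lift (\<lambda>Y b'. lie_bracket X Y \<otimes>\<^sub>C (b * b')) y) x"

lemma cbilinear_bracket_aux: "cbilinear (\<lambda>Y b'. lie_bracket X Y \<otimes>\<^sub>C (b * b'))"
  for X :: "'a::lie_algebra" and b :: "'b::complex_comm_algebra_1"
  unfolding cbilinear_def
  by (intro conjI allI clinearI)
    (simp_all add: lie_add_right lie_scale_right tensor_add_left tensor_add_right
      tensor_scale_left tensor_scale_right distrib_left scaleC_mult_right)

lemma cbilinear_bracket:
  "cbilinear (\<lambda>X b. tensor_lift (\<lambda>Y b'. lie_bracket X Y \<otimes>\<^sub>C (b * b')) y)"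
  for y :: "('a::lie_algebra, 'b::complex_comm_algebra_1) tensor"
proof (induction y rule: tensor_induct)
  case (pure Y b')
  show ?case
    unfolding tensor_lift_pure[OF cbilinear_bracket_aux] cbilinear_def
    by (intro conjI allI clinearI)
      (simp_all add: lie_add_left lie_scale_left tensor_add_left tensor_add_right
        tensor_scale_left tensor_scale_right distrib_right scaleC_mult_left)
next
  case (add x y)
  then show ?case
    unfolding clinear_add[OF clinear_tensor_lift] cbilinear_def clinear_iff
    by (simp add: scaleC_add_right algebra_simps)
qed

lemma lie_bracket_tensor:
  "lie_bracket (X \<otimes>\<^sub>C b) (Y \<otimes>\<^sub>C b') = lie_bracket X Y \<otimes>\<^sub>C (b * b')"
  for X Y :: "'a::lie_algebra" and b b' :: "'b::complex_comm_algebra_1"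
  unfolding lie_bracket_tensor_def tensor_lift_pure[OF cbilinear_bracket]
  by (rule tensor_lift_pure[OF cbilinear_bracket_aux])

instance
proof
  fix x x' y y' z :: "('a, 'b) tensor" and c
  show al: "lie_bracket (x + x') y = lie_bracket x y + lie_bracket x' y" for x x' y :: "('a, 'b) tensor"
    unfolding lie_bracket_tensor_def by (rule clinear_add[OF clinear_tensor_lift])
  show sl: "lie_bracket (c *\<^sub>C x) y = c *\<^sub>C lie_bracket x y" for x y :: "('a, 'b) tensor"
    unfolding lie_bracket_tensor_def by (rule clinear_scale[OF clinear_tensor_lift])
  show ar: "lie_bracket x (y + y') = lie_bracket x y + lie_bracket x y'" for x y y' :: "('a, 'b) tensor"
  proof (induction x rule: tensor_induct)
    case (pure X b)
    then show ?case
      unfolding lie_bracket_tensor_def tensor_lift_pure[OF cbilinear_bracket]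
      by (rule clinear_add[OF clinear_tensor_lift])
  qed (simp add: al)
  show "lie_bracket x (c *\<^sub>C y) = c *\<^sub>C lie_bracket x y"
  proof (induction x rule: tensor_induct)
    case (pure X b)
    then show ?case
      unfolding lie_bracket_tensor_def tensor_lift_pure[OF cbilinear_bracket]
      by (rule clinear_scale[OF clinear_tensor_lift])
  qed (simp add: al scaleC_add_right)
  have neg: "(- a) \<otimes>\<^sub>C b = - (a \<otimes>\<^sub>C b)" for a :: 'a and b :: 'b
    using tensor_scale_left[of "-1" a b] by (simp add: scaleC_one)
  have anti: "lie_bracket x y + lie_bracket y x = 0" for x y :: "('a, 'b) tensor"
  proof (induction x rule: tensor_induct)
    case (pure X b)
    show ?case
    proof (induction y rule: tensor_induct)
      case (pure Y b')
      show ?case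
        unfolding lie_bracket_tensor
        by (subst lie_anticommute) (simp add: neg mult.commute)
    next
      case (add y y')
      have "lie_bracket (X \<otimes>\<^sub>C b) (y + y') + lie_bracket (y + y') (X \<otimes>\<^sub>C b) = (lie_bracket (X \<otimes>\<^sub>C b) y + lie_bracket y (X \<otimes>\<^sub>C b))
          + (lie_bracket (X \<otimes>\<^sub>C b) y' + lie_bracket y' (X \<otimes>\<^sub>C b))"
        by (simp only: al ar add_ac)
      then show ?case using add by simp
    qed
  next
    case (add x x')
    have "lie_bracket (x + x') y + lie_bracket y (x + x') = (lie_bracket x y + lie_bracket y x)
          + (lie_bracket x' y + lie_bracket y x')"
        by (simp only: al ar add_ac)
      then show ?case using add by simp
  qed
  show "lie_bracket x x = 0"
  proof (induction x rule: tensor_induct)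
    case (pure X b)
    have "(0::'a) \<otimes>\<^sub>C b' = 0" for b' :: 'b
      using tensor_scale_left[of 0 "0::'a" b'] by simp
    then show ?case by (simp add: lie_bracket_tensor lie_alternating)
  next
    case (add x y)
    then show ?case using anti[of y x] by (simp add: al ar)
  qed
  let ?J = "\<lambda>x y z :: ('a, 'b) tensor. lie_bracket x (lie_bracket y z)
    + lie_bracket y (lie_bracket z x) + lie_bracket z (lie_bracket x y)"
  have Jx: "?J (x + x') y z = ?J x y z + ?J x' y z"
    and Jy: "?J x (y + y') z = ?J x y z + ?J x y' z"
    and Jz: "?J x y (z + z') = ?J x y z + ?J x y z'" for x x' y y' z z'
    by (simp_all add: al ar algebra_simps)
  show "?J x y z = 0"
  proof (induction x rule: tensor_induct)
    case (pure X a)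
    show ?case
    proof (induction y rule: tensor_induct)
      case (pure Y b)
      show ?case
      proof (induction z rule: tensor_induct)
        case (pure Z d)
        have "?J (X \<otimes>\<^sub>C a) (Y \<otimes>\<^sub>C b) (Z \<otimes>\<^sub>C d) =
          (lie_bracket X (lie_bracket Y Z) + lie_bracket Y (lie_bracket Z X)
            + lie_bracket Z (lie_bracket X Y)) \<otimes>\<^sub>C (a * b * d)"
          unfolding lie_bracket_tensor tensor_add_left by (simp add: mult_ac)
        also have "\<dots> = 0"
          unfolding lie_jacobi using tensor_scale_left[of 0 "0::'a" "a * b * d"] by simp
        finally show ?case .
      next
        case (add z z')
        then show ?case unfolding Jz by simp
      qed
    next
      case (add y y')
      then show ?case unfolding Jy by simp
    qed
  next
    case (add x x')
    then show ?case unfolding Jx by simp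
  qed
qed

end


section \<open>Laurent polynomials and the Lie algebra \<open>\<tau>\<close>\<close>

text \<open>
  \<open>A\<close> is the group algebra of \<open>\<int>\<^sup>n\<close>; the number of variables is the cardinality of \<open>'n\<close>.
\<close>

type_synonym 'n laurent = "(int ^ 'n) \<Rightarrow>\<^sub>0 complex"

type_synonym ('n, 'b) tau = "('n laurent semidirect, 'b) tensor"

definition tpow :: "int ^ 'n::finite \<Rightarrow> 'n laurent"
  where "tpow r = Poly_Mapping.single r 1"

definition cvec :: "int ^ 'n \<Rightarrow> complex ^ 'n"
  where "cvec r = (\<chi> i. of_int (r $ i))"

text \<open>The bilinear (not Hermitian) form on \<open>\<complex>\<^sup>n\<close>.\<close>

definition cdot :: "complex ^ 'n \<Rightarrow> complex ^ 'n::finite \<Rightarrow> complex"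
  where "cdot u v = (\<Sum>i\<in>UNIV. u $ i * v $ i)"

text \<open>\<open>t\<^sub>i d/dt\<^sub>i\<close>\<close>

lift_definition euler :: "'n::finite \<Rightarrow> 'n laurent \<Rightarrow> 'n laurent"
  is "\<lambda>i f s. of_int (s $ i) * f s"
  by (erule finite_subset[rotated]) auto

lemma lookup_euler: "Poly_Mapping.lookup (euler i f) s = of_int (s $ i) * Poly_Mapping.lookup f s"
  by transfer simp

lemma clinear_euler: "clinear (euler i)"
  by (rule clinearI; rule poly_mapping_eqI)
    (simp_all add: lookup_euler lookup_add lookup_scaleC scaleC_complex_def algebra_simps)

lemma euler_single: "euler i (Poly_Mapping.single s c) = Poly_Mapping.single s (of_int (s $ i) * c)"
  by (rule poly_mapping_eqI) (auto simp: lookup_euler lookup_single when_def)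

lemma euler_mult: "euler i (f * g) = euler i f * g + f * euler i g"
proof (induction f rule: poly_mapping_additive_induct)
  case (single k a)
  show ?case
  proof (induction g rule: poly_mapping_additive_induct)
    case (single l b)
    show ?case
      by (simp add: mult_single euler_single single_add[symmetric] algebra_simps)
  next
    case (add f g)
    then show ?case by (simp add: distrib_left clinear_add[OF clinear_euler] algebra_simps)
  qed
next
  case (add f g)
  then show ?case by (simp add: distrib_right clinear_add[OF clinear_euler] algebra_simps)
qed

text \<open>\<open>D(u,r) = \<Sum>\<^sub>i u\<^sub>i t\<^sup>r t\<^sub>i d/dt\<^sub>i\<close>\<close>

lift_definition Dop :: "complex ^ 'n::finite \<Rightarrow> int ^ 'n \<Rightarrow> 'n laurent derivation"
  is "\<lambda>u r f. \<Sum>i\<in>UNIV. u $ i *\<^sub>C (tpow r * euler i f)"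
  by (auto simp: clinear_iff clinear_add[OF clinear_euler] clinear_scale[OF clinear_euler]
      euler_mult distrib_left distrib_right scaleC_add_right sum.distrib scaleC_mult_left
      scaleC_mult_right cvs.scale_sum_right sum_distrib_left sum_distrib_right
      cvs.scale_left_commute mult_ac)

lemma single_sum: "Poly_Mapping.single k (sum f I) = (\<Sum>i\<in>I. Poly_Mapping.single k (f i))"
  by (induction I rule: infinite_finite_induct) (simp_all add: single_add)

lemma Dop_tpow: "apply_der (Dop u r) (tpow s) = cdot u (cvec s) *\<^sub>C tpow (r + s)"
  by transfer (simp add: tpow_def euler_single mult_single scaleC_single scaleC_complex_def
      cdot_def cvec_def single_sum)

lemma lie_bracket_Dop_Dop:
  "lie_bracket (Dop u r) (Dop v s) =
    Dop (cdot u (cvec s) *\<^sub>C v - cdot v (cvec r) *\<^sub>C u) (r + s)"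
proof (rule derivation_eqI)
  have scale: "cdot (c *\<^sub>C u - d *\<^sub>C v) w = c * cdot u w - d * cdot v w"
    for c d and u v w :: "complex ^ 'n"
    by (simp add: cdot_def scaleC_vec_def scaleC_complex_def sum_subtractf sum_distrib_left
        algebra_simps)
  have plus: "cdot u (cvec (a + b)) = cdot u (cvec a) + cdot u (cvec b)"
    for u and a b :: "int ^ 'n"
    by (simp add: cdot_def cvec_def sum.distrib algebra_simps)
  fix f
  show "apply_der (lie_bracket (Dop u r) (Dop v s)) f =
    apply_der (Dop (cdot u (cvec s) *\<^sub>C v - cdot v (cvec r) *\<^sub>C u) (r + s)) f"
  proof (induction f rule: poly_mapping_additive_induct)
    case (single m c)
    have "Poly_Mapping.single m c = c *\<^sub>C tpow m"
      by (simp add: tpow_def scaleC_single scaleC_complex_def)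
    then show ?case
      by (simp add: apply_der_simps apply_der_scale Dop_tpow scale plus scaleC_scaleC
          cvs.scale_left_diff_distrib[symmetric] add_ac)
        (simp add: algebra_simps)
  qed (simp add: apply_der_add)
qed

lemma lie_bracket_Dop_tpow:
  "lie_bracket (of_der (Dop u r)) (of_fun (tpow s)) = of_fun (cdot u (cvec s) *\<^sub>C tpow (r + s))"
  using lie_scale_right[of "Dop u r" 0 0]
  by (simp add: lie_bracket_semidirect_def Dop_tpow apply_der_simps)

definition tau_D :: "complex ^ 'n::finite \<Rightarrow> int ^ 'n \<Rightarrow> 'b::complex_comm_algebra_1 \<Rightarrow> ('n, 'b) tau"
  where "tau_D u r b = of_der (Dop u r) \<otimes>\<^sub>C b"

definition tau_t :: "int ^ 'n::finite \<Rightarrow> 'b::complex_comm_algebra_1 \<Rightarrow> ('n, 'b) tau"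
  where "tau_t r b = of_fun (tpow r) \<otimes>\<^sub>C b"


section \<open>Weight modules\<close>

text \<open>\<open>H = \<complex> t\<^sup>0 \<oplus> {D(u,0) | u \<in> \<complex>\<^sup>n}\<close>\<close>

definition H_sub :: "'n::finite laurent semidirect set"
  where "H_sub = {of_fun (c *\<^sub>C tpow 0) + of_der (Dop u 0) | c u. True}"

text \<open>
  Functionals on a subspace \<open>S\<close> are represented by functions vanishing outside \<open>S\<close>, so that
  distinct elements of \<open>dual_space S\<close> are distinct functionals on \<open>S\<close>.
\<close>

definition dual_space :: "'a::complex_vector set \<Rightarrow> ('a \<Rightarrow> complex) set"
  where "dual_space S = {l.
    (\<forall>x\<in>S. \<forall>y\<in>S. l (x + y) = l x + l y) \<and> (\<forall>c. \<forall>x\<in>S. l (c *\<^sub>C x) = c * l x) \<and>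
    (\<forall>x. x \<notin> S \<longrightarrow> l x = 0)}"

definition weight_space :: "(('n::finite, 'b::complex_comm_algebra_1) tau \<Rightarrow> 'v \<Rightarrow> 'v) \<Rightarrow>
    ('n laurent semidirect \<Rightarrow> complex) \<Rightarrow> 'v::complex_vector set"
  where "weight_space act l = {v. \<forall>h\<in>H_sub. act (h \<otimes>\<^sub>C 1) v = l h *\<^sub>C v}"

definition direct_sum :: "'i set \<Rightarrow> ('i \<Rightarrow> 'a::complex_vector set) \<Rightarrow> 'a set \<Rightarrow> bool"
  where "direct_sum I U V \<longleftrightarrow>
    (\<forall>i\<in>I. cvs.subspace (U i) \<and> U i \<subseteq> V) \<and>
    (\<forall>v\<in>V. \<exists>!f. (\<forall>i\<in>I. f i \<in> U i) \<and> (\<forall>i. i \<notin> I \<longrightarrow> f i = 0) \<and> finite {i. f i \<noteq> 0} \<and>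
      v = (\<Sum>i | f i \<noteq> 0. f i))"

definition weight_module ::
    "(('n::finite, 'b::complex_comm_algebra_1) tau \<Rightarrow> 'v::complex_vector \<Rightarrow> 'v) \<Rightarrow> bool"
  where "weight_module act \<longleftrightarrow> direct_sum (dual_space H_sub) (weight_space act) UNIV"


section \<open>The modules \<open>V(\<mu>, c)\<close> and \<open>F\<^sup>\<alpha>(\<mu>, c)\<close>\<close>

definition commutator :: "complex ^ 'n ^ 'n \<Rightarrow> complex ^ 'n ^ 'n \<Rightarrow> complex ^ 'n ^ 'n::finite"
  where "commutator X Y = X ** Y - Y ** X"

definition sl :: "(complex ^ 'n ^ 'n::finite) set"
  where "sl = {X. trace X = 0}"

definition sl_cartan :: "(complex ^ 'n ^ 'n::finite) set"
  where "sl_cartan = {X \<in> sl. \<forall>i j. i \<noteq> j \<longrightarrow> X $ i $ j = 0}"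

definition matrix_unit :: "'n \<Rightarrow> 'n \<Rightarrow> complex ^ 'n ^ 'n::finite"
  where "matrix_unit i j = (\<chi> k l. if k = i \<and> l = j then 1 else 0)"

text \<open>
  The linear order on the index type \<open>'n\<close> fixes the positive roots, which are those of the
  \<open>E\<^sub>i\<^sub>j\<close> with \<open>i < j\<close>; the corresponding coroots are \<open>E\<^sub>i\<^sub>i - E\<^sub>j\<^sub>j\<close>.
\<close>

definition dominant_integral ::
    "(complex ^ 'n::{finite,linorder} ^ 'n::{finite,linorder} \<Rightarrow> complex) \<Rightarrow> bool"
  where "dominant_integral \<mu> \<longleftrightarrow> \<mu> \<in> dual_space sl_cartan \<and>
    (\<forall>i j. i < j \<longrightarrow> \<mu> (matrix_unit i i - matrix_unit j j) \<in> \<nat>)"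

text \<open>
  \<open>W\<close> with the action \<open>\<rho>\<close> of \<open>gl\<^sub>n\<close> is (a copy of) \<open>V(\<mu>, c)\<close>. As an \<open>sl\<^sub>n\<close>-module it is
  \<open>V(\<mu>)\<close>, the finite-dimensional irreducible module of highest weight \<open>\<mu>\<close>, which is unique up to
  isomorphism.
\<close>

definition is_V ::
    "(complex ^ 'n::{finite,linorder} ^ 'n::{finite,linorder} \<Rightarrow> complex) \<Rightarrow> complex \<Rightarrow>
    'w::complex_vector set \<Rightarrow> (complex ^ 'n::{finite,linorder} ^ 'n::{finite,linorder} \<Rightarrow> 'w \<Rightarrow> 'w) \<Rightarrow> bool"
  where "is_V \<mu> c W \<rho> \<longleftrightarrow>
    lie_module UNIV commutator W \<rho> \<and>
    finite_dim W \<and>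
    irreducible_module sl W \<rho> \<and>
    (\<exists>w\<in>W. w \<noteq> 0 \<and> (\<forall>i j. i < j \<longrightarrow> \<rho> (matrix_unit i j) w = 0) \<and>
      (\<forall>h\<in>sl_cartan. \<rho> h w = \<mu> h *\<^sub>C w)) \<and>
    (\<forall>w\<in>W. \<rho> (mat 1) w = c *\<^sub>C w)"

text \<open>\<open>W \<otimes> A\<close> for a subspace \<open>W\<close>, as a subspace of the tensor product of the ambient spaces.\<close>

definition tensor_laurent :: "'w::complex_vector set \<Rightarrow> ('w, 'n::finite laurent) tensor set"
  where "tensor_laurent W = cvs.span {w \<otimes>\<^sub>C f | w f. w \<in> W}"

text \<open>
  \<open>act\<close> makes \<open>W \<otimes> A\<close> the \<open>\<tau>\<close>-module \<open>F\<^sup>\<alpha>(\<mu>, c)\<close>, for \<open>W\<close> a copy of \<open>V(\<mu>, c)\<close>. The two formulas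
  determine \<open>act\<close> on \<open>W \<otimes> A\<close>, as the elements they involve span \<open>\<tau>\<close> and \<open>W \<otimes> A\<close>.
\<close>

definition is_F :: "complex ^ 'n::finite \<Rightarrow> ('b::complex_comm_algebra_1 \<Rightarrow> complex) \<Rightarrow>
    'w::complex_vector set \<Rightarrow> (complex ^ 'n ^ 'n \<Rightarrow> 'w \<Rightarrow> 'w) \<Rightarrow>
    (('n, 'b) tau \<Rightarrow> ('w, 'n laurent) tensor \<Rightarrow> ('w, 'n laurent) tensor) \<Rightarrow> bool"
  where "is_F \<alpha> \<psi> W \<rho> act \<longleftrightarrow>
    lie_module UNIV lie_bracket (tensor_laurent W) act \<and>
    (\<forall>u r b. \<forall>w\<in>W. \<forall>m.
      act (tau_D u r b) (w \<otimes>\<^sub>C tpow m) =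
        \<psi> b *\<^sub>C (cdot u (cvec m + \<alpha>) *\<^sub>C (w \<otimes>\<^sub>C tpow (m + r))
          + (\<Sum>i\<in>UNIV. \<Sum>j\<in>UNIV.
              (u $ i * of_int (r $ j)) *\<^sub>C (\<rho> (matrix_unit j i) w \<otimes>\<^sub>C tpow (m + r))))) \<and>
    (\<forall>r b. \<forall>w\<in>W. \<forall>m. act (tau_t r b) (w \<otimes>\<^sub>C tpow m) = \<psi> b *\<^sub>C (w \<otimes>\<^sub>C tpow (r + m)))"

end

(* Let U be one weight space and pr the projection of V onto U that identifies each T_m U with U,
   where T_m is the action of t^m; U is the fibre V/mV at t = 1. By Schur's lemma B acts on V
   through a character psi. The vector fields f d/dt_i (x) b that vanish at the point (1, psi) act on
   U through pr, irreducibly. The Euler field E = sum y_i d/dt_i with y_i = t_i - 1 acts on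
   homogeneous fields by distinct integers, so fields of high order act by zero on the
   finite-dimensional U. Fields of order at least two at t = 1 kill a top eigenvector of E, and fields
   with coefficients in ker psi have a common null vector (removing powers of ker psi one at a time);
   these null spaces are submodules, hence all of U. So only the quotient gl_n, spanned by the classes
   of the y_j d/dt_i, acts on U, which is therefore some V(mu, c), and V is rebuilt from U by the T_m. *)

theory Submission
  imports Defs "HOL-Computational_Algebra.Fundamental_Theorem_Algebra"
begin

section \<open>Operators on finite-dimensional subspaces\<close>

text \<open>A field such as d/dt_i does not preserve mV, so U is a module only over the fields that
  vanish at (1, psi). Little is lost: d/dt_i + y_i d/dt_i = t_i d/dt_i is D(e_i, 0), a scalar
  alpha_i on U. This makes the action of the smaller algebra irreducible and brings alpha into the
  final formula. The grading by E exists only for polynomials in the y_i, while t_i^(-1) is an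
  infinite series in y_i. Laurent coefficients are therefore reduced modulo an ideal of coefficients
  that act by zero and in which the geometric series becomes finite. A bracket of fields with
  coefficients c and b has coefficient c b. A null space defined by c is seen to be stable only once
  c (ker psi) acts by zero, because c b then acts as psi(b) c. This forces the descent through the
  powers of ker psi. It can start because order of vanishing at t = 1 can be traded for factors in
  ker psi: enough such factors make every coefficient act by zero.\<close>

lemma scaleC_complex [simp]: "c *\<^sub>C (x::complex) = c * x"
  by (simp add: scaleC_complex_def)

lemma clinear_sum: "clinear f \<Longrightarrow> f (\<Sum>i\<in>I. g i) = (\<Sum>i\<in>I. f (g i))"
  by (induction I rule: infinite_finite_induct) (simp_all add: clinear_zero clinear_add)

lemma clinear_compose: "clinear f \<Longrightarrow> clinear g \<Longrightarrow> clinear (\<lambda>x. f (g x))"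
  by (simp add: clinear_iff)

lemma finite_dim_subset: "finite_dim V \<Longrightarrow> W \<subseteq> V \<Longrightarrow> finite_dim W"
  by (auto simp: finite_dim_def)

lemma clinear_pow: "clinear f \<Longrightarrow> clinear (f ^^ i)" for f :: "'v::complex_vector \<Rightarrow> 'v"
  by (induction i) (simp_all add: clinear_iff)

lemma pow_mem: "(\<And>w. w \<in> S \<Longrightarrow> f w \<in> S) \<Longrightarrow> w \<in> S \<Longrightarrow> (f ^^ i) w \<in> S" for f :: "'v \<Rightarrow> 'v"
  by (induction i) simp_all

lemma clinear_subspace_image:
  assumes "clinear f" "cvs.subspace S"
  shows "cvs.subspace (f ` S)"
proof -
  have "module_hom scaleC scaleC f" using assms(1) by (simp add: Vector_Spaces.linear_def)
  from module_hom.subspace_image[OF this assms(2)] show ?thesis .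
qed

lemma clinear_vanish_span:
  assumes "clinear f" "\<And>x. x \<in> X \<Longrightarrow> f x = 0" "x \<in> cvs.span X"
  shows "f x = 0"
  using assms(3)
  by (induction rule: cvs.span_induct_alt)
    (simp_all add: clinear_zero[OF assms(1)] clinear_add[OF assms(1)] clinear_scale[OF assms(1)] assms(2))

section \<open>Annihilating products of linear factors, and eigenvectors\<close>

definition poly_op :: "('v::complex_vector \<Rightarrow> 'v) \<Rightarrow> complex poly \<Rightarrow> 'v \<Rightarrow> 'v"
  where "poly_op f p w = (\<Sum>i\<le>degree p. coeff p i *\<^sub>C (f ^^ i) w)"

lemma poly_op_bound:
  assumes "degree p < n"
  shows "poly_op f p w = (\<Sum>i<n. coeff p i *\<^sub>C (f ^^ i) w)"
  unfolding poly_op_def using assms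
  by (intro sum.mono_neutral_left) (auto intro: le_degree)

lemma poly_op_linear_factor:
  assumes f: "clinear f"
  shows "poly_op f ([:- l, 1:] * q) w = poly_op f q (f w - l *\<^sub>C w)"
proof -
  define n where "n = Suc (degree q)"
  have eq: "[:- l, 1:] * q = pCons 0 q - smult l q"
    by (simp add: algebra_simps)
  have d: "degree ([:- l, 1:] * q) < Suc n"
    unfolding n_def by (rule le_less_trans[OF degree_mult_le]) simp
  have "poly_op f ([:- l, 1:] * q) w
      = (\<Sum>i<Suc n. coeff (pCons 0 q) i *\<^sub>C (f ^^ i) w) - (\<Sum>i<Suc n. (l * coeff q i) *\<^sub>C (f ^^ i) w)"
    unfolding poly_op_bound[OF d] unfolding eq
    by (simp add: cvs.scale_left_diff_distrib sum_subtractf del: sum.lessThan_Suc)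
  also have "(\<Sum>i<Suc n. coeff (pCons 0 q) i *\<^sub>C (f ^^ i) w) = (\<Sum>i<n. coeff q i *\<^sub>C (f ^^ i) (f w))"
    unfolding sum.lessThan_Suc_shift by (simp add: funpow_swap1)
  also have "(\<Sum>i<Suc n. (l * coeff q i) *\<^sub>C (f ^^ i) w) = (\<Sum>i<n. coeff q i *\<^sub>C (f ^^ i) (l *\<^sub>C w))"
    using coeff_eq_0[of q n] unfolding n_def
    by (simp add: clinear_scale[OF clinear_pow[OF f]] scaleC_scaleC mult.commute)
  also have "(\<Sum>i<n. coeff q i *\<^sub>C (f ^^ i) (f w)) - \<dots> = poly_op f q (f w - l *\<^sub>C w)"
    by (subst poly_op_bound[of q n])
      (simp_all add: n_def clinear_diff[OF clinear_pow[OF f]] cvs.scale_right_diff_distrib sum_subtractf)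
  finally show ?thesis .
qed

text \<open>The n + 1 vectors \<open>(f ^^ i) w\<close> with i at most n lie in the span of n
  vectors. Coincidences among them are treated apart, because linear dependence of the set of values
  does not see repetitions.\<close>

lemma poly_op_annihilator:
  assumes f: "clinear f" and S: "finite_dim S" "\<And>w. w \<in> S \<Longrightarrow> f w \<in> S" and w: "w \<in> S"
  shows "\<exists>p. p \<noteq> 0 \<and> poly_op f p w = 0"
proof -
  obtain T where T: "finite T" "S \<subseteq> cvs.span T" using S(1) by (auto simp: finite_dim_def)
  define n where "n = card T"
  let ?g = "\<lambda>i. (f ^^ i) w"
  have gS: "?g i \<in> cvs.span T" for i using pow_mem[of S f, OF S(2) w] T(2) by blast
  show ?thesis
  proof (cases "inj_on ?g {..n}")
    case False
    then obtain i j where ij: "i < j" "?g i = ?g j"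
      unfolding inj_on_def by (metis linorder_neqE_nat)
    define p :: "complex poly" where "p = monom 1 j - monom 1 i"
    have "coeff p j = 1" using ij by (simp add: p_def)
    then have "p \<noteq> 0" by auto
    have "degree p < Suc j"
      unfolding p_def less_Suc_eq_le using ij by (intro degree_diff_le) (simp_all add: degree_monom_eq)
    then have "poly_op f p w = (\<Sum>k<Suc j. coeff p k *\<^sub>C ?g k)" by (rule poly_op_bound)
    also have "\<dots> = (\<Sum>k<Suc j. (if k = j then ?g k else 0) - (if k = i then ?g k else 0))"
      by (rule sum.cong) (auto simp: p_def scaleC_one)
    also have "\<dots> = 0" using ij by (simp add: sum_subtractf del: sum.lessThan_Suc)
    finally show ?thesis using \<open>p \<noteq> 0\<close> by blast
  next
    case True
    have "cvs.dependent (?g ` {..n})"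
    proof (rule ccontr)
      assume "cvs.independent (?g ` {..n})"
      then have "card (?g ` {..n}) \<le> card T"
        using cvs.independent_span_bound[OF T(1)] gS by blast
      then show False using True by (simp add: card_image n_def)
    qed
    then obtain u where u: "\<exists>v\<in>?g ` {..n}. u v \<noteq> 0" "(\<Sum>v\<in>?g ` {..n}. u v *\<^sub>C v) = 0"
      by (auto simp: cvs.dependent_finite)
    define p where "p = (\<Sum>i\<le>n. monom (u (?g i)) i)"
    have cp: "coeff p i = (if i \<le> n then u (?g i) else 0)" for i
      by (simp add: p_def coeff_sum if_distrib cong: if_cong)
    then have "p \<noteq> 0" using u(1) by (metis (no_types, lifting) atMost_iff coeff_0 image_iff)
    have "degree p < Suc n" by (simp add: cp degree_le less_Suc_eq_le)
    then have "poly_op f p w = (\<Sum>k\<le>n. coeff p k *\<^sub>C ?g k)"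
      by (subst poly_op_bound) (auto simp: lessThan_Suc_atMost)
    also have "\<dots> = (\<Sum>k\<le>n. u (?g k) *\<^sub>C ?g k)" by (simp add: cp)
    also have "\<dots> = 0" using u(2) True by (simp add: sum.reindex)
    finally show ?thesis using \<open>p \<noteq> 0\<close> by blast
  qed
qed

fun shifts :: "('v::complex_vector \<Rightarrow> 'v) \<Rightarrow> complex list \<Rightarrow> 'v \<Rightarrow> 'v"
  where "shifts f [] w = w"
  | "shifts f (c # L) w = shifts f L (f w - c *\<^sub>C w)"

lemma shifts_append: "shifts f (L @ M) w = shifts f M (shifts f L w)"
  by (induction L arbitrary: w) simp_all

lemma clinear_shifts: "clinear f \<Longrightarrow> clinear (shifts f L)"
proof (induction L)
  case (Cons c L)
  have "clinear (\<lambda>w. f w - c *\<^sub>C w)"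
    using Cons.prems by (simp add: clinear_iff cvs.scale_right_diff_distrib scaleC_add_right mult.commute)
  then show ?case using clinear_compose[OF Cons.IH[OF Cons.prems]] by simp
qed (simp add: clinear_iff)

lemma shifts_commute1: "clinear f \<Longrightarrow> shifts f L (f w - c *\<^sub>C w) = f (shifts f L w) - c *\<^sub>C shifts f L w"
proof (induction L arbitrary: w)
  case (Cons d L)
  have "f (f w - c *\<^sub>C w) - d *\<^sub>C (f w - c *\<^sub>C w) = f (f w - d *\<^sub>C w) - c *\<^sub>C (f w - d *\<^sub>C w)"
    using Cons.prems
    by (simp add: clinear_diff clinear_scale cvs.scale_right_diff_distrib cvs.scale_left_commute)
  then show ?case using Cons by simp
qed simp

lemma shifts_commute: "clinear f \<Longrightarrow> shifts f L (shifts f M w) = shifts f M (shifts f L w)"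
  by (induction M arbitrary: w) (simp_all add: shifts_commute1)

text \<open>Apply the factors one by one and stop at the first vector that the next factor carries
  into \<open>N\<close>: it is an eigenvector modulo \<open>N\<close>. With \<open>N = {0}\<close>
  this yields eigenvectors, and with the kernel of a second operator it yields
  \<open>ad_eigenvector_vanishes\<close>.\<close>

lemma shifts_drop:
  assumes "w \<in> S" "shifts f L w \<in> N" "w \<notin> N"
    and S: "cvs.subspace S" "\<And>w. w \<in> S \<Longrightarrow> f w \<in> S"
  shows "\<exists>w'\<in>S. \<exists>c\<in>set L. w' \<notin> N \<and> f w' - c *\<^sub>C w' \<in> N"
  using assms(1-3)
proof (induction L arbitrary: w)
  case (Cons c L)
  have "f w - c *\<^sub>C w \<in> S" using Cons.prems(1) S by (simp add: cvs.subspace_diff cvs.subspace_scale)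
  then show ?case
    using Cons.IH[of "f w - c *\<^sub>C w"] Cons.prems by (cases "f w - c *\<^sub>C w \<in> N") auto
qed simp

lemma poly_op_zero_shifts:
  assumes f: "clinear f"
  shows "p \<noteq> 0 \<Longrightarrow> poly_op f p w = 0 \<Longrightarrow> \<exists>L. shifts f L w = 0"
proof (induction "degree p" arbitrary: p w)
  case 0
  then obtain c where "p = [:c:]" by (metis degree_eq_zeroE)
  then show ?case using 0 by (auto simp: poly_op_def intro: exI[of _ "[]"])
next
  case (Suc n)
  then have "\<not> constant (poly p)" by (simp add: constant_degree)
  then obtain l where "poly p l = 0" using fundamental_theorem_of_algebra by blast
  then obtain q where q: "p = [:- l, 1:] * q" by (auto simp: poly_eq_0_iff_dvd)
  then have "q \<noteq> 0" using Suc.prems by auto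
  then have "degree p = degree [:- l, 1:] + degree q"
    unfolding q by (intro degree_mult_eq) auto
  then have "degree q = n" using Suc(2) by simp
  then obtain L where "shifts f L (f w - l *\<^sub>C w) = 0"
    using Suc.hyps(1)[of q] \<open>q \<noteq> 0\<close> Suc.prems(2) poly_op_linear_factor[OF f, of l q w] q by metis
  then show ?case by (intro exI[of _ "l # L"]) simp
qed

text \<open>The factors commute, so the concatenation of lists that kill the members of a finite
  basis kills all of \<open>S\<close>.\<close>

lemma annihilating_shifts:
  assumes f: "clinear f" and S: "finite_dim S" "cvs.subspace S" "\<And>w. w \<in> S \<Longrightarrow> f w \<in> S"
  shows "\<exists>L. \<forall>w\<in>S. shifts f L w = 0"
proof -
  obtain T where T: "T \<subseteq> S" "cvs.independent T" "S \<subseteq> cvs.span T"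
    by (rule cvs.maximal_independent_subset)
  obtain T0 where "finite T0" "S \<subseteq> cvs.span T0" using S(1) by (auto simp: finite_dim_def)
  then have "finite T" using cvs.independent_span_bound T by blast
  then have "T \<subseteq> S \<Longrightarrow> \<exists>L. \<forall>w\<in>T. shifts f L w = 0"
  proof (induction T)
    case (insert x F)
    then obtain L where L: "\<forall>w\<in>F. shifts f L w = 0" by auto
    have "x \<in> S" using insert.prems by simp
    from poly_op_annihilator[OF f S(1,3) this] obtain M where M: "shifts f M x = 0"
      using poly_op_zero_shifts[OF f] by blast
    note z = clinear_zero[OF clinear_shifts[OF f]]
    have "shifts f (L @ M) x = 0"
      unfolding shifts_append shifts_commute[OF f, of M L] M by (rule z)
    moreover have "shifts f (L @ M) w = 0" if "w \<in> F" for w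
      using L that by (simp add: shifts_append z)
    ultimately show ?case by (intro exI[of _ "L @ M"]) simp
  qed simp
  then obtain L where "\<forall>w\<in>T. shifts f L w = 0" using T(1) by blast
  then show ?thesis
    using clinear_vanish_span[OF clinear_shifts[OF f]] T(3) by blast
qed

lemma shifts_eigenvector:
  assumes f: "clinear f" and "f w = k *\<^sub>C w"
  shows "shifts f L w = (\<Prod>c\<leftarrow>L. k - c) *\<^sub>C w"
proof (induction L)
  case (Cons c L)
  have "f w - c *\<^sub>C w = (k - c) *\<^sub>C w" by (simp add: assms cvs.scale_left_diff_distrib)
  then show ?case using Cons by (simp add: clinear_scale[OF clinear_shifts[OF f]] scaleC_scaleC)
qed (simp add: scaleC_one)

lemma eigenvalue_mem_annihilating:
  assumes "clinear f" "\<forall>w\<in>S. shifts f L w = 0" "w \<in> S" "w \<noteq> 0" "f w = k *\<^sub>C w"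
  shows "k \<in> set L"
  using shifts_eigenvector[OF assms(1,5), of L] assms(2-4)
  by (auto simp: prod_list_zero_iff)

lemma eigenvector_exists:
  assumes f: "clinear f" and S: "finite_dim S" "cvs.subspace S" "\<And>w. w \<in> S \<Longrightarrow> f w \<in> S" "S \<noteq> {0}"
  shows "\<exists>w\<in>S. \<exists>k. w \<noteq> 0 \<and> f w = k *\<^sub>C w"
proof -
  obtain L where L: "\<forall>w\<in>S. shifts f L w = 0" using annihilating_shifts[OF f S(1-3)] by blast
  obtain w where "w \<in> S" "w \<noteq> 0" using S(2,4) cvs.subspace_0 by blast
  then show ?thesis using shifts_drop[of w S f L "{0}"] L S by auto
qed

lemma eigenspace_subspace:
  assumes "clinear f" "cvs.subspace S"
  shows "cvs.subspace {w \<in> S. f w = k *\<^sub>C w}"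
  using assms unfolding cvs.subspace_def
  by (auto simp: clinear_zero clinear_add clinear_scale scaleC_add_right cvs.scale_left_commute)

text \<open>Complex eigenvalues are compared by real part. An operator that raises eigenvalues by a
  positive real number must kill the vector found here.\<close>

lemma top_eigenvector:
  assumes f: "clinear f" and S: "finite_dim S" "cvs.subspace S" "\<And>w. w \<in> S \<Longrightarrow> f w \<in> S" "S \<noteq> {0}"
  shows "\<exists>w\<in>S. \<exists>k. w \<noteq> 0 \<and> f w = k *\<^sub>C w \<and>
    (\<forall>w'\<in>S. \<forall>k'. f w' = k' *\<^sub>C w' \<longrightarrow> Re k' > Re k \<longrightarrow> w' = 0)"
proof -
  obtain L where L: "\<forall>w\<in>S. shifts f L w = 0" using annihilating_shifts[OF f S(1-3)] by blast
  define K where "K = {k. \<exists>w\<in>S. w \<noteq> 0 \<and> f w = k *\<^sub>C w}"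
  have "K \<subseteq> set L" using eigenvalue_mem_annihilating[OF f L] by (auto simp: K_def)
  then have "finite K" by (rule finite_subset) simp
  moreover have "K \<noteq> {}" using eigenvector_exists[OF f S] by (auto simp: K_def)
  ultimately have "Max (Re ` K) \<in> Re ` K" by simp
  then obtain k where k: "k \<in> K" "Max (Re ` K) = Re k" by blast
  have "Re k' \<le> Re k" if "k' \<in> K" for k'
    using that \<open>finite K\<close> k(2) by (metis Max_ge finite_imageI image_eqI)
  then have "\<forall>w'\<in>S. \<forall>k'. f w' = k' *\<^sub>C w' \<longrightarrow> Re k' > Re k \<longrightarrow> w' = 0"
    unfolding K_def by force
  then show ?thesis using k(1) unfolding K_def by blast
qed

text \<open>The operator \<open>x\<close> moves eigenvalues of \<open>f\<close> by \<open>c\<close>.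
  Taking an eigenvector \<open>w'\<close> modulo the kernel of \<open>x\<close> makes
  \<open>x w'\<close> a true eigenvector, with eigenvalue \<open>l + c\<close>, although
  \<open>f\<close> need not be diagonalisable.\<close>

lemma ad_eigenvector_vanishes:
  assumes f: "clinear f" and x: "clinear x"
    and S: "cvs.subspace S" "\<And>w. w \<in> S \<Longrightarrow> f w \<in> S" "\<And>w. w \<in> S \<Longrightarrow> x w \<in> S"
    and L: "\<forall>w\<in>S. shifts f L w = 0"
    and comm: "\<And>w. w \<in> S \<Longrightarrow> f (x w) = x (f w) + c *\<^sub>C x w"
    and c: "\<And>k l. k \<in> set L \<Longrightarrow> l \<in> set L \<Longrightarrow> c \<noteq> k - l"
    and w: "w \<in> S"
  shows "x w = 0"
proof (rule ccontr)
  let ?N = "{w. x w = 0}"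
  assume "x w \<noteq> 0"
  moreover have "shifts f L w \<in> ?N" using L w by (simp add: clinear_zero[OF x])
  ultimately obtain w' l where w': "w' \<in> S" "l \<in> set L" "w' \<notin> ?N" "f w' - l *\<^sub>C w' \<in> ?N"
    using shifts_drop[of w S f L ?N, OF w _ _ S(1,2)] by auto
  then have "f (x w') = (l + c) *\<^sub>C x w'"
    using comm[of w'] by (simp add: clinear_diff[OF x] clinear_scale[OF x] scaleC_add_left)
  then have "l + c \<in> set L"
    using eigenvalue_mem_annihilating[OF f L, of "x w'"] w' S(3) by auto
  then show False using c[of "l + c" l] w'(2) by simp
qed

text \<open>The power \<open>x ^^ n\<close> moves eigenvalues by n c, and for some n this number is
  outside the finite set of differences of eigenvalues.\<close>

lemma ad_eigenvector_nilpotent: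
  assumes f: "clinear f" and x: "clinear x"
    and S: "finite_dim S" "cvs.subspace S" "\<And>w. w \<in> S \<Longrightarrow> f w \<in> S" "\<And>w. w \<in> S \<Longrightarrow> x w \<in> S"
    and comm: "\<And>w. w \<in> S \<Longrightarrow> f (x w) = x (f w) + c *\<^sub>C x w"
    and c: "c \<noteq> 0"
  shows "\<exists>n. \<forall>w\<in>S. (x ^^ n) w = 0"
proof -
  obtain L where L: "\<forall>w\<in>S. shifts f L w = 0" using annihilating_shifts[OF f S(1-3)] by blast
  have comm_n: "f ((x ^^ n) w) = (x ^^ n) (f w) + (of_nat n * c) *\<^sub>C (x ^^ n) w" if "w \<in> S" for n w
  proof (induction n)
    case (Suc n)
    have "(x ^^ n) w \<in> S" using pow_mem[of S x, OF S(4) that] .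
    then show ?case
      using Suc by (simp add: comm clinear_add[OF x] clinear_scale[OF x] scaleC_add_left distrib_right)
  qed simp
  let ?D = "(\<lambda>(k, l). k - l) ` (set L \<times> set L)"
  have "infinite (range (\<lambda>n::nat. of_nat n * c))"
    using c by (intro range_inj_infinite) (auto simp: inj_on_def)
  then have "\<not> range (\<lambda>n::nat. of_nat n * c) \<subseteq> ?D" using finite_subset by blast
  then obtain n :: nat where n: "of_nat n * c \<notin> ?D" by auto
  have "(x ^^ n) w = 0" if "w \<in> S" for w
  proof (rule ad_eigenvector_vanishes[OF f clinear_pow[OF x] S(2,3) pow_mem[of S x, OF S(4)] L comm_n _ that])
    show "of_nat n * c \<noteq> k - l" if "k \<in> set L" "l \<in> set L" for k l
      using n that by (metis (no_types, lifting) SigmaI case_prod_conv image_eqI)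
  qed
  then show ?thesis by blast
qed

text \<open>From A^(m+1) B = B A^(m+1) + (m+1) k A^m, vanishing of A^(m+1) on \<open>S\<close> gives
  vanishing of A^m if \<open>k\<close> is not zero. Descending to m = 0 makes \<open>S\<close>
  trivial.\<close>

lemma heisenberg_central_zero:
  assumes A: "clinear A" and S: "\<And>w. w \<in> S \<Longrightarrow> A w \<in> S" "\<And>w. w \<in> S \<Longrightarrow> B w \<in> S"
    and B: "clinear B"
    and comm: "\<And>w. w \<in> S \<Longrightarrow> A (B w) = B (A w) + k *\<^sub>C w"
    and nil: "\<forall>w\<in>S. (A ^^ n) w = 0" and w: "w \<in> S" "w \<noteq> 0"
  shows "k = 0"
proof (rule ccontr)
  assume k: "k \<noteq> 0"
  have AB: "(A ^^ Suc m) (B w) = B ((A ^^ Suc m) w) + (of_nat (Suc m) * k) *\<^sub>C (A ^^ m) w"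
    if "w \<in> S" for m w
  proof (induction m)
    case 0
    then show ?case using comm that by simp
  next
    case (Suc m)
    have m: "(A ^^ Suc m) w \<in> S" using pow_mem[of S A, OF S(1) that] .
    have "(A ^^ Suc (Suc m)) (B w) = A ((A ^^ Suc m) (B w))" by simp
    also have "\<dots> = A (B ((A ^^ Suc m) w)) + (of_nat (Suc m) * k) *\<^sub>C (A ^^ Suc m) w"
      unfolding Suc by (simp add: clinear_add[OF A] clinear_scale[OF A])
    also have "A (B ((A ^^ Suc m) w)) = B ((A ^^ Suc (Suc m)) w) + k *\<^sub>C (A ^^ Suc m) w"
      using comm[OF m] by simp
    also have "\<dots> + (of_nat (Suc m) * k) *\<^sub>C (A ^^ Suc m) w
        = B ((A ^^ Suc (Suc m)) w) + (k + of_nat (Suc m) * k) *\<^sub>C (A ^^ Suc m) w"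
      by (simp only: scaleC_add_left add.assoc)
    also have "k + of_nat (Suc m) * k = of_nat (Suc (Suc m)) * k" by (simp add: algebra_simps)
    finally show ?case .
  qed
  have "\<forall>w\<in>S. (A ^^ m) w = 0 \<Longrightarrow> \<forall>w\<in>S. w = 0" for m
  proof (induction m)
    case (Suc m)
    have "(A ^^ m) w = 0" if "w \<in> S" for w
    proof -
      have "(of_nat (Suc m) * k) *\<^sub>C (A ^^ m) w = 0"
        using AB[OF that, of m] Suc.prems S(2) that clinear_zero[OF B] by (simp del: of_nat_Suc)
      then show ?thesis using k by (simp del: of_nat_Suc)
    qed
    then show ?case using Suc.IH by blast
  qed simp
  then show False using nil w by blast
qed

text \<open>The eigenspace of one operator is stable under all operators that commute with it, so
  the induction continues inside it.\<close>

lemma common_eigenvector: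
  fixes X :: "('v::complex_vector \<Rightarrow> 'v) set"
  assumes fin: "finite X" and lin: "\<And>x. x \<in> X \<Longrightarrow> clinear x"
    and S: "finite_dim S" "cvs.subspace S" "S \<noteq> {0}" "\<And>x w. x \<in> X \<Longrightarrow> w \<in> S \<Longrightarrow> x w \<in> S"
    and comm: "\<And>x y w. x \<in> X \<Longrightarrow> y \<in> X \<Longrightarrow> w \<in> S \<Longrightarrow> x (y w) = y (x w)"
  shows "\<exists>w\<in>S. w \<noteq> 0 \<and> (\<forall>x\<in>X. \<exists>k. x w = k *\<^sub>C w)"
  using fin lin S comm
proof (induction X arbitrary: S)
  case empty
  then show ?case using cvs.subspace_0 by blast
next
  case (insert x X)
  have x: "clinear x" "\<And>w. w \<in> S \<Longrightarrow> x w \<in> S" using insert.prems(1,5) by simp_all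
  obtain w k where wk: "w \<in> S" "w \<noteq> 0" "x w = k *\<^sub>C w"
    using eigenvector_exists[OF x(1) insert.prems(2,3) x(2) insert.prems(4)] by blast
  let ?T = "{w \<in> S. x w = k *\<^sub>C w}"
  have "\<exists>w\<in>?T. w \<noteq> 0 \<and> (\<forall>y\<in>X. \<exists>k. y w = k *\<^sub>C w)"
  proof (rule insert.IH)
    show "cvs.subspace ?T" by (rule eigenspace_subspace[OF x(1) insert.prems(3)])
    show "finite_dim ?T" by (rule finite_dim_subset[OF insert.prems(2)]) simp
    show "?T \<noteq> {0}" using wk by blast
    show "clinear y" if "y \<in> X" for y using insert.prems(1) that by simp
    show "y u \<in> ?T" if yu: "y \<in> X" "u \<in> ?T" for y u
    proof -
      have "x (y u) = y (x u)" by (rule insert.prems(6)) (use yu in simp_all)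
      moreover have "y u \<in> S" by (rule insert.prems(5)) (use yu in simp_all)
      ultimately show ?thesis using yu insert.prems(1)[of y] by (simp add: clinear_scale)
    qed
    show "y (z u) = z (y u)" if "y \<in> X" "z \<in> X" "u \<in> ?T" for y z u
      by (rule insert.prems(6)) (use that in simp_all)
  qed
  then show ?case using wk(3) by auto
qed


section \<open>Laurent polynomials near the point \<open>t = 1\<close>\<close>

text \<open>The sum of the coefficients, which is the value at t = 1.\<close>

definition ev1 :: "'n::finite laurent \<Rightarrow> complex"
  where "ev1 = free_lift (\<lambda>_. 1)"

lemma clinear_ev1: "clinear ev1"
  unfolding ev1_def by (rule clinear_free_lift)

lemma ev1_tpow [simp]: "ev1 (tpow r) = 1"
  by (simp add: ev1_def tpow_def free_lift_single)

lemma tpow_add: "tpow (r + s) = tpow r * tpow s"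
  by (simp add: tpow_def mult_single)

lemma tpow_zero: "tpow 0 = 1"
  by (simp add: tpow_def)

lemma laurent_induct [case_names tpow add]:
  assumes "\<And>c s. P (c *\<^sub>C tpow s)" "\<And>f g. P f \<Longrightarrow> P g \<Longrightarrow> P (f + g)"
  shows "P (f :: 'n::finite laurent)"
proof (induction f rule: poly_mapping_additive_induct)
  case (single k c)
  have "Poly_Mapping.single k c = c *\<^sub>C tpow k" by (simp add: tpow_def scaleC_single)
  then show ?case using assms(1) by simp
qed (rule assms(2))

lemma ev1_mult [simp]: "ev1 (f * g) = ev1 f * ev1 g"
proof (induction f rule: laurent_induct)
  case (tpow c s)
  show ?case
  proof (induction g rule: laurent_induct)
    case (tpow d r)
    show ?case
      by (simp add: scaleC_mult_left scaleC_mult_right tpow_add[symmetric] clinear_scale[OF clinear_ev1])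
  qed (simp add: distrib_left clinear_add[OF clinear_ev1])
qed (simp add: distrib_right clinear_add[OF clinear_ev1])

lemma ev1_one [simp]: "ev1 1 = 1"
  using ev1_tpow[of 0] by (simp only: tpow_zero)

lemmas ev1_linear [simp] = clinear_add[OF clinear_ev1] clinear_diff[OF clinear_ev1]
  clinear_scale[OF clinear_ev1] clinear_zero[OF clinear_ev1] clinear_minus[OF clinear_ev1]

definition tvar :: "'n::finite \<Rightarrow> 'n laurent"
  where "tvar i = tpow (axis i 1)"

definition yvar :: "'n::finite \<Rightarrow> 'n laurent"
  where "yvar i = tvar i - 1"

text \<open>This is d/dt_i, obtained as t_i^(-1) times t_i d/dt_i.\<close>

definition partial_der :: "'n::finite \<Rightarrow> 'n laurent derivation"
  where "partial_der i = Dop (axis i 1) (- axis i 1)"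

definition pd :: "'n::finite \<Rightarrow> 'n laurent \<Rightarrow> 'n laurent"
  where "pd i f = apply_der (partial_der i) f"

lemma clinear_pd: "clinear (pd i)"
  unfolding pd_def by (rule clinear_apply_der)

lemmas pd_linear [simp] = clinear_add[OF clinear_pd] clinear_diff[OF clinear_pd]
  clinear_scale[OF clinear_pd] clinear_zero[OF clinear_pd]

lemma pd_mult: "pd i (f * g) = pd i f * g + f * pd i g"
  by (simp add: pd_def apply_der_mult)

lemma cdot_axis: "cdot (axis i 1) v = v $ i"
  by (simp add: cdot_def axis_def if_distrib[of "\<lambda>x. x * _"] cong: if_cong)

lemma pd_tpow: "pd i (tpow s) = of_int (s $ i) *\<^sub>C tpow (s - axis i 1)"
  by (simp add: pd_def partial_der_def Dop_tpow cdot_axis cvec_def)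

lemma pd_one [simp]: "pd i 1 = 0"
  using pd_tpow[of i 0] by (simp add: tpow_zero)

lemma pd_tvar: "pd i (tvar j) = (if i = j then 1 else 0)"
  by (simp add: tvar_def pd_tpow axis_def tpow_zero scaleC_one)

lemma pd_yvar: "pd i (yvar j) = (if i = j then 1 else 0)"
  by (simp add: yvar_def pd_tvar)

lemma ev1_yvar [simp]: "ev1 (yvar i) = 0"
  by (simp add: yvar_def tvar_def)

lemma pd_commute: "pd i (pd j f) = pd j (pd i f)"
proof (induction f rule: laurent_induct)
  case (tpow c s)
  have "tpow (s - axis j 1 - axis i 1) = tpow (s - axis i 1 - axis j 1)"
    by (simp only: cancel_ab_semigroup_add_class.diff_right_commute)
  moreover have "axis k 1 $ l = (0::int)" if "k \<noteq> l" for k l :: 'a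
    using that by (simp add: axis_def)
  ultimately show ?case
    by (cases "i = j") (simp_all add: pd_tpow scaleC_scaleC mult_ac)
qed simp

lemma axis_add: "axis i (a + b) = axis i a + axis i (b::int)"
  by (simp add: axis_def vec_eq_iff)

lemma axis_minus: "axis i (- a) = - axis i (a::int)"
  by (simp add: axis_def vec_eq_iff)

lemma int_vec_induct [case_names axis add minus]:
  assumes ax: "\<And>i. P (axis i 1)" and ad: "\<And>r s. P r \<Longrightarrow> P s \<Longrightarrow> P (r + s)" and mi: "\<And>r. P r \<Longrightarrow> P (- r)"
  shows "P (r :: int ^ 'n::finite)"
proof -
  have P0: "P 0" using ad[OF ax mi[OF ax], of undefined undefined] by simp
  have nat: "P (axis i (int k))" for i k
  proof (induction k)
    case 0
    then show ?case using P0 by (simp add: axis_def vec_eq_iff zero_vec_def)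
  next
    case (Suc k)
    have "axis i (int (Suc k)) = axis i 1 + axis i (int k)" by (simp add: axis_add)
    then show ?case using ad[OF ax Suc] by simp
  qed
  have int: "P (axis i k)" for i k
  proof (cases k rule: int_cases2)
    case (nonpos n)
    then show ?thesis using mi[OF nat] by (simp add: axis_minus)
  qed (simp add: nat)
  have "P (\<Sum>i\<in>I. axis i (r $ i))" if "finite I" for I
    using that by (induction I) (simp_all add: P0 ad int)
  moreover have "(\<Sum>i\<in>UNIV. axis i (r $ i)) = r"
    by (simp add: vec_eq_iff axis_def)
  ultimately show ?thesis by (metis finite)
qed

section \<open>Taylor expansion modulo the square of the maximal ideal at t = 1\<close>

definition ker_sq :: "'n::finite laurent set"
  where "ker_sq = cvs.span {g * h | g h. ev1 g = 0 \<and> ev1 h = 0}"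

lemma ker_sq_mult: "ev1 g = 0 \<Longrightarrow> ev1 h = 0 \<Longrightarrow> g * h \<in> ker_sq"
  unfolding ker_sq_def by (intro cvs.span_base) auto

lemma ker_sq_subspace: "cvs.subspace ker_sq"
  unfolding ker_sq_def by simp

lemmas ker_sq_closed = cvs.subspace_add[OF ker_sq_subspace] cvs.subspace_diff[OF ker_sq_subspace]
  cvs.subspace_scale[OF ker_sq_subspace] cvs.subspace_0[OF ker_sq_subspace]
  cvs.subspace_neg[OF ker_sq_subspace]

text \<open>Modulo \<open>ker_sq\<close> the map sending r to t^r - 1 is additive, as its defect
  (t^r - 1)(t^s - 1) is a product of two functions that vanish at t = 1. It is therefore determined
  by the unit vectors.\<close>

lemma tpow_taylor: "tpow r - 1 - (\<Sum>j\<in>UNIV. of_int (r $ j) *\<^sub>C yvar j) \<in> ker_sq"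
proof (induction r rule: int_vec_induct)
  case (axis i)
  have "of_int (axis i 1 $ j) *\<^sub>C yvar j = (if j = i then yvar i else 0)" for j
    by (auto simp: axis_def scaleC_one)
  then show ?case by (simp add: yvar_def tvar_def ker_sq_closed)
next
  case (add r s)
  have eq: "tpow (r + s) - 1 - (\<Sum>j\<in>UNIV. of_int ((r + s) $ j) *\<^sub>C yvar j)
    = (tpow r - 1 - (\<Sum>j\<in>UNIV. of_int (r $ j) *\<^sub>C yvar j))
      + (tpow s - 1 - (\<Sum>j\<in>UNIV. of_int (s $ j) *\<^sub>C yvar j)) + (tpow r - 1) * (tpow s - 1)"
    by (simp add: tpow_add scaleC_add_left sum.distrib algebra_simps)
  show ?case unfolding eq by (intro ker_sq_closed(1) add.IH ker_sq_mult) simp_all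
next
  case (minus r)
  have "tpow r * tpow (- r) = 1" by (simp add: tpow_add[symmetric] tpow_zero)
  then have "tpow (- r) - 1 - (\<Sum>j\<in>UNIV. of_int ((- r) $ j) *\<^sub>C yvar j)
    = - (tpow r - 1 - (\<Sum>j\<in>UNIV. of_int (r $ j) *\<^sub>C yvar j)) - (tpow r - 1) * (tpow (- r) - 1)"
    by (simp add: sum_negf algebra_simps)
  moreover have "(tpow r - 1) * (tpow (- r) - 1) \<in> ker_sq" by (rule ker_sq_mult) simp_all
  ultimately show ?case using minus by (simp only: ker_sq_closed)
qed

lemma laurent_taylor: "f - ev1 f *\<^sub>C 1 - (\<Sum>j\<in>UNIV. ev1 (pd j f) *\<^sub>C yvar j) \<in> ker_sq"
proof (induction f rule: laurent_induct)
  case (tpow c s)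
  have "c *\<^sub>C tpow s - ev1 (c *\<^sub>C tpow s) *\<^sub>C 1 - (\<Sum>j\<in>UNIV. ev1 (pd j (c *\<^sub>C tpow s)) *\<^sub>C yvar j)
    = c *\<^sub>C (tpow s - 1 - (\<Sum>j\<in>UNIV. of_int (s $ j) *\<^sub>C yvar j))"
    by (simp add: pd_tpow cvs.scale_right_diff_distrib cvs.scale_sum_right scaleC_scaleC)
  then show ?case using tpow_taylor ker_sq_closed(3) by metis
next
  case (add f g)
  have "f + g - ev1 (f + g) *\<^sub>C 1 - (\<Sum>j\<in>UNIV. ev1 (pd j (f + g)) *\<^sub>C yvar j)
    = (f - ev1 f *\<^sub>C 1 - (\<Sum>j\<in>UNIV. ev1 (pd j f) *\<^sub>C yvar j))
      + (g - ev1 g *\<^sub>C 1 - (\<Sum>j\<in>UNIV. ev1 (pd j g) *\<^sub>C yvar j))"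
    by (simp add: scaleC_add_left sum.distrib)
  then show ?case using add by (simp only: ker_sq_closed)
qed


section \<open>Derivations of Laurent polynomials and elements of \<open>\<tau>\<close>\<close>

lift_definition der_mult :: "'a::complex_comm_algebra_1 \<Rightarrow> 'a derivation \<Rightarrow> 'a derivation"
  is "\<lambda>f d g. f * d g"
  by (simp add: clinear_iff algebra_simps scaleC_mult_right)

lemma apply_der_mult_left: "apply_der (der_mult f d) g = f * apply_der d g"
  by transfer simp

lemma apply_der_sum: "apply_der (\<Sum>i\<in>I. d i) f = (\<Sum>i\<in>I. apply_der (d i) f)"
  by (induction I rule: infinite_finite_induct) (simp_all add: apply_der_simps)

definition vfield :: "'n::finite laurent \<Rightarrow> 'n \<Rightarrow> 'n laurent derivation"
  where "vfield f i = der_mult f (partial_der i)"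

lemma apply_vfield: "apply_der (vfield f i) g = f * pd i g"
  by (simp add: vfield_def apply_der_mult_left pd_def)

lemma clinear_vfield: "clinear (\<lambda>f. vfield f i)"
  by (rule clinearI; rule derivation_eqI) (simp_all add: apply_vfield apply_der_simps distrib_right scaleC_mult_left)

lemma lie_bracket_vfield:
  "lie_bracket (vfield f i) (vfield g j) = vfield (f * pd i g) j - vfield (g * pd j f) i"
proof (rule derivation_eqI)
  fix h show "apply_der (lie_bracket (vfield f i) (vfield g j)) h =
    apply_der (vfield (f * pd i g) j - vfield (g * pd j f) i) h"
    by (simp add: apply_der_simps apply_vfield pd_mult pd_commute[of i j h] algebra_simps)
qed

lemma vfield_tpow: "vfield (tpow s) i = Dop (axis i 1) (s - axis i 1)"
proof (rule derivation_eqI)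
  fix h show "apply_der (vfield (tpow s) i) h = apply_der (Dop (axis i 1) (s - axis i 1)) h"
  proof (induction h rule: laurent_induct)
    case (tpow c r)
    have "tpow (s + (r - axis i 1)) = tpow (s - axis i 1 + r)" by (simp add: algebra_simps)
    then show ?case
      by (simp add: apply_vfield pd_tpow Dop_tpow cdot_axis cvec_def apply_der_scale scaleC_mult_right
          tpow_add[symmetric])
  qed (simp add: apply_der_add)
qed

lemma Dop_eq_vfield: "Dop u r = (\<Sum>i\<in>UNIV. u $ i *\<^sub>C vfield (tpow (r + axis i 1)) i)"
proof (rule derivation_eqI)
  fix h show "apply_der (Dop u r) h = apply_der (\<Sum>i\<in>UNIV. u $ i *\<^sub>C vfield (tpow (r + axis i 1)) i) h"
  proof (induction h rule: laurent_induct)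
    case (tpow c s)
    show ?case
      by (simp add: apply_der_sum apply_der_simps vfield_tpow Dop_tpow cdot_axis apply_der_scale
          cdot_def[of u] cvs.scale_sum_left cvs.scale_sum_right scaleC_scaleC mult.commute mult.left_commute)
  qed (simp add: apply_der_add)
qed

text \<open>Both sides agree on the t_i. The Leibniz rule extends this to products, and applied to
  t^r t^(-r) = 1 it extends it to inverses.\<close>

lemma derivation_eq_vfields: "d = (\<Sum>i\<in>UNIV. vfield (apply_der d (tvar i)) i)" (is "d = ?e")
  for d :: "'n::finite laurent derivation"
proof (rule derivation_eqI)
  have one: "apply_der d' 1 = 0" for d' :: "'n laurent derivation"
    using apply_der_mult[of d' 1 1] by simp
  have eq: "apply_der d (tpow r) = apply_der ?e (tpow r)" for r
  proof (induction r rule: int_vec_induct)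
    case (axis i)
    show ?case
      by (simp add: tvar_def[symmetric] apply_der_sum apply_vfield pd_tvar if_distrib[of "\<lambda>x. _ * x"] cong: if_cong)
  next
    case (add r s)
    then show ?case by (simp add: tpow_add apply_der_mult)
  next
    case (minus r)
    have inv: "tpow r * tpow (- r) = 1" by (simp add: tpow_add[symmetric] tpow_zero)
    have *: "apply_der d' (tpow (- r)) = - (tpow (- r) * tpow (- r) * apply_der d' (tpow r))"
      for d' :: "'n laurent derivation"
    proof -
      have "0 = apply_der d' (tpow r * tpow (- r))" by (simp add: inv one)
      then have "0 = tpow (- r) * (apply_der d' (tpow r) * tpow (- r) + tpow r * apply_der d' (tpow (- r)))"
        by (simp add: apply_der_mult)
      also have "\<dots> = tpow (- r) * tpow (- r) * apply_der d' (tpow r) + (tpow r * tpow (- r)) * apply_der d' (tpow (- r))"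
        by (simp add: algebra_simps)
      finally show ?thesis by (simp add: inv eq_neg_iff_add_eq_0 add.commute)
    qed
    show ?case unfolding * minus ..
  qed
  fix f show "apply_der d f = apply_der ?e f"
    by (induction f rule: laurent_induct) (simp_all only: eq apply_der_add apply_der_scale)
qed

section \<open>The elements f d/dt_i (x) b and f (x) b of \<open>tau\<close>\<close>

definition tau_vf :: "'n::finite laurent \<Rightarrow> 'n \<Rightarrow> 'b::complex_comm_algebra_1 \<Rightarrow> ('n, 'b) tau"
  where "tau_vf f i b = of_der (vfield f i) \<otimes>\<^sub>C b"

definition tau_fun :: "'n::finite laurent \<Rightarrow> 'b::complex_comm_algebra_1 \<Rightarrow> ('n, 'b) tau"
  where "tau_fun f b = of_fun f \<otimes>\<^sub>C b"

lemma clinear_of_der: "clinear of_der"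
  by (simp add: clinear_iff plus_semidirect_def scaleC_semidirect_def)

lemma clinear_of_fun: "clinear of_fun"
  by (simp add: clinear_iff plus_semidirect_def scaleC_semidirect_def)

lemma clinear_tensor_left: "clinear (\<lambda>x. x \<otimes>\<^sub>C b)"
  by (simp add: clinear_iff tensor_add_left tensor_scale_left)

lemma clinear_tensor_right: "clinear (\<lambda>b. x \<otimes>\<^sub>C b)"
  by (simp add: clinear_iff tensor_add_right tensor_scale_right)

lemma clinear_tau_vf_left: "clinear (\<lambda>f. tau_vf f i b)"
  unfolding tau_vf_def
  by (intro clinear_compose[OF clinear_tensor_left] clinear_compose[OF clinear_of_der] clinear_vfield)

lemma clinear_tau_vf_right: "clinear (\<lambda>b. tau_vf f i b)"
  unfolding tau_vf_def by (rule clinear_tensor_right)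

lemma clinear_tau_fun_left: "clinear (\<lambda>f. tau_fun f b)"
  unfolding tau_fun_def by (intro clinear_compose[OF clinear_tensor_left] clinear_of_fun)

lemma lie_bracket_tau_vf:
  "lie_bracket (tau_vf f i b) (tau_vf g j b') = tau_vf (f * pd i g) j (b * b') - tau_vf (g * pd j f) i (b * b')"
proof -
  have "lie_bracket (of_der (vfield f i)) (of_der (vfield g j))
      = of_der (vfield (f * pd i g) j) - of_der (vfield (g * pd j f) i)"
    by (simp add: lie_bracket_semidirect_def lie_bracket_vfield minus_semidirect_def
        clinear_zero[OF clinear_apply_der])
  then show ?thesis
    by (simp add: tau_vf_def lie_bracket_tensor clinear_diff[OF clinear_tensor_left])
qed

lemma lie_bracket_tau_vf_fun:
  "lie_bracket (tau_vf f i b) (tau_fun g b') = tau_fun (f * pd i g) (b * b')"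
proof -
  have "lie_bracket (vfield f i) 0 = 0"
    by (rule derivation_eqI) (simp add: apply_der_simps clinear_zero[OF clinear_apply_der])
  then have "lie_bracket (of_der (vfield f i)) (of_fun g) = of_fun (f * pd i g)"
    by (simp add: lie_bracket_semidirect_def apply_vfield apply_der_simps)
  then show ?thesis by (simp add: tau_vf_def tau_fun_def lie_bracket_tensor)
qed

lemma tau_t_eq: "tau_t r b = tau_fun (tpow r) b"
  by (simp add: tau_t_def tau_fun_def)

lemma tau_D_eq: "tau_D u r b = (\<Sum>i\<in>UNIV. u $ i *\<^sub>C tau_vf (tpow (r + axis i 1)) i b)"
  by (simp add: tau_D_def Dop_eq_vfield clinear_sum[OF clinear_of_der] clinear_scale[OF clinear_of_der]
      clinear_sum[OF clinear_tensor_left] clinear_scale[OF clinear_tensor_left] tau_vf_def)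

lemma tau_vf_tpow: "tau_vf (tpow s) i b = tau_D (axis i 1) (s - axis i 1) b"
  by (simp add: tau_vf_def tau_D_def vfield_tpow)

text \<open>Reduces invariance of subspaces under \<open>tau\<close> to the generators. The type of
  derivations contains all derivations of A, so \<open>derivation_eq_vfields\<close> is the
  essential input.\<close>

lemma tau_spanned:
  "x \<in> cvs.span ({tau_D u r b | u r b. True} \<union> {tau_t r b | r b. True})" (is "x \<in> cvs.span ?G")
  for x :: "('n::finite, 'b::complex_comm_algebra_1) tau"
proof (induction x rule: tensor_induct)
  case (pure X b)
  obtain f d where X: "X = Semidirect f d" by (cases X)
  have vf: "tau_vf g i b \<in> cvs.span ?G" for g i
  proof (induction g rule: laurent_induct)
    case (tpow c s)
    have "tau_vf (tpow s) i b \<in> cvs.span ?G"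
      unfolding tau_vf_tpow by (rule cvs.span_base) blast
    then show ?case by (simp add: clinear_scale[OF clinear_tau_vf_left] cvs.span_scale)
  qed (simp add: clinear_add[OF clinear_tau_vf_left] cvs.span_add)
  have tf: "tau_fun g b \<in> cvs.span ?G" for g
  proof (induction g rule: laurent_induct)
    case (tpow c s)
    have "tau_fun (tpow s) b \<in> cvs.span ?G"
      unfolding tau_t_eq[symmetric] by (rule cvs.span_base) blast
    then show ?case by (simp add: clinear_scale[OF clinear_tau_fun_left] cvs.span_scale)
  qed (simp add: clinear_add[OF clinear_tau_fun_left] cvs.span_add)
  have "X = of_fun f + of_der d" by (simp add: X plus_semidirect_def)
  moreover have "of_der d \<otimes>\<^sub>C b = (\<Sum>i\<in>UNIV. tau_vf (apply_der d (tvar i)) i b)"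
    by (subst derivation_eq_vfields[of d])
      (simp add: tau_vf_def clinear_sum[OF clinear_of_der] clinear_sum[OF clinear_tensor_left])
  ultimately have eq: "X \<otimes>\<^sub>C b = tau_fun f b + (\<Sum>i\<in>UNIV. tau_vf (apply_der d (tvar i)) i b)"
    by (simp add: tensor_add_left tau_fun_def)
  show ?case unfolding eq by (intro cvs.span_add cvs.span_sum vf tf)
qed (rule cvs.span_add)


section \<open>Modules over the vector fields vanishing at a point\<close>

text \<open>Products of the y_i and not of the t_i, so that the degree is the order of vanishing at
  t = 1.\<close>

inductive monomial :: "nat \<Rightarrow> 'n::finite laurent \<Rightarrow> bool"
  where one: "monomial 0 1"
  | mult: "monomial k f \<Longrightarrow> monomial (Suc k) (yvar i * f)"

lemma monomial_euler: "monomial k f \<Longrightarrow> (\<Sum>i\<in>UNIV. yvar i * pd i f) = of_nat k *\<^sub>C f"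
proof (induction rule: monomial.induct)
  case (mult k f j)
  have "(\<Sum>i\<in>UNIV. yvar i * pd i (yvar j * f))
    = (\<Sum>i\<in>UNIV. (if i = j then yvar j * f else 0) + yvar j * (yvar i * pd i f))"
    by (rule sum.cong) (auto simp: pd_mult pd_yvar algebra_simps)
  also have "\<dots> = yvar j * f + yvar j * (of_nat k *\<^sub>C f)"
    by (simp add: sum.distrib sum_distrib_left[symmetric] mult.IH)
  finally show ?case by (simp add: scaleC_mult_right scaleC_add_left scaleC_one)
qed simp

lemma monomial_ev1: "monomial k f \<Longrightarrow> k > 0 \<Longrightarrow> ev1 f = 0"
  by (erule monomial.cases) simp_all

lemma monomial_mult: "monomial k f \<Longrightarrow> monomial l g \<Longrightarrow> monomial (k + l) (f * g)"
  by (induction rule: monomial.induct) (simp_all add: monomial.mult mult.assoc)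

lemma monomial_power: "monomial k (yvar i ^ k)"
  by (induction k) (simp_all add: monomial.intros)

text \<open>The k-th power of the maximal ideal at t = 1 inside the ring of polynomials in the y_i,
  a proper subring of the Laurent polynomials.\<close>

definition polys :: "nat \<Rightarrow> 'n::finite laurent set"
  where "polys k = cvs.span {f. \<exists>l\<ge>k. monomial l f}"

lemma polys_subspace: "cvs.subspace (polys k)"
  unfolding polys_def by simp

lemmas polys_closed = cvs.subspace_add[OF polys_subspace] cvs.subspace_diff[OF polys_subspace]
  cvs.subspace_scale[OF polys_subspace] cvs.subspace_0[OF polys_subspace]

lemma monomial_in_polys: "monomial l f \<Longrightarrow> k \<le> l \<Longrightarrow> f \<in> polys k"
  unfolding polys_def by (rule cvs.span_base) auto

lemma polys_mult:
  assumes "f \<in> polys k" "g \<in> polys l"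
  shows "f * g \<in> polys (k + l)"
proof -
  have mon: "m * g \<in> polys (k + l)" if "monomial k' m" "k \<le> k'" for k' m
    using assms(2) unfolding polys_def[of l]
  proof (induction rule: cvs.span_induct_alt)
    case (step c x y)
    then obtain l' where "monomial l' x" "l \<le> l'" by auto
    then have "m * x \<in> polys (k + l)"
      by (intro monomial_in_polys[OF monomial_mult[OF that(1)]]) (use that(2) in auto)
    then show ?case using step by (simp add: distrib_left scaleC_mult_right polys_closed)
  qed (simp add: polys_closed)
  show ?thesis using assms(1) unfolding polys_def[of k]
  proof (induction rule: cvs.span_induct_alt)
    case (step c x y)
    then have "x * g \<in> polys (k + l)" using mon by auto
    then show ?case using step by (simp add: distrib_right scaleC_mult_left polys_closed)
  qed (simp add: polys_closed)
qed

lemma polys_0_cases: "f \<in> polys 0 \<Longrightarrow> \<exists>c. \<exists>p\<in>polys 1. f = c *\<^sub>C 1 + p"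
  unfolding polys_def[of 0]
proof (induction rule: cvs.span_induct_alt)
  case base
  show ?case using polys_closed(4)[of 1] by (intro exI[of _ 0] bexI[of _ 0]) simp_all
next
  case (step c x y)
  then obtain l d q where x: "monomial l x" and q: "q \<in> polys 1" "y = d *\<^sub>C 1 + q" by auto
  show ?case
  proof (cases "l = 0")
    case True
    then have "x = 1" using x by (auto elim: monomial.cases)
    then show ?thesis using q
      by (intro exI[of _ "c + d"] bexI[of _ q]) (simp_all add: scaleC_add_left)
  next
    case False
    then have "x \<in> polys 1" using monomial_in_polys[OF x, of 1] by simp
    then show ?thesis using q
      by (intro exI[of _ d] bexI[of _ "c *\<^sub>C x + q"]) (simp_all add: polys_closed)
  qed
qed

lemma polys_ev1: "f \<in> polys 1 \<Longrightarrow> ev1 f = 0"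
  unfolding polys_def by (rule clinear_vanish_span[OF clinear_ev1]) (auto simp: monomial_ev1)

text \<open>
  \<open>rho f i b\<close> is the action of \<open>f d/dt\<^sub>i \<otimes> b\<close> on the fibre \<open>U\<close> at the point \<open>(1, psi)\<close>; it respects
  brackets only on the subalgebra of vector fields that vanish there.
\<close>

locale jet_module =
  fixes U :: "'v::complex_vector set"
    and psi :: "'b::complex_comm_algebra_1 \<Rightarrow> complex"
    and rho :: "'n::finite laurent \<Rightarrow> 'n \<Rightarrow> 'b \<Rightarrow> 'v \<Rightarrow> 'v"
  assumes U_fin: "finite_dim U" and U_sub: "cvs.subspace U" and U_nonzero: "U \<noteq> {0}"
    and psi: "algebra_hom psi"
    and rho_lin: "clinear (rho f i b)"
    and rho_mem: "w \<in> U \<Longrightarrow> rho f i b w \<in> U"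
    and rho_fun: "clinear (\<lambda>f. rho f i b w)"
    and rho_alg: "clinear (\<lambda>b. rho f i b w)"
    and rho_bracket: "ev1 f * psi b = 0 \<Longrightarrow> ev1 g * psi b' = 0 \<Longrightarrow> w \<in> U \<Longrightarrow>
      rho f i b (rho g j b' w) - rho g j b' (rho f i b w)
        = rho (f * pd i g) j (b * b') w - rho (g * pd j f) i (b * b') w"
    and rho_irreducible: "cvs.subspace N \<Longrightarrow> N \<subseteq> U \<Longrightarrow>
      (\<And>f i b w. ev1 f * psi b = 0 \<Longrightarrow> w \<in> N \<Longrightarrow> rho f i b w \<in> N) \<Longrightarrow> N = {0} \<or> N = U"
begin

definition vanishes :: "'n laurent \<Rightarrow> 'n \<Rightarrow> 'b \<Rightarrow> bool"
  where "vanishes f j b \<longleftrightarrow> (\<forall>w\<in>U. rho f j b w = 0)"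

lemmas rho_zero = clinear_zero[OF rho_lin]

lemma psi_simps [simp]: "psi (x * y) = psi x * psi y" "psi 1 = 1" "psi (x - y) = psi x - psi y"
    "psi (c *\<^sub>C x) = c * psi x"
  using psi clinear_diff[of psi] clinear_scale[of psi] by (auto simp: algebra_hom_def)

lemma rho_comm:
  assumes "ev1 f * psi b = 0" "ev1 g * psi b' = 0" "w \<in> U"
  shows "rho f i b (rho g j b' w)
    = rho g j b' (rho f i b w) + rho (f * pd i g) j (b * b') w - rho (g * pd j f) i (b * b') w"
  using rho_bracket[OF assms, of i j] by (simp add: algebra_simps)

section \<open>The grading by the Euler field and vanishing in high degree\<close>

definition euler_op :: "'v \<Rightarrow> 'v"
  where "euler_op w = (\<Sum>i\<in>UNIV. rho (yvar i) i 1 w)"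

lemma euler_lin: "clinear euler_op"
  unfolding euler_op_def
  by (rule clinearI) (simp_all add: clinear_add[OF rho_lin] clinear_scale[OF rho_lin] sum.distrib cvs.scale_sum_right)

lemma euler_mem: "w \<in> U \<Longrightarrow> euler_op w \<in> U"
  unfolding euler_op_def by (intro cvs.subspace_sum[OF U_sub] rho_mem)

text \<open>The coefficient has degree k and d/dt_j has degree -1, whence the eigenvalue k -
  1.\<close>

lemma euler_comm:
  assumes f: "monomial k f" and good: "ev1 f * psi b = 0" and w: "w \<in> U"
  shows "euler_op (rho f j b w) = rho f j b (euler_op w) + (of_nat k - 1) *\<^sub>C rho f j b w"
proof -
  have "rho (yvar i) i 1 (rho f j b w) = rho f j b (rho (yvar i) i 1 w)
    + (rho (yvar i * pd i f) j b w - (if i = j then rho f j b w else 0))" for i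
    using rho_comm[of "yvar i" 1 f b w i j] good w by (auto simp: pd_yvar clinear_zero[OF rho_fun])
  then have "euler_op (rho f j b w) = rho f j b (euler_op w)
      + ((\<Sum>i\<in>UNIV. rho (yvar i * pd i f) j b w) - rho f j b w)"
    by (simp add: euler_op_def sum.distrib sum_subtractf clinear_sum[OF rho_lin])
  also have "(\<Sum>i\<in>UNIV. rho (yvar i * pd i f) j b w) = of_nat k *\<^sub>C rho f j b w"
    by (simp add: clinear_sum[OF rho_fun, symmetric] monomial_euler[OF f] clinear_scale[OF rho_fun])
  finally show ?thesis by (simp add: cvs.scale_left_diff_distrib scaleC_one)
qed

text \<open>For large k the number k - 1 is not a difference of roots in the annihilating list of
  the Euler operator, whatever j and b are. The bound is positive, so that these monomials vanish at
  t = 1 and no condition on b arises.\<close>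

lemma high_degree_vanishes: "\<exists>N>0. \<forall>k\<ge>N. \<forall>f j b. monomial k f \<longrightarrow> vanishes f j b"
proof -
  obtain L where L: "\<forall>w\<in>U. shifts euler_op L w = 0"
    using annihilating_shifts[OF euler_lin U_fin U_sub euler_mem] by blast
  let ?D = "(\<lambda>(k, l). k - l) ` (set L \<times> set L)"
  have "finite ((\<lambda>k::nat. of_nat k - 1) -` ?D)"
    by (rule finite_vimageI) (auto simp: inj_on_def)
  then obtain N where N: "k < N" if "of_nat k - 1 \<in> ?D" for k
    unfolding finite_nat_set_iff_bounded by auto
  have "vanishes f j b" if k: "k \<ge> Suc N" and f: "monomial k f" for k f j b
    unfolding vanishes_def
  proof
    fix w assume w: "w \<in> U"
    have ev: "ev1 f * psi b = 0" using monomial_ev1[OF f] k by simp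
    show "rho f j b w = 0"
    proof (rule ad_eigenvector_vanishes[OF euler_lin rho_lin U_sub euler_mem rho_mem L euler_comm[OF f ev] _ w])
      show "of_nat k - 1 \<noteq> x - y" if "x \<in> set L" "y \<in> set L" for x y
      proof
        assume "of_nat k - 1 = x - y"
        then have "of_nat k - 1 \<in> ?D" using that by force
        then show False using N[of k] k by simp
      qed
    qed
  qed
  then show ?thesis by (intro exI[of _ "Suc N"]) simp
qed

section \<open>Reduction of Laurent coefficients to polynomials in the y_i\<close>

definition deg_bound :: nat
  where "deg_bound = (SOME N. N > 0 \<and> (\<forall>k\<ge>N. \<forall>f j b. monomial k f \<longrightarrow> vanishes f j b))"

lemma deg_bound_pos: "deg_bound > 0"
  and deg_bound: "deg_bound \<le> k \<Longrightarrow> monomial k f \<Longrightarrow> vanishes f j b"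
  using someI_ex[OF high_degree_vanishes] unfolding deg_bound_def[symmetric] by blast+

text \<open>The multiplier \<open>h\<close> runs through all Laurent polynomials, which makes this
  an ideal of A. The condition on \<open>ev1\<close> ensures that reduction modulo the ideal keeps
  the value at t = 1.\<close>

definition null_ideal :: "'n laurent set"
  where "null_ideal = {f. ev1 f = 0 \<and> (\<forall>h j b. vanishes (f * h) j b)}"

lemma null_ideal_add: "f \<in> null_ideal \<Longrightarrow> g \<in> null_ideal \<Longrightarrow> f + g \<in> null_ideal"
  by (simp add: null_ideal_def vanishes_def distrib_right clinear_add[OF rho_fun])

lemma null_ideal_mult: "f \<in> null_ideal \<Longrightarrow> f * g \<in> null_ideal"
  by (auto simp: null_ideal_def mult.assoc)

lemma null_ideal_zero: "0 \<in> null_ideal"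
  by (simp add: null_ideal_def vanishes_def clinear_zero[OF rho_fun])

lemma null_ideal_vanishes: "f \<in> null_ideal \<Longrightarrow> vanishes f j b"
  by (auto simp: null_ideal_def dest!: spec[of _ 1])

lemma null_ideal_scale: "f \<in> null_ideal \<Longrightarrow> c *\<^sub>C f \<in> null_ideal"
  by (simp add: null_ideal_def vanishes_def scaleC_mult_left clinear_scale[OF rho_fun])

text \<open>
  Comparing the brackets of \<open>p y\<^sub>j d\<^sub>j\<close> with \<open>h d\<^sub>j\<close> and of \<open>p d\<^sub>j\<close> with \<open>y\<^sub>j h d\<^sub>j\<close> isolates \<open>2 p h d\<^sub>j\<close>.
  This passes from polynomial to Laurent polynomial coefficients.
\<close>

lemma high_degree_mult_vanishes:
  assumes k: "deg_bound \<le> k" and p: "monomial k p" and h: "ev1 h = 0"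
  shows "vanishes (p * h) j b"
  unfolding vanishes_def
proof
  fix w assume w: "w \<in> U"
  have ev: "ev1 p = 0" using monomial_ev1[OF p] k deg_bound_pos by simp
  have py: "monomial (Suc k) (yvar j * p)" using monomial.mult[OF p] .
  have v: "rho p j 1 x = 0" "rho (yvar j * p) j 1 x = 0" if "x \<in> U" for x
    using deg_bound[OF k p] deg_bound[OF _ py] k that by (auto simp: vanishes_def)
  have 1: "rho (yvar j * p * pd j h) j b w - rho (h * pd j (yvar j * p)) j b w = 0"
    using rho_bracket[of "yvar j * p" 1 h b w j j] h w by (simp add: v rho_mem rho_zero)
  have 2: "rho (p * pd j (yvar j * h)) j b w - rho (yvar j * h * pd j p) j b w = 0"
    using rho_bracket[of p 1 "yvar j * h" b w j j] h ev w by (simp add: v rho_mem rho_zero)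
  have "2 *\<^sub>C (p * h) = (p * pd j (yvar j * h) - yvar j * h * pd j p)
      - (yvar j * p * pd j h - h * pd j (yvar j * p))"
    using scaleC_add_left[of 1 1 "p * h"] by (simp add: pd_mult pd_yvar scaleC_one algebra_simps)
  then have "2 *\<^sub>C rho (p * h) j b w = (rho (p * pd j (yvar j * h)) j b w - rho (yvar j * h * pd j p) j b w)
      - (rho (yvar j * p * pd j h) j b w - rho (h * pd j (yvar j * p)) j b w)"
    by (metis clinear_scale[OF rho_fun] clinear_diff[OF rho_fun])
  then show "rho (p * h) j b w = 0" using 1 2 by simp
qed

text \<open>One power beyond \<open>deg_bound\<close>: the spare factor y_i makes y_i h vanish at t
  = 1 for every h, as \<open>high_degree_mult_vanishes\<close> requires.\<close>

lemma power_in_null_ideal: "yvar i ^ Suc deg_bound \<in> null_ideal"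
proof -
  have "vanishes (yvar i ^ deg_bound * (yvar i * h)) j b" for h j b
    by (rule high_degree_mult_vanishes[OF order_refl monomial_power]) simp
  then show ?thesis by (auto simp: null_ideal_def mult_ac)
qed

text \<open>The reducible elements form a subalgebra, so only t_i and its inverse matter. Since t_i
  = 1 + y_i and y_i is nilpotent modulo the ideal, the inverse is a finite geometric series in
  y_i.\<close>

lemma laurent_mod_null_ideal: "\<exists>p\<in>polys 0. f - p \<in> null_ideal"
proof -
  let ?C = "{f. \<exists>p\<in>polys 0. f - p \<in> null_ideal}"
  have C_mult: "f * g \<in> ?C" if fg: "f \<in> ?C" "g \<in> ?C" for f g
  proof -
    obtain p q where p: "p \<in> polys 0" "f - p \<in> null_ideal" and q: "q \<in> polys 0" "g - q \<in> null_ideal"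
      using fg by blast
    have "f * g - p * q = (f - p) * g + (g - q) * p" by (simp add: algebra_simps)
    then have "f * g - p * q \<in> null_ideal" using p q by (simp add: null_ideal_add null_ideal_mult)
    then show ?thesis using polys_mult[OF p(1) q(1)] by auto
  qed
  have C_add: "f + g \<in> ?C" if fg: "f \<in> ?C" "g \<in> ?C" for f g
  proof -
    obtain p q where p: "p \<in> polys 0" "f - p \<in> null_ideal" and q: "q \<in> polys 0" "g - q \<in> null_ideal"
      using fg by blast
    have "f + g - (p + q) = (f - p) + (g - q)" by (simp add: algebra_simps)
    then have "f + g - (p + q) \<in> null_ideal" using p q by (simp only: null_ideal_add)
    then show ?thesis using polys_closed(1)[OF p(1) q(1)] by blast
  qed
  have C_scale: "c *\<^sub>C f \<in> ?C" if f: "f \<in> ?C" for c f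
  proof -
    obtain p where p: "p \<in> polys 0" "f - p \<in> null_ideal" using f by blast
    have "c *\<^sub>C f - c *\<^sub>C p \<in> null_ideal"
      using null_ideal_scale[OF p(2)] by (simp add: cvs.scale_right_diff_distrib)
    then show ?thesis using polys_closed(3)[OF p(1)] by blast
  qed
  have C_polys: "p \<in> ?C" if "p \<in> polys 0" for p
    using that null_ideal_zero by (auto intro!: bexI[of _ p])
  have mon: "m \<in> polys 0" if "monomial k m" for k m
    using monomial_in_polys[OF that, of 0] by simp
  \<comment> \<open>Both signs are carried along because the induction over the lattice includes
    negation, which exchanges them.\<close>
  have "tpow r \<in> ?C \<and> tpow (- r) \<in> ?C" for r
  proof (induction r rule: int_vec_induct)
    case (axis i)
    have "tvar i = 1 + yvar i" by (simp add: yvar_def)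
    moreover have "1 \<in> polys 0" "yvar i \<in> polys 0"
      using mon[OF monomial.one] mon[OF monomial_power[of 1]] by simp_all
    ultimately have t: "tvar i \<in> ?C" using C_polys[of "tvar i"] polys_closed(1) by metis
    \<comment> \<open>The geometric series of 1 / (1 + y_i), cut off so that the remainder is a
      multiple of y_i to the power \<open>Suc deg_bound\<close>.\<close>
    define q where "q = (\<Sum>k\<le>deg_bound. (- yvar i) ^ k)"
    have "(- yvar i) ^ k \<in> polys 0" for k
      using polys_closed(3)[OF mon[OF monomial_power], of "(-1) ^ k" i k]
      by (cases "even k") (simp_all add: scaleC_one)
    then have q: "q \<in> polys 0" unfolding q_def by (intro cvs.subspace_sum[OF polys_subspace])
    have "(1 - (- yvar i)) * q = 1 - (- yvar i) ^ Suc deg_bound"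
      unfolding q_def by (rule sum_gp_basic)
    then have tq: "tvar i * q = 1 - (- yvar i) ^ Suc deg_bound" by (simp add: yvar_def)
    have inv: "tvar i * tpow (- axis i 1) = 1"
      by (simp add: tvar_def tpow_add[symmetric] tpow_zero)
    then have "tpow (- axis i 1) - q = tpow (- axis i 1) * (1 - tvar i * q)"
      by (simp add: algebra_simps)
    also have "\<dots> = (yvar i ^ Suc deg_bound) * ((-1) ^ Suc deg_bound * tpow (- axis i 1))"
      unfolding tq power_minus[of "yvar i"] by (simp add: mult_ac)
    finally have "tpow (- axis i 1) - q \<in> null_ideal"
      using null_ideal_mult[OF power_in_null_ideal] by (simp only:)
    then show ?case using t q unfolding tvar_def by blast
  next
    case (add r s)
    have "- (r + s) = - r + - s" by simp
    then show ?case using add C_mult unfolding tpow_add \<open>- (r + s) = - r + - s\<close> by blast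
  qed simp
  then have t: "tpow r \<in> ?C" for r by blast
  have "f \<in> ?C"
    by (induction f rule: laurent_induct) (rule C_scale[OF t], rule C_add)
  then show ?thesis by blast
qed

lemma laurent_mod_null_ideal_ev1:
  assumes "ev1 f = 0"
  shows "\<exists>p\<in>polys 1. f - p \<in> null_ideal"
proof -
  obtain p where p: "p \<in> polys 0" "f - p \<in> null_ideal" using laurent_mod_null_ideal by blast
  obtain c q where q: "q \<in> polys 1" "p = c *\<^sub>C 1 + q" using polys_0_cases[OF p(1)] by blast
  have "ev1 (f - p) = 0" using p(2) by (simp add: null_ideal_def)
  then have "c = 0" using assms q(2) polys_ev1[OF q(1)] by simp
  then show ?thesis using p(2) q by auto
qed

lemma vanishes_mod_null_ideal:
  assumes "f - p \<in> null_ideal" "w \<in> U"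
  shows "rho f j b w = rho p j b w"
  using null_ideal_vanishes[OF assms(1), of j b] assms(2)
  by (simp add: vanishes_def clinear_diff[OF rho_fun])

text \<open>Two functions that vanish at t = 1 reduce to polynomials without constant term, and
  their product to monomials of degree at least two. The statement concerns a single vector because
  it is applied to a top eigenvector, before vanishing on \<open>U\<close> is known.\<close>

lemma ker_sq_vanishes_locally:
  assumes "\<And>k f. k \<ge> 2 \<Longrightarrow> monomial k f \<Longrightarrow> rho f j b w = 0" "w \<in> U" "f \<in> ker_sq"
  shows "rho f j b w = 0"
proof (rule clinear_vanish_span[OF rho_fun _ assms(3)[unfolded ker_sq_def]])
  fix x :: "'n laurent" assume "x \<in> {g * h | g h. ev1 g = 0 \<and> ev1 h = 0}"
  then obtain g h where x: "x = g * h" "ev1 g = 0" "ev1 h = 0" by blast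
  obtain p q where p: "p \<in> polys 1" "g - p \<in> null_ideal" and q: "q \<in> polys 1" "h - q \<in> null_ideal"
    using laurent_mod_null_ideal_ev1 x by metis
  have "g * h - p * q = (g - p) * h + (h - q) * p" by (simp add: algebra_simps)
  then have "g * h - p * q \<in> null_ideal" using p q by (simp add: null_ideal_add null_ideal_mult)
  then have "rho x j b w = rho (p * q) j b w" unfolding x by (rule vanishes_mod_null_ideal) fact
  also have "p * q \<in> polys 2" using polys_mult[OF p(1) q(1)] by (simp add: numeral_2_eq_2)
  then have "rho (p * q) j b w = 0" unfolding polys_def
    by (rule clinear_vanish_span[OF rho_fun, rotated]) (use assms(1) in blast)
  finally show "rho x j b w = 0" .
qed

text \<open>The element b - psi(b) 1 lies in the kernel of \<open>psi\<close>, so multiplied by c it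
  acts by zero.\<close>

lemma rho_absorb:
  assumes c: "\<And>b' f j. psi b' = 0 \<Longrightarrow> vanishes f j (c * b')" and w: "w \<in> U"
  shows "rho f j (c * b) w = psi b *\<^sub>C rho f j c w"
proof -
  have "vanishes f j (c * (b - psi b *\<^sub>C 1))" by (rule c) simp
  then show ?thesis using w
    by (simp add: vanishes_def right_diff_distrib scaleC_mult_right clinear_diff[OF rho_alg] clinear_scale[OF rho_alg])
qed

text \<open>The hypothesis on \<open>c\<close> lets \<open>rho_absorb\<close> bring brackets with
  coefficient c b back to coefficient c, which makes the null space stable. The lemma serves twice:
  for products of elements of ker psi during the descent, and for c = 1 afterwards.\<close>

lemma ker_sq_vanishes:
  assumes c: "\<And>b' f j. psi b' = 0 \<Longrightarrow> vanishes f j (c * b')" and f: "f \<in> ker_sq"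
  shows "vanishes f j c"
proof -
  define S where "S = {w \<in> U. \<forall>f\<in>ker_sq. \<forall>j. rho f j c w = 0}"
  have sub: "cvs.subspace S"
    using U_sub unfolding S_def cvs.subspace_def
    by (auto simp: rho_zero clinear_add[OF rho_lin] clinear_scale[OF rho_lin])
  obtain w k where w: "w \<in> U" "w \<noteq> 0" "euler_op w = k *\<^sub>C w"
    and top: "\<And>w' k'. w' \<in> U \<Longrightarrow> euler_op w' = k' *\<^sub>C w' \<Longrightarrow> Re k' > Re k \<Longrightarrow> w' = 0"
    using top_eigenvector[OF euler_lin U_fin U_sub euler_mem U_nonzero] by blast
  have "rho f j c w = 0" if f: "f \<in> ker_sq" for f j
  proof (rule ker_sq_vanishes_locally[OF _ w(1) f])
    fix l and m :: "'n laurent" assume l: "l \<ge> 2" "monomial l m"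
    have "ev1 m * psi c = 0" using monomial_ev1[OF l(2)] l(1) by simp
    then have "euler_op (rho m j c w) = (k + (of_nat l - 1)) *\<^sub>C rho m j c w"
      using euler_comm[OF l(2) _ w(1), of c j] w(3)
      by (simp add: clinear_scale[OF rho_lin] scaleC_add_left)
    then show "rho m j c w = 0" by (rule top[OF rho_mem[OF w(1)]]) (use l in simp)
  qed
  then have "w \<in> S" using w by (simp add: S_def)
  then have "S \<noteq> {0}" using w by blast
  moreover have "S = {0} \<or> S = U"
  proof (rule rho_irreducible[OF sub])
    show "S \<subseteq> U" by (auto simp: S_def)
    fix g :: "'n laurent" and i b w assume good: "ev1 g * psi b = 0" and w: "w \<in> S"
    have wU: "w \<in> U" using w by (simp add: S_def)
    have ker: "rho f j c w = 0" if "f \<in> ker_sq" for f j using w that by (simp add: S_def)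
    have "rho f j c (rho g i b w) = 0" if f: "f \<in> ker_sq" for f j
    proof (rule clinear_vanish_span[OF rho_fun _ f[unfolded ker_sq_def]])
      fix x :: "'n laurent" assume "x \<in> {g * h | g h. ev1 g = 0 \<and> ev1 h = 0}"
      then obtain g1 h1 where x: "x = g1 * h1" "ev1 g1 = 0" "ev1 h1 = 0" by blast
      have "rho x j c (rho g i b w)
        = rho g i b (rho x j c w) + rho (x * pd j g) i (c * b) w - rho (g * pd i x) j (c * b) w"
        by (rule rho_comm) (use x good wU in simp_all)
      also have "\<dots> = psi b *\<^sub>C rho (x * pd j g) i c w - psi b *\<^sub>C rho (g * pd i x) j c w"
        using x by (simp add: ker ker_sq_mult rho_zero rho_absorb[OF c wU])
      \<comment> \<open>If psi b = 0, both terms carry the factor zero. Otherwise \<open>g\<close>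
        vanishes at t = 1, and both coefficients stay in \<open>ker_sq\<close>.\<close>
      also have "\<dots> = 0"
      proof (cases "psi b = 0")
        case False
        then have g: "ev1 g = 0" using good by simp
        have "x * pd j g \<in> ker_sq" unfolding x mult.assoc by (rule ker_sq_mult) (simp_all add: x)
        moreover have "g * pd i x \<in> ker_sq" by (rule ker_sq_mult[OF g]) (simp add: x pd_mult)
        ultimately show ?thesis by (simp add: ker)
      qed simp
      finally show "rho x j c (rho g i b w) = 0" .
    qed
    then show "rho g i b w \<in> S" using rho_mem[OF wU] by (simp add: S_def)
  qed
  ultimately have "S = U" by blast
  then show ?thesis using f unfolding S_def vanishes_def by blast
qed

text \<open>
  \<open>y\<^sub>i d\<^sub>j \<otimes> c\<close> is half the bracket of \<open>d\<^sub>i \<otimes> c\<close> with \<open>y\<^sub>i\<^sup>2 d\<^sub>j\<close> and commutes with both, since \<open>c\<^sup>2\<close>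
  and \<open>ker_sq \<otimes> c\<close> act by zero. As \<open>d\<^sub>i \<otimes> c\<close> is nilpotent, its only eigenvalue is \<open>0\<close>.
\<close>

lemma vanishes_step:
  assumes c0: "psi c = 0" and c: "\<And>b' f j. psi b' = 0 \<Longrightarrow> vanishes f j (c * b')"
  shows "vanishes f j c"
proof -
  have ks: "vanishes f j c" if "f \<in> ker_sq" for f j
    by (rule ker_sq_vanishes[OF _ that]) (rule c)
  have cc: "rho f j (c * c) w = 0" if "w \<in> U" for f j w
    using c[OF c0, of f j] that by (simp add: vanishes_def)
  have comm: "rho f i c (rho g j c w) = rho g j c (rho f i c w)" if "w \<in> U" for f g i j w
    using rho_comm[of f c g c w i j] that c0 by (simp add: cc)
  \<comment> \<open>A constant coefficient has degree 0, so the bracket with the Euler operator is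
    multiplication by -1. The field d/dt_i (x) c vanishes at (1, psi) because psi c = 0.\<close>
  have A_nil: "\<exists>n. \<forall>w\<in>U. (rho 1 i c ^^ n) w = 0" for i
    by (rule ad_eigenvector_nilpotent[OF euler_lin rho_lin U_fin U_sub euler_mem rho_mem
          euler_comm[OF monomial.one]]) (simp_all add: c0)
  have A_eig: "k = 0" if w: "w \<in> U" "w \<noteq> 0" "rho 1 i c w = k *\<^sub>C w" for w k i
  proof -
    obtain n where n: "\<forall>w\<in>U. (rho 1 i c ^^ n) w = 0" using A_nil by blast
    have "(rho 1 i c ^^ m) w = k ^ m *\<^sub>C w" for m
      by (induction m) (simp_all add: scaleC_one w(3) clinear_scale[OF rho_lin] scaleC_scaleC mult.commute)
    then show ?thesis using n w by auto
  qed
  have z_eig: "k = 0" if w: "w \<in> U" "w \<noteq> 0" "rho (yvar i) j c w = k *\<^sub>C w" for w k i j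
  proof -
    let ?z = "rho (yvar i) j c" and ?A = "rho 1 i c" and ?B = "rho (yvar i * yvar i) j 1"
    let ?S = "{w \<in> U. ?z w = k *\<^sub>C w}"
    obtain n where n: "\<forall>w\<in>U. (?A ^^ n) w = 0" using A_nil by blast
    \<comment> \<open>On the \<open>k\<close>-eigenspace of \<open>?z\<close> the commutator of
      \<open>?A\<close> and \<open>?B\<close> is the scalar 2 k.\<close>
    have "2 * k = 0"
    proof (rule heisenberg_central_zero[where A = ?A and B = ?B and S = ?S and n = n and w = w])
      show "?A u \<in> ?S" if "u \<in> ?S" for u
        using that comm[of u "yvar i" j 1 i] by (simp add: rho_mem clinear_scale[OF rho_lin])
      show "?B u \<in> ?S" if u: "u \<in> ?S" for u
      proof -
        have "yvar i * pd j (yvar i * yvar i) \<in> ker_sq"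
          by (rule ker_sq_mult) (simp_all add: pd_mult)
        moreover have "yvar i * yvar i * pd j (yvar i) \<in> ker_sq"
          unfolding mult.assoc by (rule ker_sq_mult) simp_all
        ultimately have "?z (?B u) = ?B (?z u)"
          using rho_comm[of "yvar i" c "yvar i * yvar i" 1 u j j] u ks
          by (simp add: vanishes_def)
        then show ?thesis using u by (simp add: rho_mem clinear_scale[OF rho_lin])
      qed
      show "?A (?B u) = ?B (?A u) + (2 * k) *\<^sub>C u" if u: "u \<in> ?S" for u
      proof -
        have "pd i (yvar i * yvar i) = 2 *\<^sub>C yvar i"
          using scaleC_add_left[of 1 1 "yvar i"] by (simp add: pd_mult pd_yvar scaleC_one)
        then have "?A (?B u) = ?B (?A u) + 2 *\<^sub>C ?z u"
          using rho_comm[of 1 c "yvar i * yvar i" 1 u i j] u c0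
          by (simp add: clinear_zero[OF rho_fun] clinear_scale[OF rho_fun])
        then show ?thesis using u by (simp add: scaleC_scaleC)
      qed
    qed (use w n rho_lin in auto)
    then show ?thesis by simp
  qed
  \<comment> \<open>Fields with coefficient c commute on \<open>U\<close>, since their brackets have
    coefficient c^2. These finitely many suffice: modulo \<open>ker_sq\<close> every Laurent
    polynomial is a combination of 1 and the y_i.\<close>
  let ?X = "range (\<lambda>(i, j). rho (yvar i) j c) \<union> range (\<lambda>j. rho 1 j c)"
  have "\<exists>w\<in>U. w \<noteq> 0 \<and> (\<forall>x\<in>?X. \<exists>k. x w = k *\<^sub>C w)"
    by (rule common_eigenvector[OF _ _ U_fin U_sub U_nonzero]) (auto simp: rho_lin rho_mem comm)
  then obtain w where w: "w \<in> U" "w \<noteq> 0" "\<forall>x\<in>?X. \<exists>k. x w = k *\<^sub>C w" by blast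
  have w_A: "rho 1 j c w = 0" for j
  proof -
    obtain k where k: "rho 1 j c w = k *\<^sub>C w" using w(3) by blast
    then show ?thesis using A_eig[OF w(1,2) k] by simp
  qed
  have w_z: "rho (yvar i) j c w = 0" for i j
  proof -
    have "rho (yvar i) j c \<in> ?X" by (rule UnI1) (rule range_eqI[of _ _ "(i, j)"], simp)
    then obtain k where k: "rho (yvar i) j c w = k *\<^sub>C w" using w(3) by blast
    then show ?thesis using z_eig[OF w(1,2) k] by simp
  qed
  define S where "S = {w \<in> U. \<forall>f j. rho f j c w = 0}"
  have "rho f j c w = 0" for f j
  proof -
    have "rho (f - ev1 f *\<^sub>C 1 - (\<Sum>j\<in>UNIV. ev1 (pd j f) *\<^sub>C yvar j)) j c w = 0"
      using ks[OF laurent_taylor] w(1) by (simp add: vanishes_def)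
    then show ?thesis
      by (simp add: clinear_diff[OF rho_fun] clinear_sum[OF rho_fun] clinear_scale[OF rho_fun] w_A w_z)
  qed
  then have "w \<in> S" using w by (simp add: S_def)
  then have "S \<noteq> {0}" using w by blast
  moreover have "S = {0} \<or> S = U"
  proof (rule rho_irreducible)
    show "cvs.subspace S"
      using U_sub unfolding S_def cvs.subspace_def
      by (auto simp: rho_zero clinear_add[OF rho_lin] clinear_scale[OF rho_lin])
    show "S \<subseteq> U" by (auto simp: S_def)
    fix g :: "'n laurent" and i b w assume good: "ev1 g * psi b = 0" and w: "w \<in> S"
    then have wU: "w \<in> U" by (simp add: S_def)
    have "rho f j c (rho g i b w) = 0" for f j
      using rho_comm[of f c g b w j i] good w wU c0 by (simp add: S_def rho_zero rho_absorb[OF c wU])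
    then show "rho g i b w \<in> S" using rho_mem[OF wU] by (simp add: S_def)
  qed
  ultimately have "S = U" by blast
  then show ?thesis unfolding S_def vanishes_def by blast
qed

text \<open>Generators of the k-th power of the ideal ker psi: k factors from the kernel and one
  arbitrary factor.\<close>

inductive ker_power :: "nat \<Rightarrow> 'b \<Rightarrow> bool"
  where zero: "ker_power 0 b"
  | mult: "psi b = 0 \<Longrightarrow> ker_power k c \<Longrightarrow> ker_power (Suc k) (b * c)"

text \<open>
  Bracketing \<open>b d\<^sub>i\<close> with \<open>y\<^sub>i f c d\<^sub>j\<close> and summing over \<open>i\<close> gives \<open>(n + deg f) f b c d\<^sub>j\<close>, so each
  factor in the kernel of \<open>psi\<close> lowers the vanishing degree by one.
\<close>

lemma ker_power_descent:
  "ker_power k c \<Longrightarrow> monomial l f \<Longrightarrow> deg_bound \<le> k + l \<Longrightarrow> vanishes f j c"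
proof (induction arbitrary: l f rule: ker_power.induct)
  case (zero b)
  then show ?case using deg_bound by simp
next
  case (mult b k c)
  have v: "rho (yvar i * f) j c w = 0" if "w \<in> U" for i w
    using mult.IH[OF monomial.mult[OF mult.prems(1), of i]] mult.prems(2) that by (simp add: vanishes_def)
  show ?case unfolding vanishes_def
  proof
    fix w assume w: "w \<in> U"
    have "rho (f + yvar i * pd i f) j (b * c) w = 0" for i
    proof -
      have "pd i (yvar i * f) = f + yvar i * pd i f" by (simp add: pd_mult pd_yvar)
      then show ?thesis
        using rho_bracket[of 1 b "yvar i * f" c w i j] mult.hyps(1) w
        by (simp add: v rho_mem rho_zero clinear_zero[OF rho_fun])
    qed
    then have "rho (\<Sum>i\<in>UNIV. f + yvar i * pd i f) j (b * c) w = 0"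
      by (simp add: clinear_sum[OF rho_fun])
    also have "(\<Sum>i\<in>UNIV. f + yvar i * pd i f) = of_nat (CARD('n) + l) *\<^sub>C f"
    proof -
      have "(\<Sum>i\<in>I. f) = of_nat (card I) *\<^sub>C f" if "finite I" for I :: "'n set"
        using that by (induction I) (simp_all add: scaleC_add_left scaleC_one del: sum_constant)
      then show ?thesis
        by (simp add: sum.distrib monomial_euler[OF mult.prems(1)] scaleC_add_left del: sum_constant)
    qed
    \<comment> \<open>The scalar n + l is nonzero even for l = 0, because n is at least 1.\<close>
    finally show "rho f j (b * c) w = 0"
      using zero_less_card_finite[where 'a = 'n] by (simp add: clinear_scale[OF rho_fun] del: of_nat_add)
  qed
qed

text \<open>With \<open>deg_bound\<close> factors from the kernel, \<open>ker_power_descent\<close>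
  reaches degree 0 and kills all polynomial coefficients, hence all Laurent ones. From there
  \<open>vanishes_step\<close> removes one factor at a time.\<close>

lemma rho_psi_zero:
  assumes "psi b = 0"
  shows "vanishes f j b"
proof -
  have base: "vanishes f j c" if c: "ker_power deg_bound c" for c f j
    unfolding vanishes_def
  proof
    fix w assume w: "w \<in> U"
    obtain p where p: "p \<in> polys 0" "f - p \<in> null_ideal" using laurent_mod_null_ideal by blast
    have "rho p j c w = 0"
      by (rule clinear_vanish_span[OF rho_fun _ p(1)[unfolded polys_def]])
        (use ker_power_descent[OF c] w in \<open>auto simp: vanishes_def\<close>)
    then show "rho f j c w = 0" using vanishes_mod_null_ideal[OF p(2) w] by simp
  qed
  \<comment> \<open>The exponent \<open>Suc n\<close> stops the downward induction at one factor:
    \<open>vanishes_step\<close> needs psi c = 0, which fails for products of no factors in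
    general.\<close>
  have "\<forall>c f j. ker_power (Suc n) c \<longrightarrow> vanishes f j c" if "n < deg_bound" for n
    using that
  proof (induction "deg_bound - Suc n" arbitrary: n)
    case 0
    then have "Suc n = deg_bound" by simp
    then show ?case using base by simp
  next
    case (Suc m)
    have "m = deg_bound - Suc (Suc n)" "Suc n < deg_bound" using Suc.hyps(2) by linarith+
    then have IH: "vanishes f j c" if "ker_power (Suc (Suc n)) c" for c f j
      using Suc.hyps(1)[of "Suc n"] that by blast
    show ?case
    proof (intro allI impI)
      fix c f j assume c: "ker_power (Suc n) c"
      show "vanishes f j c"
      proof (rule vanishes_step)
        show "psi c = 0" using c by cases simp
        show "vanishes f j (c * b')" if "psi b' = 0" for b' f j
          using IH[OF ker_power.mult[OF that c]] by (simp add: mult.commute)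
      qed
    qed
  qed
  moreover have "ker_power (Suc 0) (b * 1)" using assms by (intro ker_power.intros)
  ultimately show ?thesis using deg_bound_pos by simp
qed

lemma rho_ker_sq: "f \<in> ker_sq \<Longrightarrow> vanishes f j 1"
  by (rule ker_sq_vanishes) (simp_all add: rho_psi_zero)

end


section \<open>Highest weights of irreducible \<open>gl\<^sub>n\<close>-modules\<close>

definition diag_mat :: "('n \<Rightarrow> complex) \<Rightarrow> complex ^ 'n ^ 'n::finite"
  where "diag_mat d = (\<chi> i j. if i = j then d i else 0)"

lemma matrix_unit_mult:
  "matrix_unit i j ** matrix_unit k l = (if j = k then matrix_unit i l else 0)"
proof -
  have "(\<Sum>m\<in>UNIV. (if p = i \<and> m = j then 1 else 0) * (if m = k \<and> q = l then 1 else 0 :: complex))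
    = (\<Sum>m\<in>UNIV. if m = j then (if p = i \<and> j = k \<and> q = l then 1 else 0) else 0)" for p q
    by (rule sum.cong) auto
  then show ?thesis by (auto simp: vec_eq_iff matrix_unit_def matrix_matrix_mult_def)
qed

lemma diag_mat_mult_left: "(diag_mat d ** X) $ i $ j = d i * X $ i $ j"
  by (simp add: diag_mat_def matrix_matrix_mult_def if_distrib[of "\<lambda>x. x * _"] cong: if_cong)

lemma diag_mat_mult_right: "(X ** diag_mat d) $ i $ j = X $ i $ j * d j"
  by (simp add: diag_mat_def matrix_matrix_mult_def if_distrib[of "\<lambda>x. _ * x"] cong: if_cong)

lemma commutator_diag_unit: "commutator (diag_mat d) (matrix_unit i j) = (d i - d j) *\<^sub>C matrix_unit i j"
  by (simp add: vec_eq_iff commutator_def diag_mat_mult_left diag_mat_mult_right)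
    (simp add: matrix_unit_def scaleC_vec_def algebra_simps)

lemma commutator_diag_diag: "commutator (diag_mat d) (diag_mat e) = 0"
  by (simp add: vec_eq_iff commutator_def diag_mat_mult_left diag_mat_mult_right)
    (simp add: diag_mat_def)

lemma diag_mat_eq_sum: "diag_mat d = (\<Sum>k\<in>UNIV. d k *\<^sub>C matrix_unit k k)"
proof -
  have "(\<Sum>k\<in>UNIV. d k * (if i = k \<and> j = k then 1 else 0)) = (\<Sum>k\<in>UNIV. if k = i then (if i = j then d i else 0) else 0)" for i j
    by (rule sum.cong) auto
  then show ?thesis by (simp add: vec_eq_iff diag_mat_def matrix_unit_def scaleC_vec_def)
qed

lemma matrix_unit_diag: "matrix_unit k k = diag_mat (\<lambda>i. if i = k then 1 else 0)"
  by (auto simp: vec_eq_iff diag_mat_def matrix_unit_def)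

lemma sl_cartan_diag: "h \<in> sl_cartan \<Longrightarrow> h = diag_mat (\<lambda>i. h $ i $ i)"
  by (auto simp: vec_eq_iff diag_mat_def sl_cartan_def)

text \<open>\<open>lin\<close> asks for linearity on the whole type, because the operator lemmas are
  about globally linear maps, while \<open>lie_module\<close> speaks only of
  \<open>W\<close>.\<close>

locale gl_module =
  fixes W :: "'w::complex_vector set"
    and \<rho> :: "complex ^ 'n::{finite,linorder} ^ 'n::{finite,linorder} \<Rightarrow> 'w \<Rightarrow> 'w"
  assumes mod: "lie_module UNIV commutator W \<rho>"
    and irr: "irreducible_module UNIV W \<rho>"
    and fin: "finite_dim W"
    and lin: "clinear (\<rho> X)"
begin

lemma sub: "cvs.subspace W"
  and mem: "w \<in> W \<Longrightarrow> \<rho> X w \<in> W"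
  and add_mat: "w \<in> W \<Longrightarrow> \<rho> (X + Y) w = \<rho> X w + \<rho> Y w"
  and scale_mat: "w \<in> W \<Longrightarrow> \<rho> (c *\<^sub>C X) w = c *\<^sub>C \<rho> X w"
  and comm: "w \<in> W \<Longrightarrow> \<rho> (commutator X Y) w = \<rho> X (\<rho> Y w) - \<rho> Y (\<rho> X w)"
  using mod unfolding lie_module_def by auto

lemma zero_mat: "w \<in> W \<Longrightarrow> \<rho> 0 w = 0"
  using scale_mat[of w 0 0] by simp

lemma diff_mat: "w \<in> W \<Longrightarrow> \<rho> (X - Y) w = \<rho> X w - \<rho> Y w"
  using add_mat[of w "X - Y" Y] by simp

lemma sum_mat: "w \<in> W \<Longrightarrow> \<rho> (\<Sum>i\<in>I. X i) w = (\<Sum>i\<in>I. \<rho> (X i) w)"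
  by (induction I rule: infinite_finite_induct) (simp_all add: zero_mat add_mat)

lemma nonzero: "W \<noteq> {0}"
  using irr by (simp add: irreducible_module_def)

lemma irreducible: "cvs.subspace N \<Longrightarrow> N \<subseteq> W \<Longrightarrow> (\<And>X w. w \<in> N \<Longrightarrow> \<rho> X w \<in> N) \<Longrightarrow> N = {0} \<or> N = W"
  using irr by (auto simp: irreducible_module_def)

lemma identity_scalar: "\<exists>c. \<forall>w\<in>W. \<rho> (mat 1) w = c *\<^sub>C w"
proof -
  obtain w c where w: "w \<in> W" "w \<noteq> 0" "\<rho> (mat 1) w = c *\<^sub>C w"
    using eigenvector_exists[OF lin fin sub mem nonzero] by blast
  let ?N = "{w \<in> W. \<rho> (mat 1) w = c *\<^sub>C w}"
  have "?N = {0} \<or> ?N = W"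
  proof (rule irreducible)
    show "cvs.subspace ?N" by (rule eigenspace_subspace[OF lin sub])
    fix X u assume u: "u \<in> ?N"
    then have "\<rho> (mat 1) (\<rho> X u) = \<rho> X (\<rho> (mat 1) u)"
      using comm[of u "mat 1" X] by (simp add: commutator_def zero_mat)
    then show "\<rho> X u \<in> ?N" using u by (simp add: mem clinear_scale[OF lin])
  qed auto
  then show ?thesis using w by blast
qed

text \<open>Every matrix is a traceless one plus a multiple of the identity, which acts by a scalar.
  Hence subspaces stable under \<open>sl\<close> are stable under all matrices.\<close>

lemma irreducible_sl: "irreducible_module sl W \<rho>"
  unfolding irreducible_module_def
proof (intro conjI allI impI nonzero)
  fix N assume N: "cvs.subspace N \<and> N \<subseteq> W \<and> (\<forall>x\<in>sl. \<forall>v\<in>N. \<rho> x v \<in> N)"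
  obtain c where c: "\<forall>w\<in>W. \<rho> (mat 1) w = c *\<^sub>C w" using identity_scalar by blast
  show "N = {0} \<or> N = W"
  proof (rule irreducible)
    fix X :: "complex ^ 'n::{finite,linorder} ^ 'n::{finite,linorder}" and w assume w: "w \<in> N"
    let ?t = "trace X / of_nat CARD('n)"
    have "trace (?t *\<^sub>C mat 1 :: complex ^ 'n::{finite,linorder} ^ 'n::{finite,linorder}) = trace X"
      by (simp add: trace_def scaleC_vec_def mat_def)
    then have "trace (X - ?t *\<^sub>C mat 1) = 0" by (simp add: trace_sub)
    then have "\<rho> (X - ?t *\<^sub>C mat 1) w \<in> N" using N w by (simp add: sl_def)
    moreover have "?t *\<^sub>C c *\<^sub>C w \<in> N" using N w by (simp add: cvs.subspace_scale)
    ultimately have "\<rho> (X - ?t *\<^sub>C mat 1) w + ?t *\<^sub>C c *\<^sub>C w \<in> N" using N by (simp add: cvs.subspace_add)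
    moreover have "w \<in> W" using N w by blast
    ultimately show "\<rho> X w \<in> N" using c by (simp add: diff_mat scale_mat)
  qed (use N in auto)
qed

text \<open>For a diagonal matrix with strictly decreasing entries, E_ij with i < j raises
  eigenvalues by r_i - r_j > 0. Its whole top eigenspace is thus killed by the positive root
  vectors, and the diagonal units have a common eigenvector inside it.\<close>

lemma highest_weight_vector:
  "\<exists>w\<in>W. \<exists>l. w \<noteq> 0 \<and> (\<forall>i j. i < j \<longrightarrow> \<rho> (matrix_unit i j) w = 0) \<and>
    (\<forall>d. \<rho> (diag_mat d) w = (\<Sum>k\<in>UNIV. d k * l k) *\<^sub>C w)"
proof -
  \<comment> \<open>Minus the position of the index: the index type is an abstract finite linear
    order, and counting smaller elements gives the required decreasing numbers.\<close>
  define r :: "'n \<Rightarrow> complex" where "r i = - of_nat (card {l. l < i})" for i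
  have r: "Re (r i - r j) > 0" if "i < j" for i j
  proof -
    have "{l. l < i} \<subset> {l. l < j}" using that by auto
    then have "card {l. l < i} < card {l. l < j}" by (rule psubset_card_mono[rotated]) simp
    then show ?thesis by (simp add: r_def)
  qed
  let ?h = "\<rho> (diag_mat r)"
  obtain w0 k where w0: "w0 \<in> W" "w0 \<noteq> 0" "?h w0 = k *\<^sub>C w0"
    and top: "\<And>w' k'. w' \<in> W \<Longrightarrow> ?h w' = k' *\<^sub>C w' \<Longrightarrow> Re k' > Re k \<Longrightarrow> w' = 0"
    using top_eigenvector[OF lin fin sub mem nonzero, of "diag_mat r"] by blast
  let ?T = "{w \<in> W. ?h w = k *\<^sub>C w}"
  let ?X = "range (\<lambda>k. \<rho> (matrix_unit k k))"
  have diag_comm: "\<rho> (diag_mat d) (\<rho> (diag_mat e) w) = \<rho> (diag_mat e) (\<rho> (diag_mat d) w)" if "w \<in> W" for d e w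
    using comm[OF that, of "diag_mat d" "diag_mat e"] that by (simp add: commutator_diag_diag zero_mat)
  have "\<exists>w\<in>?T. w \<noteq> 0 \<and> (\<forall>x\<in>?X. \<exists>k. x w = k *\<^sub>C w)"
  proof (rule common_eigenvector)
    show "finite_dim ?T" by (rule finite_dim_subset[OF fin]) auto
    show "cvs.subspace ?T" by (rule eigenspace_subspace[OF lin sub])
    show "?T \<noteq> {0}" using w0 by blast
    show "x w \<in> ?T" if x: "x \<in> ?X" and w: "w \<in> ?T" for x w
    proof -
      obtain d where "x = \<rho> (diag_mat d)" using x by (auto simp: matrix_unit_diag)
      then show ?thesis using w diag_comm[of w r d] by (simp add: mem clinear_scale[OF lin])
    qed
    show "x (y w) = y (x w)" if "x \<in> ?X" "y \<in> ?X" "w \<in> ?T" for x y w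
      using that by (auto simp: matrix_unit_diag intro: diag_comm)
  qed (auto simp: lin)
  then obtain w where w: "w \<in> ?T" "w \<noteq> 0" "\<forall>x\<in>?X. \<exists>k. x w = k *\<^sub>C w" by blast
  then have "\<forall>i. \<exists>k. \<rho> (matrix_unit i i) w = k *\<^sub>C w" by blast
  then obtain l where l: "\<rho> (matrix_unit i i) w = l i *\<^sub>C w" for i by metis
  have "\<rho> (matrix_unit i j) w = 0" if "i < j" for i j
  proof (rule top)
    show "?h (\<rho> (matrix_unit i j) w) = (k + (r i - r j)) *\<^sub>C \<rho> (matrix_unit i j) w"
    proof -
      have "?h (\<rho> (matrix_unit i j) w) = \<rho> (matrix_unit i j) (?h w) + (r i - r j) *\<^sub>C \<rho> (matrix_unit i j) w"
        using comm[of w "diag_mat r" "matrix_unit i j"] w(1)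
        by (simp add: commutator_diag_unit scale_mat eq_diff_eq add.commute)
      then show ?thesis using w(1) by (simp add: clinear_scale[OF lin] scaleC_add_left)
    qed
  qed (use w mem r[OF that] in auto)
  moreover have "\<rho> (diag_mat d) w = (\<Sum>k\<in>UNIV. d k * l k) *\<^sub>C w" for d
    using w(1) by (simp add: diag_mat_eq_sum sum_mat scale_mat l scaleC_scaleC cvs.scale_sum_left)
  ultimately show ?thesis using w by blast
qed

text \<open>Along the string of vectors Y^k w one has X Y^(k+1) w = (k+1)(m - k) Y^k w. As Y is
  nilpotent, the string has a last nonzero member Y^k w, and this relation gives m = k.\<close>

lemma sl2_weight_natural:
  assumes w: "w \<in> W" "w \<noteq> 0" "\<rho> X w = 0" and H: "\<rho> H w = m *\<^sub>C w"
    and XY: "commutator X Y = H" and HY: "commutator H Y = (- 2) *\<^sub>C Y"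
  shows "m \<in> \<nat>"
proof -
  let ?f = "\<rho> Y"
  have f_mem: "(?f ^^ k) w \<in> W" for k using pow_mem[of W ?f, OF mem w(1)] .
  have HYu: "\<rho> H (?f u) = ?f (\<rho> H u) + (- 2) *\<^sub>C ?f u" if "u \<in> W" for u
    using comm[OF that, of H Y] that by (simp only: HY scale_mat) (simp add: algebra_simps)
  have Hk: "\<rho> H ((?f ^^ k) w) = (m - 2 * of_nat k) *\<^sub>C (?f ^^ k) w" for k
  proof (induction k)
    case (Suc k)
    have "\<rho> H ((?f ^^ Suc k) w) = (m - 2 * of_nat k) *\<^sub>C (?f ^^ Suc k) w + (- 2) *\<^sub>C (?f ^^ Suc k) w"
      using HYu[OF f_mem] Suc by (simp add: clinear_scale[OF lin])
    also have "\<dots> = (m - 2 * of_nat k + (- 2)) *\<^sub>C (?f ^^ Suc k) w" by (simp only: scaleC_add_left)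
    also have "m - 2 * of_nat k + (- 2) = m - 2 * of_nat (Suc k)" by simp
    finally show ?case .
  qed (simp add: H)
  have Xk: "\<rho> X ((?f ^^ Suc k) w) = (of_nat (Suc k) * (m - of_nat k)) *\<^sub>C (?f ^^ k) w" for k
  proof (induction k)
    case 0
    show ?case using comm[OF w(1), of X Y] by (simp add: XY H w(3) clinear_zero[OF lin])
  next
    case (Suc k)
    have "\<rho> X ((?f ^^ Suc (Suc k)) w) = \<rho> H ((?f ^^ Suc k) w) + ?f (\<rho> X ((?f ^^ Suc k) w))"
      using comm[OF f_mem[of "Suc k"], of X Y] by (simp add: XY)
    also have "\<dots> = (m - 2 * of_nat (Suc k)) *\<^sub>C (?f ^^ Suc k) w
        + (of_nat (Suc k) * (m - of_nat k)) *\<^sub>C (?f ^^ Suc k) w"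
      by (simp only: Hk Suc clinear_scale[OF lin]) simp
    also have "\<dots> = (m - 2 * of_nat (Suc k) + of_nat (Suc k) * (m - of_nat k)) *\<^sub>C (?f ^^ Suc k) w"
      by (simp only: scaleC_add_left)
    also have "m - 2 * of_nat (Suc k) + of_nat (Suc k) * (m - of_nat k) = of_nat (Suc (Suc k)) * (m - of_nat (Suc k))"
      by (simp add: algebra_simps)
    finally show ?case .
  qed
  obtain n where n: "\<forall>w\<in>W. (?f ^^ n) w = 0"
    using ad_eigenvector_nilpotent[OF lin lin fin sub mem mem HYu] by auto
  define k where "k = (LEAST k. (?f ^^ k) w = 0)"
  have k: "(?f ^^ k) w = 0" unfolding k_def by (rule LeastI[of _ n]) (use n w in blast)
  then have "k \<noteq> 0" using w(2) by (intro notI) simp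
  then obtain k' where k': "k = Suc k'" by (cases k) auto
  have "(?f ^^ k') w \<noteq> 0" using not_less_Least[of k' "\<lambda>k. (?f ^^ k) w = 0"] k' by (auto simp: k_def)
  moreover have "(of_nat (Suc k') * (m - of_nat k')) *\<^sub>C (?f ^^ k') w = 0"
    using Xk[of k'] k unfolding k' by (simp only: clinear_zero[OF lin])
  ultimately have "m = of_nat k'" by (simp del: of_nat_Suc)
  then show ?thesis by simp
qed

lemma is_V_exists: "\<exists>\<mu> c. dominant_integral \<mu> \<and> is_V \<mu> c W \<rho>"
proof -
  obtain w l where w: "w \<in> W" "w \<noteq> 0" "\<forall>i j. i < j \<longrightarrow> \<rho> (matrix_unit i j) w = 0"
    and l: "\<rho> (diag_mat d) w = (\<Sum>k\<in>UNIV. d k * l k) *\<^sub>C w" for d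
    using highest_weight_vector by blast
  obtain c where c: "\<forall>w\<in>W. \<rho> (mat 1) w = c *\<^sub>C w" using identity_scalar by blast
  \<comment> \<open>The value 0 outside \<open>sl_cartan\<close> is the representation of
    functionals in \<open>dual_space\<close>.\<close>
  define \<mu> where "\<mu> h = (if h \<in> sl_cartan then \<Sum>k\<in>UNIV. h $ k $ k * l k else 0)"
    for h :: "complex ^ 'n::{finite,linorder} ^ 'n::{finite,linorder}"
  have add: "x + y \<in> sl_cartan" if "x \<in> sl_cartan" "y \<in> sl_cartan" for x y :: "complex ^ 'n::{finite,linorder} ^ 'n::{finite,linorder}"
    using that by (simp add: sl_cartan_def sl_def trace_add)
  have scale: "a *\<^sub>C x \<in> sl_cartan" if "x \<in> sl_cartan" for a and x :: "complex ^ 'n::{finite,linorder} ^ 'n::{finite,linorder}"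
    using that by (simp add: sl_cartan_def sl_def trace_def scaleC_vec_def sum_distrib_left[symmetric])
  have "\<mu> \<in> dual_space sl_cartan"
    by (simp add: dual_space_def \<mu>_def add scale)
      (simp add: scaleC_vec_def distrib_right sum.distrib sum_distrib_left mult.assoc)
  have mu: "\<rho> h w = \<mu> h *\<^sub>C w" if "h \<in> sl_cartan" for h
    using l[of "\<lambda>k. h $ k $ k"] sl_cartan_diag[OF that] that by (simp add: \<mu>_def)
  have "\<mu> (matrix_unit i i - matrix_unit j j) \<in> \<nat>" if ij: "i < j" for i j
  proof (rule sl2_weight_natural[OF w(1,2)])
    let ?h = "matrix_unit i i - matrix_unit j j :: complex ^ 'n::{finite,linorder} ^ 'n::{finite,linorder}"
    have "trace (matrix_unit k k :: complex ^ 'n::{finite,linorder} ^ 'n::{finite,linorder}) = 1" for k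
      by (simp add: trace_def matrix_unit_def)
    then have "?h \<in> sl_cartan"
      by (auto simp: sl_cartan_def sl_def trace_sub) (auto simp: matrix_unit_def)
    then show "\<rho> ?h w = \<mu> ?h *\<^sub>C w" by (rule mu)
    show "\<rho> (matrix_unit i j) w = 0" using w(3) ij by simp
    show "commutator (matrix_unit i j) (matrix_unit j i) = ?h"
      by (simp add: commutator_def matrix_unit_mult)
    have "?h = diag_mat (\<lambda>k. (if k = i then 1 else 0) - (if k = j then 1 else 0))"
      by (auto simp: vec_eq_iff matrix_unit_def diag_mat_def)
    then show "commutator ?h (matrix_unit j i) = (- 2) *\<^sub>C matrix_unit j i"
      using ij by (simp only: commutator_diag_unit) auto
  qed
  then have "dominant_integral \<mu>"
    using \<open>\<mu> \<in> dual_space sl_cartan\<close> by (simp add: dominant_integral_def)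
  moreover have "is_V \<mu> c W \<rho>"
    unfolding is_V_def using mod fin irreducible_sl w mu c by blast
  ultimately show ?thesis by blast
qed

end


section \<open>The fibre of a weight module\<close>

text \<open>The left inverse is linear on the whole target and takes values in \<open>S\<close>, so
  that it can be composed freely with other globally linear maps.\<close>

lemma subspace_left_inverse:
  fixes f :: "'a::complex_vector \<Rightarrow> 'c::complex_vector"
  assumes "clinear f" "cvs.subspace S" "inj_on f S"
  shows "\<exists>g. clinear g \<and> range g \<subseteq> S \<and> (\<forall>x\<in>S. g (f x) = x)"
proof -
  interpret vector_space_pair "scaleC :: complex \<Rightarrow> 'a \<Rightarrow> 'a" "scaleC :: complex \<Rightarrow> 'c \<Rightarrow> 'c" ..
  show ?thesis using linear_exists_left_inverse_on[OF assms] by blast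
qed

text \<open>Gives a copy of \<open>U\<close> in a type independent of \<open>'v\<close>, as the
  theorem asks for V(mu, c). \<open>W\<close> is the space of coordinate vectors with respect to a
  basis of \<open>U\<close>.\<close>

lemma finite_dim_coordinates:
  fixes U :: "'v::complex_vector set"
  assumes "finite_dim U" "cvs.subspace U"
  shows "\<exists>(W :: (nat \<Rightarrow>\<^sub>0 complex) set) \<kappa> \<theta>. cvs.subspace W \<and> finite_dim W \<and> clinear \<kappa> \<and> clinear \<theta> \<and>
    \<kappa> ` W = U \<and> range \<theta> \<subseteq> W \<and> (\<forall>w\<in>W. \<theta> (\<kappa> w) = w)"
proof -
  obtain T where T: "T \<subseteq> U" "cvs.independent T" "U \<subseteq> cvs.span T"
    by (rule cvs.maximal_independent_subset)
  obtain T0 where "finite T0" "U \<subseteq> cvs.span T0" using assms(1) by (auto simp: finite_dim_def)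
  then have "finite T" using cvs.independent_span_bound T by blast
  have spanT: "cvs.span T = U" using T assms(2) by (metis cvs.span_minimal subset_antisym)
  obtain n h where h: "bij_betw h {..<n::nat} T"
    using ex_bij_betw_nat_finite[OF \<open>finite T\<close>] by (auto simp: atLeast0LessThan)
  define \<kappa> where "\<kappa> = free_lift h"
  have lin: "clinear \<kappa>" unfolding \<kappa>_def by (rule clinear_free_lift)
  define W :: "(nat \<Rightarrow>\<^sub>0 complex) set" where "W = {x. Poly_Mapping.keys x \<subseteq> {..<n}}"
  have W_sub: "cvs.subspace W"
    unfolding cvs.subspace_def W_def
    by (auto simp: in_keys_iff lookup_add lookup_scaleC subset_iff) (metis add.right_neutral)
  have kW: "\<kappa> x = (\<Sum>i<n. Poly_Mapping.lookup x i *\<^sub>C h i)" if "x \<in> W" for x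
    unfolding \<kappa>_def using that by (intro free_lift_superset) (auto simp: W_def)
  have single_W: "Poly_Mapping.single i c \<in> W" if "i < n" for i and c :: complex
    using that by (simp add: W_def)
  have W_span: "W \<subseteq> cvs.span ((\<lambda>i. Poly_Mapping.single i 1) ` {..<n})"
  proof
    fix x assume x: "x \<in> W"
    have "x = (\<Sum>i<n. Poly_Mapping.lookup x i *\<^sub>C Poly_Mapping.single i 1)"
      using x by (intro poly_mapping_eqI)
        (auto simp: lookup_sum lookup_scaleC lookup_single when_def W_def in_keys_iff subset_iff
          if_distrib[of "\<lambda>y. _ * y"] cong: if_cong)
    also have "\<dots> \<in> cvs.span ((\<lambda>i. Poly_Mapping.single i 1) ` {..<n})"
      by (intro cvs.span_sum cvs.span_scale cvs.span_base) auto
    finally show "x \<in> cvs.span ((\<lambda>i. Poly_Mapping.single i 1) ` {..<n})" .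
  qed
  then have W_fin: "finite_dim W" unfolding finite_dim_def by blast
  have inj: "inj_on \<kappa> W"
  proof (rule inj_onI)
    fix x y assume xy: "x \<in> W" "y \<in> W" "\<kappa> x = \<kappa> y"
    define z where "z = x - y"
    have z: "z \<in> W" "\<kappa> z = 0" using xy W_sub by (simp_all add: z_def cvs.subspace_diff clinear_diff[OF lin])
    have "(\<Sum>v\<in>T. Poly_Mapping.lookup z (inv_into {..<n} h v) *\<^sub>C v) = \<kappa> z"
      unfolding kW[OF z(1)] using h
      by (subst sum.reindex_bij_betw[OF h, symmetric])
        (auto intro!: sum.cong simp: bij_betw_inv_into_left)
    then have "Poly_Mapping.lookup z (inv_into {..<n} h v) = 0" if "v \<in> T" for v
      using T(2) \<open>finite T\<close> that z(2) by (auto simp: cvs.dependent_finite)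
    then have "Poly_Mapping.lookup z i = 0" if "i < n" for i
      using that h bij_betw_inv_into_left[OF h, of i] bij_betwE[OF h] by (metis lessThan_iff)
    moreover have "Poly_Mapping.lookup z i = 0" if "\<not> i < n" for i
      using z(1) that by (auto simp: W_def in_keys_iff subset_iff)
    ultimately have "z = 0" by (intro poly_mapping_eqI) (metis lookup_zero)
    then show "x = y" by (simp add: z_def)
  qed
  obtain \<theta> where \<theta>: "clinear \<theta>" "range \<theta> \<subseteq> W" "\<forall>w\<in>W. \<theta> (\<kappa> w) = w"
    using subspace_left_inverse[OF lin W_sub inj] by blast
  have "\<kappa> ` W \<subseteq> U"
  proof
    fix u assume "u \<in> \<kappa> ` W"
    then obtain x where "x \<in> W" "u = \<kappa> x" by blast
    then have "u = (\<Sum>i<n. Poly_Mapping.lookup x i *\<^sub>C h i)" using kW by simp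
    also have "\<dots> \<in> cvs.span T"
      by (intro cvs.span_sum cvs.span_scale cvs.span_base) (use bij_betwE[OF h] in auto)
    finally show "u \<in> U" by (simp only: spanT)
  qed
  moreover have "U \<subseteq> \<kappa> ` W"
    unfolding spanT[symmetric]
  proof (rule cvs.span_minimal)
    show "cvs.subspace (\<kappa> ` W)" by (rule clinear_subspace_image[OF lin W_sub])
    show "T \<subseteq> \<kappa> ` W"
    proof
      fix v assume "v \<in> T"
      then obtain i where i: "i < n" "v = h i" using h by (auto simp: bij_betw_def)
      then have "v = \<kappa> (Poly_Mapping.single i 1)" by (simp add: \<kappa>_def free_lift_single scaleC_one)
      then show "v \<in> \<kappa> ` W" using single_W[OF i(1)] by blast
    qed
  qed
  ultimately have "\<kappa> ` W = U" by blast
  then show ?thesis using W_sub W_fin lin \<theta> by blast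
qed

section \<open>Brackets with the generators D(u,r) b\<close>

lemma cdot_add_right: "cdot u (v + w) = cdot u v + cdot u w"
  by (simp add: cdot_def sum.distrib distrib_left)

lemma cvec_add: "cvec (r + s) = cvec r + cvec s"
  by (simp add: cvec_def vec_eq_iff)

lemma cvec_zero [simp]: "cvec 0 = 0"
  by (simp add: cvec_def vec_eq_iff)

lemma cdot_zero_right [simp]: "cdot u 0 = 0"
  by (simp add: cdot_def)

lemma tau_D_scale: "tau_D (c *\<^sub>C u) r b = c *\<^sub>C tau_D u r b"
  by (simp add: tau_D_eq scaleC_vec_def cvs.scale_sum_right scaleC_scaleC)

lemma tau_D_axis_sum: "tau_D u r b = (\<Sum>i\<in>UNIV. u $ i *\<^sub>C tau_D (axis i 1) r b)"
proof -
  have "tau_D (axis i 1) r b = tau_vf (tpow (r + axis i 1)) i b" for i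
    by (simp add: tau_vf_tpow)
  then show ?thesis by (simp add: tau_D_eq)
qed

lemma lie_bracket_tau_D_t:
  "lie_bracket (tau_D u r b) (tau_t s b') = cdot u (cvec s) *\<^sub>C tau_t (r + s) (b * b')"
  unfolding tau_D_def tau_t_def lie_bracket_tensor lie_bracket_Dop_tpow
  by (simp only: clinear_scale[OF clinear_of_fun] tensor_scale_left)

lemma lie_bracket_tau_D0_D:
  "lie_bracket (tau_D v 0 1) (tau_D u r b) = cdot v (cvec r) *\<^sub>C tau_D u r b"
proof -
  have "lie_bracket (Dop v 0) (Dop u r) = Dop (cdot v (cvec r) *\<^sub>C u) r"
    by (simp add: lie_bracket_Dop_Dop)
  moreover have "lie_bracket (of_der x) (of_der y) = of_der (lie_bracket x y)" for x y :: "'a laurent derivation"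
    by (simp add: lie_bracket_semidirect_def clinear_zero[OF clinear_apply_der])
  ultimately have "lie_bracket (tau_D v 0 1) (tau_D u r b) = tau_D (cdot v (cvec r) *\<^sub>C u) r b"
    by (simp add: tau_D_def lie_bracket_tensor)
  then show ?thesis by (simp add: tau_D_scale)
qed

section \<open>Translations, the action of B, and weights\<close>

locale tau_module =
  fixes act :: "('n::finite, 'b::complex_comm_algebra_1) tau \<Rightarrow> 'v::complex_vector \<Rightarrow> 'v"
  assumes lie: "lie_module UNIV lie_bracket UNIV act"
    and irr: "irreducible_module UNIV UNIV act"
    and weight: "weight_module act"
    and weight_fin: "l \<in> dual_space H_sub \<Longrightarrow> finite_dim (weight_space act l)"
    and assoc: "act (tau_t r b) (act (tau_t s b') v) = act (tau_t (r + s) (b * b')) v"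
    and unit: "act (tau_t 0 1) v = v"
begin

lemma act_lin: "clinear (act x)"
  using lie unfolding lie_module_def clinear_iff by auto

lemma act_alg: "clinear (\<lambda>x. act x v)"
  using lie unfolding lie_module_def clinear_iff by auto

lemma act_bracket: "act (lie_bracket x y) v = act x (act y v) - act y (act x v)"
  using lie unfolding lie_module_def by auto

lemma act_swap: "act x (act y v) = act y (act x v) + act (lie_bracket x y) v"
  by (simp add: act_bracket)

lemma irreducible:
  assumes N: "cvs.subspace N" and D: "\<And>u r b v. v \<in> N \<Longrightarrow> act (tau_D u r b) v \<in> N"
    and t: "\<And>r b v. v \<in> N \<Longrightarrow> act (tau_t r b) v \<in> N"
  shows "N = {0} \<or> N = UNIV"
proof -
  have "act x v \<in> N" if v: "v \<in> N" for x v
    using tau_spanned[of x]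
  proof (induction rule: cvs.span_induct_alt)
    case base
    show ?case by (simp add: clinear_zero[OF act_alg] cvs.subspace_0[OF N])
  next
    case (step c x y)
    then have "act x v \<in> N" using D[OF v] t[OF v] by auto
    then show ?case using step
      by (simp add: clinear_add[OF act_alg] clinear_scale[OF act_alg] cvs.subspace_add[OF N] cvs.subspace_scale[OF N])
  qed
  then show ?thesis using irr N by (auto simp: irreducible_module_def)
qed

text \<open>The operator T_r of the overview.\<close>

definition shift :: "int ^ 'n \<Rightarrow> 'v \<Rightarrow> 'v"
  where "shift r = act (tau_t r 1)"

definition beta :: "'b \<Rightarrow> 'v \<Rightarrow> 'v"
  where "beta b = act (tau_t 0 b)"

lemma shift_lin: "clinear (shift r)" and beta_lin: "clinear (beta b)"
  by (simp_all add: shift_def beta_def act_lin)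

lemma shift_shift: "shift r (shift s v) = shift (r + s) v"
  by (simp add: shift_def assoc)

lemma shift_zero [simp]: "shift 0 v = v"
  by (simp add: shift_def unit)

lemma act_tau_t: "act (tau_t r b) v = shift r (beta b v)"
  by (simp add: shift_def beta_def assoc)

lemma beta_shift: "beta b (shift r v) = shift r (beta b v)"
  by (simp add: shift_def beta_def assoc)

lemma beta_beta: "beta b (beta b' v) = beta (b * b') v"
  by (simp add: beta_def assoc)

lemma act_D_shift:
  "act (tau_D u r b) (shift m v) = shift m (act (tau_D u r b) v) + cdot u (cvec m) *\<^sub>C shift (m + r) (beta b v)"
  unfolding shift_def[of m] act_swap[of "tau_D u r b"] lie_bracket_tau_D_t
  by (simp add: clinear_scale[OF act_alg] act_tau_t add.commute)

lemma beta_act_D: "beta b (act (tau_D u r b') v) = act (tau_D u r b') (beta b v)"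
  unfolding beta_def act_swap[of "tau_D u r b'"] lie_bracket_tau_D_t
  by (simp add: clinear_zero[OF act_alg])

lemma weight_vector_exists: "\<exists>l\<in>dual_space H_sub. \<exists>v\<in>weight_space act l. v \<noteq> 0"
proof -
  obtain v :: 'v where v: "v \<noteq> 0" using irr by (auto simp: irreducible_module_def)
  obtain f where f: "\<forall>i\<in>dual_space H_sub. f i \<in> weight_space act i"
      "\<forall>i. i \<notin> dual_space H_sub \<longrightarrow> f i = 0" "v = (\<Sum>i | f i \<noteq> 0. f i)"
    using weight unfolding weight_module_def direct_sum_def by blast
  then obtain l where "f l \<noteq> 0" using v by (metis (mono_tags, lifting) sum.neutral mem_Collect_eq)
  then show ?thesis using f by blast
qed

definition graded :: "complex ^ 'n \<Rightarrow> int ^ 'n \<Rightarrow> 'v set"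
  where "graded \<alpha> m = {v. \<forall>u. act (tau_D u 0 1) v = cdot u (cvec m + \<alpha>) *\<^sub>C v}"

lemma act_Cartan_element:
  "act ((of_fun (c *\<^sub>C tpow 0) + of_der (Dop u 0)) \<otimes>\<^sub>C 1) v = c *\<^sub>C v + act (tau_D u 0 1) v"
proof -
  have "(of_fun (c *\<^sub>C tpow 0) + of_der (Dop u 0)) \<otimes>\<^sub>C 1 = c *\<^sub>C tau_t 0 1 + tau_D u 0 (1::'b)"
    by (simp add: tensor_add_left clinear_scale[OF clinear_of_fun] tensor_scale_left tau_t_def tau_D_def)
  then show ?thesis by (simp add: clinear_add[OF act_alg] clinear_scale[OF act_alg] unit)
qed

text \<open>The vector alpha is read off from any nonzero weight vector. Since t^0 acts as the
  identity, the eigenvalues of the D(u,0) determine the weight on H, so the fibre lies in a single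
  weight space and inherits its finite dimension.\<close>

lemma fibre_exists: "\<exists>\<alpha>. finite_dim (graded \<alpha> 0) \<and> graded \<alpha> 0 \<noteq> {0}"
proof -
  obtain l v where l: "l \<in> dual_space H_sub" and v: "v \<in> weight_space act l" "v \<noteq> 0"
    using weight_vector_exists by blast
  have act_l: "act (h \<otimes>\<^sub>C 1) v = l h *\<^sub>C v" if "h \<in> H_sub" for h
    using v that by (simp add: weight_space_def)
  have H: "of_fun (c *\<^sub>C tpow 0) + of_der (Dop u 0) \<in> H_sub" for c and u :: "complex ^ 'n"
    unfolding H_sub_def by blast
  \<comment> \<open>The zero multiple of t^0 gives D(e_i, 0) the literal form of a member of
    \<open>H_sub\<close>.\<close>
  define \<alpha> :: "complex ^ 'n" where "\<alpha> = (\<chi> i. l (of_fun (0 *\<^sub>C tpow 0) + of_der (Dop (axis i 1) 0)))"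
  have ax: "act (tau_D (axis i 1) 0 1) v = \<alpha> $ i *\<^sub>C v" for i
    using act_l[OF H[of 0 "axis i 1"]] unfolding act_Cartan_element by (simp add: \<alpha>_def)
  have D: "act (tau_D u 0 1) v = cdot u \<alpha> *\<^sub>C v" for u
    by (subst tau_D_axis_sum)
      (simp add: clinear_sum[OF act_alg] clinear_scale[OF act_alg] ax cdot_def cvs.scale_sum_left scaleC_scaleC)
  then have "v \<in> graded \<alpha> 0" by (simp add: graded_def)
  moreover have "graded \<alpha> 0 \<subseteq> weight_space act l"
  proof
    fix w assume w: "w \<in> graded \<alpha> 0"
    have "act (h \<otimes>\<^sub>C 1) w = l h *\<^sub>C w" if "h \<in> H_sub" for h
    proof -
      obtain c u where h: "h = of_fun (c *\<^sub>C tpow 0) + of_der (Dop u 0)" using \<open>h \<in> H_sub\<close> unfolding H_sub_def by blast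
      have "l h *\<^sub>C v = (c + cdot u \<alpha>) *\<^sub>C v"
        using act_l[OF that] by (simp add: h act_Cartan_element D scaleC_add_left)
      then have "l h = c + cdot u \<alpha>" using v(2) by simp
      then show ?thesis using w by (simp add: h act_Cartan_element graded_def scaleC_add_left)
    qed
    then show "w \<in> weight_space act l" by (simp add: weight_space_def)
  qed
  ultimately show ?thesis using finite_dim_subset[OF weight_fin[OF l]] v(2) by blast
qed

end

section \<open>The module as U (x) A\<close>

locale tau_module_fibre = tau_module act
  for act :: "('n::finite, 'b::complex_comm_algebra_1) tau \<Rightarrow> 'v::complex_vector \<Rightarrow> 'v" +
  fixes \<alpha> :: "complex ^ 'n"
  assumes fin: "finite_dim (graded \<alpha> 0)" and nonzero: "graded \<alpha> 0 \<noteq> {0}"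
begin

abbreviation U :: "'v set"
  where "U \<equiv> graded \<alpha> 0"

lemma graded_subspace: "cvs.subspace (graded \<alpha> m)"
  unfolding cvs.subspace_def graded_def
  by (auto simp: clinear_zero[OF act_lin] clinear_add[OF act_lin] clinear_scale[OF act_lin]
      scaleC_add_right cvs.scale_left_commute)

lemma shift_graded: "v \<in> graded \<alpha> m \<Longrightarrow> shift r v \<in> graded \<alpha> (m + r)"
proof -
  assume v: "v \<in> graded \<alpha> m"
  have "beta 1 v = v" by (simp add: beta_def unit)
  then show ?thesis using v
    by (auto simp: graded_def act_D_shift clinear_scale[OF shift_lin] scaleC_add_left[symmetric]
        cdot_add_right cvec_add)
qed

lemma act_D_graded:
  assumes "v \<in> graded \<alpha> m"
  shows "act (tau_D u r b) v \<in> graded \<alpha> (m + r)"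
proof -
  have "act (tau_D v' 0 1) (act (tau_D u r b) v) = cdot v' (cvec (m + r) + \<alpha>) *\<^sub>C act (tau_D u r b) v" for v'
    using assms unfolding act_swap[of "tau_D v' 0 1"] lie_bracket_tau_D0_D
    by (simp add: graded_def clinear_scale[OF act_lin] clinear_scale[OF act_alg] scaleC_add_left[symmetric]
        cdot_add_right cvec_add add_ac)
  then show ?thesis by (simp add: graded_def)
qed

lemma beta_graded:
  assumes "v \<in> graded \<alpha> m"
  shows "beta b v \<in> graded \<alpha> m"
  using assms by (simp add: graded_def beta_act_D[symmetric] clinear_scale[OF beta_lin])

lemma graded_eq_shift: "v \<in> graded \<alpha> m \<Longrightarrow> \<exists>w\<in>U. v = shift m w"
  using shift_graded[of v m "- m"] by (intro bexI[of _ "shift (- m) v"]) (simp_all add: shift_shift)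

text \<open>The generators of \<open>tau\<close> permute the graded pieces up to inclusion, and each
  piece is a translate of \<open>U\<close>. The span of the translates is therefore a nonzero
  submodule.\<close>

lemma shifts_span: "v \<in> cvs.span {shift m w | m w. w \<in> U}"
proof -
  let ?G = "{shift m w | m w. w \<in> U}"
  have graded_G: "v \<in> ?G" if "v \<in> graded \<alpha> m" for v m
    using graded_eq_shift[OF that] by blast
  have G_graded: "\<exists>m. v \<in> graded \<alpha> m" if "v \<in> ?G" for v
    using that shift_graded[of _ 0] by auto
  have "cvs.span ?G = {0} \<or> cvs.span ?G = UNIV"
  proof (rule irreducible)
    fix v assume v: "v \<in> cvs.span ?G"
    show "act (tau_D u r b) v \<in> cvs.span ?G" for u r b
      using v
    proof (induction rule: cvs.span_induct_alt)
      case (step c x y)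
      obtain m where "x \<in> graded \<alpha> m" using G_graded[OF step(1)] by blast
      then have "act (tau_D u r b) x \<in> cvs.span ?G"
        by (intro cvs.span_base graded_G[OF act_D_graded])
      then show ?case using step
        by (simp add: clinear_add[OF act_lin] clinear_scale[OF act_lin] cvs.span_add cvs.span_scale)
    qed (simp add: clinear_zero[OF act_lin] cvs.span_zero)
    show "act (tau_t r b) v \<in> cvs.span ?G" for r b
      using v
    proof (induction rule: cvs.span_induct_alt)
      case (step c x y)
      obtain m where "x \<in> graded \<alpha> m" using G_graded[OF step(1)] by blast
      then have "act (tau_t r b) x \<in> cvs.span ?G"
        unfolding act_tau_t by (intro cvs.span_base graded_G[OF shift_graded[OF beta_graded]])
      then show ?case using step
        by (simp add: clinear_add[OF act_lin] clinear_scale[OF act_lin] cvs.span_add cvs.span_scale)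
    qed (simp add: clinear_zero[OF act_lin] cvs.span_zero)
  qed simp
  moreover obtain w where "w \<in> U" "w \<noteq> 0"
    using nonzero cvs.subspace_0[OF graded_subspace[of 0]] by blast
  then have "w \<in> cvs.span ?G" "w \<noteq> 0" using cvs.span_base[OF graded_G] by auto
  ultimately show ?thesis by blast
qed

text \<open>An index p other than k differs from it in some coordinate i. Subtracting from D(e_i, 0)
  its eigenvalue on \<open>v k\<close> removes that term and multiplies \<open>v p\<close> by the
  nonzero number p_i - k_i.\<close>

lemma graded_independent:
  assumes "finite F" "\<And>m. m \<in> F \<Longrightarrow> v m \<in> graded \<alpha> m" "(\<Sum>m\<in>F. v m) = 0" "m \<in> F"
  shows "v m = 0"
  using assms
proof (induction F arbitrary: v m)
  case (insert k F)
  have F0: "v p = 0" if p: "p \<in> F" for p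
  proof -
    have "p \<noteq> k" using insert.hyps p by blast
    then obtain i where i: "p $ i \<noteq> k $ i" by (auto simp: vec_eq_iff)
    let ?op = "\<lambda>x. act (tau_D (axis i 1) 0 1) x - (of_int (k $ i) + \<alpha> $ i) *\<^sub>C x"
    have op: "?op (v q) = (of_int (q $ i) - of_int (k $ i)) *\<^sub>C v q" if "q \<in> insert k F" for q
      using insert.prems(1)[OF that]
      by (simp add: graded_def cdot_axis cvec_def cvs.scale_left_diff_distrib[symmetric])
    have "0 = ?op (\<Sum>q\<in>insert k F. v q)" by (simp only: insert.prems(2)) (simp add: clinear_zero[OF act_lin])
    also have "\<dots> = (\<Sum>q\<in>insert k F. ?op (v q))"
      by (simp add: clinear_sum[OF act_lin] cvs.scale_sum_right sum_subtractf del: sum.insert)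
    also have "\<dots> = (\<Sum>q\<in>insert k F. (of_int (q $ i) - of_int (k $ i)) *\<^sub>C v q)"
      by (rule sum.cong[OF refl op])
    also have "\<dots> = (\<Sum>q\<in>F. (of_int (q $ i) - of_int (k $ i)) *\<^sub>C v q)"
      using insert.hyps by simp
    finally have "(\<Sum>q\<in>F. (of_int (q $ i) - of_int (k $ i)) *\<^sub>C v q) = 0" by simp
    then have "(of_int (p $ i) - of_int (k $ i)) *\<^sub>C v p = 0"
      by (intro insert.IH[OF _ _ p, of "\<lambda>q. (of_int (q $ i) - of_int (k $ i)) *\<^sub>C v q"])
        (use insert.prems(1) cvs.subspace_scale[OF graded_subspace] in auto)
    then show ?thesis using i by simp
  qed
  then have "v k = 0" using insert.prems(2) insert.hyps by simp
  then show ?case using F0 insert.prems(3) by blast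
qed simp

text \<open>Used twice: with the identity map on \<open>U\<close> to construct the projection, and
  with coordinates on \<open>U\<close> for the final model. \<open>\<Psi>\<close> is defined on the
  tensor product of the ambient spaces, hence \<open>\<phi>\<close> is a left inverse only on
  \<open>tensor_laurent W\<close>.\<close>

lemma tensor_model:
  fixes \<kappa> :: "'w::complex_vector \<Rightarrow> 'v"
  assumes W: "cvs.subspace W" and \<kappa>: "clinear \<kappa>" "\<kappa> ` W = U" "inj_on \<kappa> W"
  shows "\<exists>\<Psi> \<phi>. clinear \<Psi> \<and> clinear \<phi> \<and> (\<forall>w m. \<Psi> (w \<otimes>\<^sub>C tpow m) = shift m (\<kappa> w)) \<and>
    range \<phi> \<subseteq> tensor_laurent W \<and> (\<forall>x\<in>tensor_laurent W. \<phi> (\<Psi> x) = x) \<and> (\<forall>v. \<Psi> (\<phi> v) = v)"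
proof -
  let ?A = "tensor_laurent W :: ('w, 'n laurent) tensor set"
  define \<Psi> :: "('w, 'n laurent) tensor \<Rightarrow> 'v"
    where "\<Psi> = tensor_lift (\<lambda>w f. free_lift (\<lambda>m. shift m (\<kappa> w)) f)"
  have bil: "cbilinear (\<lambda>w f. free_lift (\<lambda>m. shift m (\<kappa> w)) f)"
    unfolding cbilinear_def
  proof (intro conjI allI)
    show "clinear (\<lambda>w. free_lift (\<lambda>m. shift m (\<kappa> w)) f)" for f
      unfolding free_lift_def
      by (rule clinearI)
        (simp_all add: clinear_add[OF \<kappa>(1)] clinear_scale[OF \<kappa>(1)] clinear_add[OF shift_lin]
          clinear_scale[OF shift_lin] scaleC_add_right sum.distrib cvs.scale_sum_right cvs.scale_left_commute mult.commute)
  qed (rule clinear_free_lift)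
  have \<Psi>: "\<Psi> (w \<otimes>\<^sub>C tpow m) = shift m (\<kappa> w)" for w m
    by (simp add: \<Psi>_def tensor_lift_pure[OF bil] tpow_def free_lift_single scaleC_one)
  have lin: "clinear \<Psi>" unfolding \<Psi>_def by (rule clinear_tensor_lift)
  have A_sub: "cvs.subspace ?A" unfolding tensor_laurent_def by simp
  have zero_tensor: "0 \<otimes>\<^sub>C f = 0" for f :: "'n laurent"
    using clinear_zero[OF clinear_tensor_left] .
  have form: "\<exists>F w. finite F \<and> (\<forall>m. w m \<in> W) \<and> x = (\<Sum>m\<in>F. w m \<otimes>\<^sub>C tpow m)" if "x \<in> ?A" for x
    using that unfolding tensor_laurent_def
  proof (induction rule: cvs.span_induct_alt)
    case base
    show ?case using cvs.subspace_0[OF W] by (intro exI[of _ "{}"] exI[of _ "\<lambda>_. 0"]) simp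
  next
    case (step c x y)
    obtain w f where x: "x = w \<otimes>\<^sub>C f" "w \<in> W" using step(1) by blast
    obtain F g where y: "finite F" "\<forall>m. g m \<in> W" "y = (\<Sum>m\<in>F. g m \<otimes>\<^sub>C tpow m)" using step(2) by blast
    let ?K = "Poly_Mapping.keys f"
    have f: "f = (\<Sum>m\<in>?K. Poly_Mapping.lookup f m *\<^sub>C tpow m)"
      by (rule poly_mapping_eqI)
        (auto simp: lookup_sum lookup_scaleC tpow_def lookup_single when_def in_keys_iff
          if_distrib[of "\<lambda>y. _ * y"] cong: if_cong)
    let ?h = "\<lambda>m. (if m \<in> ?K then (c * Poly_Mapping.lookup f m) *\<^sub>C w else 0) + (if m \<in> F then g m else 0)"
    have "c *\<^sub>C x = (\<Sum>m\<in>?K. ((c * Poly_Mapping.lookup f m) *\<^sub>C w) \<otimes>\<^sub>C tpow m)"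
      unfolding x by (subst f)
        (simp add: clinear_sum[OF clinear_tensor_right] clinear_scale[OF clinear_tensor_right]
          tensor_scale_left cvs.scale_sum_right)
    also have "\<dots> = (\<Sum>m\<in>?K \<union> F. (if m \<in> ?K then (c * Poly_Mapping.lookup f m) *\<^sub>C w else 0) \<otimes>\<^sub>C tpow m)"
      by (rule sum.mono_neutral_cong_left) (auto simp: zero_tensor y(1))
    finally have 1: "c *\<^sub>C x = \<dots>" .
    have 2: "y = (\<Sum>m\<in>?K \<union> F. (if m \<in> F then g m else 0) \<otimes>\<^sub>C tpow m)"
      unfolding y(3) by (rule sum.mono_neutral_cong_left) (auto simp: zero_tensor y(1))
    have "c *\<^sub>C x + y = (\<Sum>m\<in>?K \<union> F. ?h m \<otimes>\<^sub>C tpow m)"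
      unfolding 1 by (subst 2) (simp only: tensor_add_left sum.distrib)
    moreover have "?h m \<in> W" for m
      using x(2) y(2) W by (auto intro!: cvs.subspace_add cvs.subspace_scale cvs.subspace_0)
    ultimately show ?case using y(1) by (intro exI[of _ "?K \<union> F"] exI[of _ ?h]) auto
  qed
  have "inj_on \<Psi> ?A"
  proof (rule inj_onI)
    fix x y assume xy: "x \<in> ?A" "y \<in> ?A" "\<Psi> x = \<Psi> y"
    then have z: "x - y \<in> ?A" "\<Psi> (x - y) = 0"
      using cvs.subspace_diff[OF A_sub] by (simp_all add: clinear_diff[OF lin])
    obtain F w where F: "finite F" "\<forall>m. w m \<in> W" "x - y = (\<Sum>m\<in>F. w m \<otimes>\<^sub>C tpow m)"
      using form[OF z(1)] by blast
    have "\<kappa> (w m) = 0" if m: "m \<in> F" for m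
    proof -
      have "shift m (\<kappa> (w m)) = 0"
      proof (rule graded_independent[OF F(1) _ _ m])
        show "shift k (\<kappa> (w k)) \<in> graded \<alpha> k" for k
          using shift_graded[of "\<kappa> (w k)" 0 k] F(2) \<kappa>(2) by auto
        show "(\<Sum>m\<in>F. shift m (\<kappa> (w m))) = 0"
          using z(2) unfolding F(3) by (simp add: clinear_sum[OF lin] \<Psi>)
      qed
      then have "shift (- m) (shift m (\<kappa> (w m))) = 0" by (simp add: clinear_zero[OF shift_lin])
      then show ?thesis by (simp add: shift_shift)
    qed
    then have "w m = 0" if "m \<in> F" for m
      using inj_onD[OF \<kappa>(3), of "w m" 0] that F(2) cvs.subspace_0[OF W] clinear_zero[OF \<kappa>(1)] by simp
    then have "x - y = 0" unfolding F(3) by (intro sum.neutral) (simp add: zero_tensor)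
    then show "x = y" by simp
  qed
  from subspace_left_inverse[OF lin A_sub this] obtain \<phi> where \<phi>: "clinear \<phi>" "range \<phi> \<subseteq> ?A" "\<forall>x\<in>?A. \<phi> (\<Psi> x) = x"
    by blast
  have "\<Psi> (\<phi> v) = v" for v
    using shifts_span[of v]
  proof (induction rule: cvs.span_induct_alt)
    case base
    show ?case by (simp add: clinear_zero[OF lin] clinear_zero[OF \<phi>(1)])
  next
    case (step c x y)
    obtain m u where u: "x = shift m u" "u \<in> U" using step(1) by blast
    then obtain w where w: "w \<in> W" "u = \<kappa> w" using \<kappa>(2) by blast
    have "w \<otimes>\<^sub>C tpow m \<in> ?A" unfolding tensor_laurent_def using w(1) by (intro cvs.span_base) blast
    then have "\<Psi> (\<phi> (\<Psi> (w \<otimes>\<^sub>C tpow m))) = \<Psi> (w \<otimes>\<^sub>C tpow m)" using \<phi>(3) by simp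
    then have "\<Psi> (\<phi> x) = x" by (simp add: \<Psi> u w)
    then show ?case using step(2)
      by (simp add: clinear_add[OF lin] clinear_add[OF \<phi>(1)] clinear_scale[OF lin] clinear_scale[OF \<phi>(1)])
  qed
  then show ?thesis using lin \<Psi> \<phi> by blast
qed

text \<open>On U (x) A the projection is evaluation of the second factor at t = 1, so its kernel is
  mV.\<close>

lemma projection_exists: "\<exists>pr. clinear pr \<and> (\<forall>m. \<forall>w\<in>U. pr (shift m w) = w)"
proof -
  obtain \<Psi> :: "('v, 'n laurent) tensor \<Rightarrow> 'v" and \<phi>
    where \<Psi>: "\<forall>w m. \<Psi> (w \<otimes>\<^sub>C tpow m) = shift m w" and \<phi>: "clinear \<phi>" "\<forall>x\<in>tensor_laurent U. \<phi> (\<Psi> x) = x"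
    using tensor_model[OF graded_subspace[of 0], of "\<lambda>v. v"] by (auto simp: clinear_iff)
  have bil: "cbilinear (\<lambda>(w::'v) (f::'n laurent). ev1 f *\<^sub>C w)"
    by (simp add: cbilinear_def clinear_iff scaleC_add_right scaleC_add_left scaleC_scaleC mult.commute)
  define pr where "pr v = tensor_lift (\<lambda>(w::'v) (f::'n laurent). ev1 f *\<^sub>C w) (\<phi> v)" for v
  have "clinear pr" unfolding pr_def by (rule clinear_compose[OF clinear_tensor_lift \<phi>(1)])
  moreover have "pr (shift m w) = w" if w: "w \<in> U" for m w
  proof -
    have "w \<otimes>\<^sub>C (tpow m :: 'n laurent) \<in> tensor_laurent U"
      unfolding tensor_laurent_def using w by (intro cvs.span_base) blast
    then have "\<phi> (shift m w) = w \<otimes>\<^sub>C tpow m" using \<phi>(2) \<Psi> by metis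
    then show ?thesis by (simp add: pr_def tensor_lift_pure[OF bil] scaleC_one)
  qed
  ultimately show ?thesis by blast
qed

end


section \<open>The action on the fibre at t = 1\<close>

locale tau_module_projection = tau_module_fibre act \<alpha>
  for act :: "('n::finite, 'b::complex_comm_algebra_1) tau \<Rightarrow> 'v::complex_vector \<Rightarrow> 'v" and \<alpha> :: "complex ^ 'n" +
  fixes pr :: "'v \<Rightarrow> 'v"
  assumes pr_lin: "clinear pr" and pr_shift_fibre: "w \<in> U \<Longrightarrow> pr (shift m w) = w"
begin

lemma shift_fibre_induct [consumes 0, case_names shift add scale]:
  assumes s: "\<And>m w. w \<in> U \<Longrightarrow> P (shift m w)" and a: "\<And>v v'. P v \<Longrightarrow> P v' \<Longrightarrow> P (v + v')"
    and c: "\<And>c v. P v \<Longrightarrow> P (c *\<^sub>C v)"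
  shows "P v"
  using shifts_span[of v]
proof (induction rule: cvs.span_induct_alt)
  case base
  have "P (shift 0 0)" by (rule s) (rule cvs.subspace_0[OF graded_subspace])
  then show ?case by simp
next
  case (step c x y)
  then show ?case using s a assms(3) by auto
qed

lemma pr_fibre: "w \<in> U \<Longrightarrow> pr w = w"
  using pr_shift_fibre[of w 0] by simp

lemma pr_mem: "pr v \<in> U"
  by (induction v rule: shift_fibre_induct)
    (simp_all add: pr_shift_fibre clinear_add[OF pr_lin] clinear_scale[OF pr_lin]
      cvs.subspace_add[OF graded_subspace] cvs.subspace_scale[OF graded_subspace])

lemma pr_shift: "pr (shift r v) = pr v"
  by (induction v rule: shift_fibre_induct)
    (simp_all add: pr_shift_fibre shift_shift clinear_add[OF pr_lin] clinear_scale[OF pr_lin]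
      clinear_add[OF shift_lin] clinear_scale[OF shift_lin])

lemma graded_pr: "v \<in> graded \<alpha> m \<Longrightarrow> v = shift m (pr v)"
  using graded_eq_shift[of v m] pr_shift_fibre by metis

lemma act_D_fibre: "w \<in> U \<Longrightarrow> act (tau_D u r b) w = shift r (pr (act (tau_D u r b) w))"
  using graded_pr[OF act_D_graded[of w 0]] by simp

text \<open>The translates of \<open>N\<close> span a submodule of V, and \<open>pr\<close> maps
  this span back into \<open>N\<close>. If the span is everything, then \<open>N\<close> contains
  pr(U) = U.\<close>

lemma fibre_irreducible:
  assumes N: "cvs.subspace N" "N \<subseteq> U"
    and D: "\<And>u r b w. w \<in> N \<Longrightarrow> pr (act (tau_D u r b) w) \<in> N"
    and B: "\<And>b w. w \<in> N \<Longrightarrow> beta b w \<in> N"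
  shows "N = {0} \<or> N = U"
proof -
  let ?G = "{shift m w | m w. w \<in> N}"
  have G: "shift m w \<in> cvs.span ?G" if "w \<in> N" for m w
    using that by (intro cvs.span_base) blast
  have "cvs.span ?G = {0} \<or> cvs.span ?G = UNIV"
  proof (rule irreducible)
    fix v assume v: "v \<in> cvs.span ?G"
    show "act (tau_D u r b) v \<in> cvs.span ?G" for u r b
      using v
    proof (induction rule: cvs.span_induct_alt)
      case (step c x y)
      obtain m w where x: "x = shift m w" and w: "w \<in> N" using step(1) by blast
      have "shift m (act (tau_D u r b) w) = shift (m + r) (pr (act (tau_D u r b) w))"
        using act_D_fibre[of w u r b] w N(2) by (metis shift_shift subsetD)
      then have "act (tau_D u r b) x \<in> cvs.span ?G"
        using w by (simp add: x act_D_shift cvs.span_add cvs.span_scale G D B)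
      then show ?case using step
        by (simp add: clinear_add[OF act_lin] clinear_scale[OF act_lin] cvs.span_add cvs.span_scale)
    qed (simp add: clinear_zero[OF act_lin] cvs.span_zero)
    show "act (tau_t r b) v \<in> cvs.span ?G" for r b
      using v
    proof (induction rule: cvs.span_induct_alt)
      case (step c x y)
      obtain m w where x: "x = shift m w" and w: "w \<in> N" using step(1) by blast
      have "act (tau_t r b) x \<in> cvs.span ?G"
        by (simp add: x act_tau_t beta_shift shift_shift G B w)
      then show ?case using step
        by (simp add: clinear_add[OF act_lin] clinear_scale[OF act_lin] cvs.span_add cvs.span_scale)
    qed (simp add: clinear_zero[OF act_lin] cvs.span_zero)
  qed simp
  then show ?thesis
  proof
    assume "cvs.span ?G = {0}"
    then have "N \<subseteq> {0}" using G[of _ 0] by auto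
    then show ?thesis using cvs.subspace_0[OF N(1)] by blast
  next
    assume all: "cvs.span ?G = UNIV"
    have "pr v \<in> N" if "v \<in> cvs.span ?G" for v
      using that
    proof (induction rule: cvs.span_induct_alt)
      case (step c x y)
      then have "pr x \<in> N" using N(2) pr_shift_fibre by auto
      then show ?case using step
        by (simp add: clinear_add[OF pr_lin] clinear_scale[OF pr_lin] cvs.subspace_add[OF N(1)] cvs.subspace_scale[OF N(1)])
    qed (simp add: clinear_zero[OF pr_lin] cvs.subspace_0[OF N(1)])
    then have "U \<subseteq> N" using all pr_fibre by (metis UNIV_I subsetI)
    then show ?thesis using N(2) by blast
  qed
qed

lemma beta_pr: "beta b (pr v) = pr (beta b v)"
proof (induction v rule: shift_fibre_induct)
  case (shift m w)
  then show ?case by (simp add: beta_shift pr_shift_fibre beta_graded)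
qed (simp_all add: clinear_add[OF pr_lin] clinear_scale[OF pr_lin] clinear_add[OF beta_lin] clinear_scale[OF beta_lin])

lemma beta_scalar: "\<exists>c. \<forall>v. beta b v = c *\<^sub>C v"
proof -
  obtain w c where w: "w \<in> U" "w \<noteq> 0" "beta b w = c *\<^sub>C w"
    using eigenvector_exists[OF beta_lin fin graded_subspace beta_graded nonzero] by blast
  let ?N = "{w \<in> U. beta b w = c *\<^sub>C w}"
  have "?N = {0} \<or> ?N = U"
  proof (rule fibre_irreducible)
    show "cvs.subspace ?N" by (rule eigenspace_subspace[OF beta_lin graded_subspace])
    show "pr (act (tau_D u r b') w) \<in> ?N" if "w \<in> ?N" for u r b' w
      using that pr_mem by (simp add: beta_pr beta_act_D clinear_scale[OF act_lin] clinear_scale[OF pr_lin])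
    show "beta b' w \<in> ?N" if "w \<in> ?N" for b' w
    proof -
      have "beta b (beta b' w) = beta b' (beta b w)" by (simp add: beta_beta mult.commute)
      then show ?thesis using that by (simp add: beta_graded clinear_scale[OF beta_lin])
    qed
  qed auto
  then have U: "beta b w = c *\<^sub>C w" if "w \<in> U" for w using w that by blast
  have "beta b v = c *\<^sub>C v" for v
  proof (induction v rule: shift_fibre_induct)
    case (shift m w)
    then show ?case by (simp add: beta_shift U clinear_scale[OF shift_lin])
  qed (simp_all add: clinear_add[OF beta_lin] clinear_scale[OF beta_lin] scaleC_add_right cvs.scale_left_commute mult.commute)
  then show ?thesis by blast
qed

definition psi :: "'b \<Rightarrow> complex"
  where "psi b = (SOME c. \<forall>v. beta b v = c *\<^sub>C v)"

lemma beta_psi: "beta b v = psi b *\<^sub>C v"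
  using someI_ex[OF beta_scalar[of b]] unfolding psi_def[symmetric] by blast

lemma act_tau_t_psi: "act (tau_t r b) v = psi b *\<^sub>C shift r v"
  by (simp add: act_tau_t beta_psi clinear_scale[OF shift_lin])

lemma algebra_hom_psi: "algebra_hom psi"
proof -
  obtain w where w: "w \<in> U" "w \<noteq> 0"
    using nonzero cvs.subspace_0[OF graded_subspace[of 0]] by blast
  have eq: "x = y" if "x *\<^sub>C w = y *\<^sub>C w" for x y using that w(2) by simp
  have tadd: "tau_t 0 (b + b') = tau_t 0 b + (tau_t 0 b' :: ('n, 'b) tau)"
    and tscale: "tau_t 0 (c *\<^sub>C b) = c *\<^sub>C (tau_t 0 b :: ('n, 'b) tau)" for b b' c
    by (simp_all add: tau_t_def tensor_add_right tensor_scale_right)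
  have "psi (b + b') = psi b + psi b'" for b b'
  proof (rule eq)
    have "beta (b + b') w = beta b w + beta b' w"
      by (simp add: beta_def tadd clinear_add[OF act_alg])
    then show "psi (b + b') *\<^sub>C w = (psi b + psi b') *\<^sub>C w"
      by (simp only: beta_psi scaleC_add_left)
  qed
  moreover have "psi (c *\<^sub>C b) = c * psi b" for b c
  proof (rule eq)
    have "beta (c *\<^sub>C b) w = c *\<^sub>C beta b w"
      by (simp add: beta_def tscale clinear_scale[OF act_alg])
    then show "psi (c *\<^sub>C b) *\<^sub>C w = (c * psi b) *\<^sub>C w"
      by (simp only: beta_psi scaleC_scaleC)
  qed
  moreover have "psi (b * b') = psi b * psi b'" for b b'
  proof (rule eq)
    show "psi (b * b') *\<^sub>C w = (psi b * psi b') *\<^sub>C w"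
      using beta_beta[of b b' w] by (simp only: beta_psi scaleC_scaleC)
  qed
  moreover have "psi 1 = 1"
  proof (rule eq)
    have "beta 1 w = w" by (simp add: beta_def unit)
    then show "psi 1 *\<^sub>C w = 1 *\<^sub>C w" by (simp only: beta_psi scaleC_one)
  qed
  ultimately show ?thesis by (simp add: algebra_hom_def clinear_iff)
qed

lemma pr_act_tau_fun: "pr (act (tau_fun f b) v) = (ev1 f * psi b) *\<^sub>C pr v"
proof (induction f rule: laurent_induct)
  case (tpow c s)
  show ?case
    by (simp add: clinear_scale[OF clinear_tau_fun_left] clinear_scale[OF act_alg] clinear_scale[OF pr_lin]
        tau_t_eq[symmetric] act_tau_t_psi pr_shift scaleC_scaleC)
qed (simp add: clinear_add[OF clinear_tau_fun_left] clinear_add[OF act_alg] clinear_add[OF pr_lin]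
    distrib_right scaleC_add_left)

definition rho :: "'n laurent \<Rightarrow> 'n \<Rightarrow> 'b \<Rightarrow> 'v \<Rightarrow> 'v"
  where "rho f i b w = pr (act (tau_vf f i b) w)"

text \<open>Moving the field past T_m leaves the function f d_i(t^m) (x) b, whose value at (1, psi)
  is zero. Such a field therefore acts on the quotient V/mV, and brackets in \<open>tau\<close>
  become commutators of the operators \<open>rho\<close>.\<close>

lemma pr_act_vf:
  assumes "ev1 f * psi b = 0"
  shows "pr (act (tau_vf f i b) v) = rho f i b (pr v)"
proof (induction v rule: shift_fibre_induct)
  case (shift m w)
  have "pr (act (tau_vf f i b) (shift m w)) = pr (shift m (act (tau_vf f i b) w))
    + pr (act (tau_fun (f * pd i (tpow m)) b) w)"
    unfolding shift_def act_swap[of "tau_vf f i b"] clinear_add[OF pr_lin] tau_t_eq lie_bracket_tau_vf_fun by simp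
  then show ?case using assms shift by (auto simp: pr_shift pr_act_tau_fun pr_fibre pr_shift_fibre rho_def)
qed (simp_all add: rho_def clinear_add[OF pr_lin] clinear_scale[OF pr_lin] clinear_add[OF act_lin] clinear_scale[OF act_lin])

text \<open>The two fields add up to t_i d/dt_i = D(e_i, 0), which has eigenvalue alpha_i on
  \<open>U\<close>.\<close>

lemma rho_one:
  assumes "w \<in> U"
  shows "rho 1 i 1 w + rho (yvar i) i 1 w = \<alpha> $ i *\<^sub>C w"
proof -
  have "rho 1 i 1 w + rho (yvar i) i 1 w = pr (act (tau_vf (1 + yvar i) i 1) w)"
    by (simp only: rho_def clinear_add[OF clinear_tau_vf_left] clinear_add[OF act_alg] clinear_add[OF pr_lin])
  also have "1 + yvar i = tpow (axis i 1)" by (simp add: yvar_def tvar_def)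
  finally show ?thesis
    using assms by (simp add: tau_vf_tpow) (simp add: graded_def cdot_axis clinear_scale[OF pr_lin] pr_fibre[unfolded graded_def])
qed

lemma pr_act_D: "pr (act (tau_D u r b) w) = (\<Sum>i\<in>UNIV. u $ i *\<^sub>C rho (tpow (r + axis i 1)) i b w)"
  by (simp add: tau_D_eq clinear_sum[OF act_alg] clinear_scale[OF act_alg] clinear_sum[OF pr_lin]
      clinear_scale[OF pr_lin] rho_def)

lemma rho_linear: "clinear (rho f i b)" "clinear (\<lambda>f. rho f i b w)" "clinear (\<lambda>b. rho f i b w)"
  unfolding rho_def
  by (intro clinear_compose[OF pr_lin] act_lin
      clinear_compose[OF act_alg, OF clinear_tau_vf_left] clinear_compose[OF act_alg, OF clinear_tau_vf_right])+

sublocale jet_module U psi rho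
proof (rule jet_module.intro)
  show "finite_dim U" "cvs.subspace U" "U \<noteq> {0}" "algebra_hom psi"
    using fin graded_subspace nonzero algebra_hom_psi by blast+
  show "clinear (rho f i b)" "clinear (\<lambda>f. rho f i b w)" "clinear (\<lambda>b. rho f i b w)" for f i b w
    by (rule rho_linear)+
  show "rho f i b w \<in> U" for f i b w by (simp add: rho_def pr_mem)
  show "rho f i b (rho g j b' w) - rho g j b' (rho f i b w)
      = rho (f * pd i g) j (b * b') w - rho (g * pd j f) i (b * b') w"
    if "ev1 f * psi b = 0" "ev1 g * psi b' = 0" "w \<in> U" for f b g b' w i j
  proof -
    have "rho f i b (rho g j b' w) - rho g j b' (rho f i b w)
      = pr (act (tau_vf f i b) (act (tau_vf g j b') w)) - pr (act (tau_vf g j b') (act (tau_vf f i b) w))"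
      using that by (simp add: pr_act_vf rho_def[of g j b' w] rho_def[of f i b w])
    also have "\<dots> = pr (act (lie_bracket (tau_vf f i b) (tau_vf g j b')) w)"
      by (simp add: act_bracket clinear_diff[OF pr_lin])
    finally show ?thesis
      by (simp add: lie_bracket_tau_vf clinear_diff[OF act_alg] clinear_diff[OF pr_lin] rho_def)
  qed
  show "N = {0} \<or> N = U"
    if N: "cvs.subspace N" "N \<subseteq> U" and inv: "\<And>f i b w. ev1 f * psi b = 0 \<Longrightarrow> w \<in> N \<Longrightarrow> rho f i b w \<in> N" for N
  proof (rule fibre_irreducible[OF N])
    have psi1: "psi (b - psi b *\<^sub>C 1) = 0" for b
      using algebra_hom_psi by (simp add: algebra_hom_def clinear_diff clinear_scale)
    fix w assume w: "w \<in> N"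
    show "beta b w \<in> N" for b by (simp add: beta_psi cvs.subspace_scale[OF N(1)] w)
    have "rho (tpow s) i b w \<in> N" for s i b
    proof -
      have "rho 1 i 1 w = \<alpha> $ i *\<^sub>C w - rho (yvar i) i 1 w"
        using rho_one[of w i] w N(2) by (auto simp: eq_diff_eq)
      then have one: "rho 1 i 1 w \<in> N"
        by (simp add: cvs.subspace_diff[OF N(1)] cvs.subspace_scale[OF N(1)] w inv)
      \<comment> \<open>The first two fields vanish at (1, psi), one through its function and the
        other through its coefficient. The third is a multiple of d/dt_i, covered by
        \<open>rho_one\<close>.\<close>
      have "rho (tpow s) i b w = rho (tpow s - 1) i b w + rho 1 i (b - psi b *\<^sub>C 1) w + psi b *\<^sub>C rho 1 i 1 w"
        by (simp add: clinear_diff[OF rho_linear(2)] clinear_diff[OF rho_linear(3)] clinear_scale[OF rho_linear(3)])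
      then show ?thesis
        by (simp add: cvs.subspace_add[OF N(1)] cvs.subspace_scale[OF N(1)] one inv w psi1)
    qed
    then show "pr (act (tau_D u r b) w) \<in> N" for u r b
      by (simp add: pr_act_D cvs.subspace_sum[OF N(1)] cvs.subspace_scale[OF N(1)])
  qed
qed

lemma rho_psi: "w \<in> U \<Longrightarrow> rho f i b w = psi b *\<^sub>C rho f i 1 w"
  using rho_absorb[of 1 w f i b] rho_psi_zero by simp

text \<open>First-order Taylor expansion of t^r t_i. The extra factor t_i contributes one more y_i
  d/dt_i, which completes the constant term d/dt_i to t_i d/dt_i and yields alpha_i.\<close>

lemma rho_tpow:
  assumes w: "w \<in> U"
  shows "rho (tpow (r + axis i 1)) i b w
    = psi b *\<^sub>C (\<alpha> $ i *\<^sub>C w + (\<Sum>j\<in>UNIV. of_int (r $ j) *\<^sub>C rho (yvar j) i 1 w))"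
proof -
  let ?s = "r + axis i 1"
  have "rho (tpow ?s - 1 - (\<Sum>j\<in>UNIV. of_int (?s $ j) *\<^sub>C yvar j)) i 1 w = 0"
    by (rule bspec[OF rho_ker_sq[OF tpow_taylor, unfolded vanishes_def] w])
  then have "rho (tpow ?s) i 1 w = rho 1 i 1 w + (\<Sum>j\<in>UNIV. of_int (?s $ j) *\<^sub>C rho (yvar j) i 1 w)"
    by (simp add: diff_eq_eq add.commute clinear_diff[OF rho_linear(2)] clinear_sum[OF rho_linear(2)] clinear_scale[OF rho_linear(2)]
        del: vector_add_component)
  also have "(\<Sum>j\<in>UNIV. of_int (?s $ j) *\<^sub>C rho (yvar j) i 1 w)
    = (\<Sum>j\<in>UNIV. of_int (r $ j) *\<^sub>C rho (yvar j) i 1 w + (if j = i then rho (yvar i) i 1 w else 0))"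
    by (rule sum.cong) (auto simp: axis_def scaleC_add_left scaleC_one)
  also have "\<dots> = (\<Sum>j\<in>UNIV. of_int (r $ j) *\<^sub>C rho (yvar j) i 1 w) + rho (yvar i) i 1 w"
    by (simp add: sum.distrib)
  finally have "rho (tpow ?s) i 1 w = \<alpha> $ i *\<^sub>C w + (\<Sum>j\<in>UNIV. of_int (r $ j) *\<^sub>C rho (yvar j) i 1 w)"
    using rho_one[OF w, of i] by (simp add: algebra_simps)
  then show ?thesis by (simp add: rho_psi[OF w, of _ _ b])
qed

lemma act_D_formula:
  assumes w: "w \<in> U"
  shows "act (tau_D u r b) (shift m w) = psi b *\<^sub>C (cdot u (cvec m + \<alpha>) *\<^sub>C shift (m + r) w
    + (\<Sum>i\<in>UNIV. \<Sum>j\<in>UNIV. (u $ i * of_int (r $ j)) *\<^sub>C shift (m + r) (rho (yvar j) i 1 w)))"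
proof -
  have "pr (act (tau_D u r b) w) = psi b *\<^sub>C (cdot u \<alpha> *\<^sub>C w
      + (\<Sum>i\<in>UNIV. \<Sum>j\<in>UNIV. (u $ i * of_int (r $ j)) *\<^sub>C rho (yvar j) i 1 w))"
    by (simp add: pr_act_D rho_tpow[OF w] scaleC_add_right sum.distrib cvs.scale_sum_right cdot_def
        cvs.scale_sum_left scaleC_scaleC mult_ac)
  moreover have "shift m (act (tau_D u r b) w) = shift (m + r) (pr (act (tau_D u r b) w))"
    using act_D_fibre[OF w] by (metis shift_shift)
  ultimately have "act (tau_D u r b) (shift m w) = shift (m + r) (psi b *\<^sub>C (cdot u \<alpha> *\<^sub>C w
      + (\<Sum>i\<in>UNIV. \<Sum>j\<in>UNIV. (u $ i * of_int (r $ j)) *\<^sub>C rho (yvar j) i 1 w)))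
      + cdot u (cvec m) *\<^sub>C shift (m + r) (psi b *\<^sub>C w)"
    by (simp add: act_D_shift beta_psi)
  then show ?thesis
    by (simp add: clinear_add[OF shift_lin] clinear_scale[OF shift_lin] clinear_sum[OF shift_lin]
        cdot_add_right scaleC_add_left scaleC_add_right scaleC_scaleC mult.commute add_ac)
qed

section \<open>The linear fields y_j d/dt_i as matrix units E_ji\<close>

definition gl_act :: "complex ^ 'n ^ 'n \<Rightarrow> 'v \<Rightarrow> 'v"
  where "gl_act X w = (\<Sum>j\<in>UNIV. \<Sum>i\<in>UNIV. X $ j $ i *\<^sub>C rho (yvar j) i 1 w)"

lemma gl_act_lin: "clinear (gl_act X)"
  unfolding gl_act_def
  by (rule clinearI)
    (simp_all add: clinear_add[OF rho_lin] clinear_scale[OF rho_lin] scaleC_add_right sum.distrib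
      cvs.scale_sum_right cvs.scale_left_commute mult.commute)

lemma gl_act_unit: "gl_act (matrix_unit j i) w = rho (yvar j) i 1 w"
proof -
  have "gl_act (matrix_unit j i) w
    = (\<Sum>k\<in>UNIV. \<Sum>l\<in>UNIV. if l = i then (if k = j then rho (yvar j) i 1 w else 0) else 0)"
    unfolding gl_act_def by (intro sum.cong refl) (auto simp: matrix_unit_def scaleC_one)
  then show ?thesis by simp
qed

text \<open>The bracket of y_j d_i and y_l d_k is delta_il y_j d_k - delta_kj y_l d_i, which has the
  structure constants of E_ji and E_lk. The rest is reordering of sums.\<close>

lemma gl_act_commutator:
  assumes w: "w \<in> U"
  shows "gl_act (commutator X Y) w = gl_act X (gl_act Y w) - gl_act Y (gl_act X w)"
proof -
  let ?r = "\<lambda>j i. rho (yvar j) i 1"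
  have br: "?r j i (?r l k w) - ?r l k (?r j i w)
    = (if i = l then ?r j k w else 0) - (if k = j then ?r l i w else 0)" for i j k l
    using rho_bracket[of "yvar j" 1 "yvar l" 1 w i k] w by (auto simp: pd_yvar clinear_zero[OF rho_fun])
  have XY: "gl_act X (gl_act Y w) = (\<Sum>j\<in>UNIV. \<Sum>i\<in>UNIV. \<Sum>l\<in>UNIV. \<Sum>k\<in>UNIV. (X $ j $ i * Y $ l $ k) *\<^sub>C ?r j i (?r l k w))" for X Y
    unfolding gl_act_def
    by (simp add: clinear_sum[OF rho_lin] clinear_scale[OF rho_lin] cvs.scale_sum_right scaleC_scaleC)
  have swap: "(\<Sum>j\<in>UNIV. \<Sum>i\<in>UNIV. \<Sum>l\<in>UNIV. \<Sum>k\<in>UNIV. f j i l k) = (\<Sum>l\<in>UNIV. \<Sum>k\<in>UNIV. \<Sum>j\<in>UNIV. \<Sum>i\<in>UNIV. f j i l k)"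
    for f :: "'n \<Rightarrow> 'n \<Rightarrow> 'n \<Rightarrow> 'n \<Rightarrow> 'v"
  proof -
    have "(\<Sum>p\<in>UNIV. \<Sum>q\<in>UNIV. f (fst p) (snd p) (fst q) (snd q)) = (\<Sum>q\<in>UNIV. \<Sum>p\<in>UNIV. f (fst p) (snd p) (fst q) (snd q))"
      by (rule sum.swap)
    then show ?thesis by (simp add: UNIV_Times_UNIV[symmetric] sum.cartesian_product' del: UNIV_Times_UNIV)
  qed
  have "gl_act X (gl_act Y w) - gl_act Y (gl_act X w)
    = (\<Sum>j\<in>UNIV. \<Sum>i\<in>UNIV. \<Sum>l\<in>UNIV. \<Sum>k\<in>UNIV. (X $ j $ i * Y $ l $ k) *\<^sub>C (?r j i (?r l k w) - ?r l k (?r j i w)))"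
    unfolding XY by (subst (2) swap) (simp add: sum_subtractf[symmetric] cvs.scale_right_diff_distrib mult.commute)
  also have "\<dots> = (\<Sum>j\<in>UNIV. \<Sum>i\<in>UNIV. \<Sum>l\<in>UNIV. \<Sum>k\<in>UNIV. if i = l then (X $ j $ i * Y $ l $ k) *\<^sub>C ?r j k w else 0)
      - (\<Sum>j\<in>UNIV. \<Sum>i\<in>UNIV. \<Sum>l\<in>UNIV. \<Sum>k\<in>UNIV. if k = j then (X $ j $ i * Y $ l $ k) *\<^sub>C ?r l i w else 0)"
    unfolding br sum_subtractf[symmetric] by (intro sum.cong refl) (auto simp: cvs.scale_right_diff_distrib)
  also have "(\<Sum>j\<in>UNIV. \<Sum>i\<in>UNIV. \<Sum>l\<in>UNIV. \<Sum>k\<in>UNIV. if i = l then (X $ j $ i * Y $ l $ k) *\<^sub>C ?r j k w else 0)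
    = gl_act (X ** Y) w"
  proof -
    have "(\<Sum>l\<in>UNIV. \<Sum>k\<in>UNIV. if i = l then (X $ j $ i * Y $ l $ k) *\<^sub>C ?r j k w else 0)
      = (\<Sum>k\<in>UNIV. (X $ j $ i * Y $ i $ k) *\<^sub>C ?r j k w)" for i j
      by (subst sum.swap) simp
    then show ?thesis
      unfolding gl_act_def matrix_matrix_mult_def
      by (simp add: cvs.scale_sum_left) (subst sum.swap, rule refl)
  qed
  also have "(\<Sum>j\<in>UNIV. \<Sum>i\<in>UNIV. \<Sum>l\<in>UNIV. \<Sum>k\<in>UNIV. if k = j then (X $ j $ i * Y $ l $ k) *\<^sub>C ?r l i w else 0)
    = gl_act (Y ** X) w"
  proof -
    have "(\<Sum>j\<in>UNIV. \<Sum>i\<in>UNIV. \<Sum>l\<in>UNIV. (Y $ l $ j * X $ j $ i) *\<^sub>C ?r l i w)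
      = (\<Sum>l\<in>UNIV. \<Sum>i\<in>UNIV. \<Sum>j\<in>UNIV. (Y $ l $ j * X $ j $ i) *\<^sub>C ?r l i w)"
    proof -
      have sw: "(\<Sum>j\<in>UNIV. \<Sum>i\<in>UNIV. \<Sum>l\<in>UNIV. h j i l) = (\<Sum>j\<in>UNIV. \<Sum>l\<in>UNIV. \<Sum>i\<in>UNIV. h j i l)"
        for h :: "'n \<Rightarrow> 'n \<Rightarrow> 'n \<Rightarrow> 'v"
        by (intro sum.cong refl sum.swap)
      show ?thesis by (subst sw, subst sum.swap, subst sw) (rule refl)
    qed
    then show ?thesis
      unfolding gl_act_def matrix_matrix_mult_def by (simp add: cvs.scale_sum_left mult.commute)
  qed
  finally have "gl_act X (gl_act Y w) - gl_act Y (gl_act X w) = gl_act (X ** Y) w - gl_act (Y ** X) w" .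
  also have "\<dots> = gl_act (commutator X Y) w"
    by (simp add: gl_act_def commutator_def cvs.scale_left_diff_distrib sum_subtractf)
  finally show ?thesis by simp
qed

lemma gl_act_mem: "w \<in> U \<Longrightarrow> gl_act X w \<in> U"
  unfolding gl_act_def by (intro cvs.subspace_sum[OF U_sub] cvs.subspace_scale[OF U_sub] rho_mem)

text \<open>By \<open>rho_psi\<close> and Taylor expansion, a field that vanishes at (1, psi) acts
  as a linear combination of the y_j d/dt_i, so stability under matrices implies stability under
  these fields.\<close>

lemma gl_act_irreducible:
  assumes N: "cvs.subspace N" "N \<subseteq> U" and inv: "\<And>X w. w \<in> N \<Longrightarrow> gl_act X w \<in> N"
  shows "N = {0} \<or> N = U"
proof (rule rho_irreducible[OF N])
  fix f :: "'n laurent" and i b w assume good: "ev1 f * psi b = 0" and w: "w \<in> N"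
  then have wU: "w \<in> U" using N by blast
  show "rho f i b w \<in> N"
  proof (cases "psi b = 0")
    case True
    then show ?thesis using rho_psi[OF wU, of f i b] by (simp add: cvs.subspace_0[OF N(1)])
  next
    case False
    then have f: "ev1 f = 0" using good by simp
    have "rho (f - ev1 f *\<^sub>C 1 - (\<Sum>j\<in>UNIV. ev1 (pd j f) *\<^sub>C yvar j)) i 1 w = 0"
      using rho_ker_sq[OF laurent_taylor] wU by (simp add: vanishes_def)
    then have "rho f i 1 w = (\<Sum>j\<in>UNIV. ev1 (pd j f) *\<^sub>C gl_act (matrix_unit j i) w)"
      by (simp add: f clinear_diff[OF rho_fun] clinear_sum[OF rho_fun] clinear_scale[OF rho_fun] gl_act_unit)
    then have "rho f i 1 w \<in> N" by (simp add: cvs.subspace_sum[OF N(1)] cvs.subspace_scale[OF N(1)] inv w)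
    then show ?thesis using rho_psi[OF wU, of f i b] by (simp add: cvs.subspace_scale[OF N(1)])
  qed
qed

end


theorem theorem4p1:
  fixes act :: "('n::{finite,linorder}, 'b::complex_comm_algebra_1) tau \<Rightarrow> 'v::complex_vector \<Rightarrow> 'v"
  assumes "finitely_generated_algebra TYPE('b)"
    and "lie_module UNIV lie_bracket UNIV act"
    and "irreducible_module UNIV UNIV act"
    and "weight_module act"
    and "\<And>l. l \<in> dual_space H_sub \<Longrightarrow> finite_dim (weight_space act l)"
    and "\<And>r s b b' v. act (tau_t r b) (act (tau_t s b') v) = act (tau_t (r + s) (b * b')) v"
    and "\<And>v. act (tau_t 0 1) v = v"
  shows "\<exists>\<mu> c \<alpha> \<psi>.
    dominant_integral \<mu> \<and> algebra_hom \<psi> \<and>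
    (\<exists>(W :: (nat \<Rightarrow>\<^sub>0 complex) set) \<rho> actF \<phi>.
      is_V \<mu> c W \<rho> \<and> is_F \<alpha> \<psi> W \<rho> actF \<and>
      module_iso UNIV UNIV act (tensor_laurent W) actF \<phi>)"
proof -
  interpret tau_module act by unfold_locales (fact assms)+
  obtain \<alpha> where "finite_dim (graded \<alpha> 0)" "graded \<alpha> 0 \<noteq> {0}" using fibre_exists by blast
  then interpret tau_module_fibre act \<alpha> by unfold_locales
  obtain pr where "clinear pr" "\<forall>m. \<forall>w\<in>U. pr (shift m w) = w" using projection_exists by blast
  then interpret tau_module_projection act \<alpha> pr
    by (intro tau_module_projection.intro tau_module_projection_axioms.intro tau_module_fibre_axioms) blast+
  \<comment> \<open>Coordinates on the fibre: \<open>\<kappa>\<close> maps \<open>W\<close> onto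
    \<open>U\<close>, and \<open>\<theta>\<close> is its inverse there.\<close>
  obtain W :: "(nat \<Rightarrow>\<^sub>0 complex) set" and \<kappa> \<theta>
    where W: "cvs.subspace W" "finite_dim W" and \<kappa>: "clinear \<kappa>" "\<kappa> ` W = U"
      and \<theta>: "clinear \<theta>" "range \<theta> \<subseteq> W" "\<forall>w\<in>W. \<theta> (\<kappa> w) = w"
    using finite_dim_coordinates[OF U_fin U_sub] by blast
  have \<kappa>_mem: "\<kappa> w \<in> U" if "w \<in> W" for w using \<kappa>(2) that by blast
  have \<theta>_mem: "\<theta> v \<in> W" for v using \<theta>(2) by blast
  have \<kappa>\<theta>: "\<kappa> (\<theta> u) = u" if "u \<in> U" for u
    using that \<kappa>(2) \<theta>(3) by (metis imageE)
  have inj: "inj_on \<kappa> W" using \<theta>(3) by (metis inj_onI)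
  obtain \<Psi> \<phi> where \<Psi>: "clinear \<Psi>" "\<forall>w m. \<Psi> (w \<otimes>\<^sub>C tpow m) = shift m (\<kappa> w)"
    and \<phi>: "clinear \<phi>" "range \<phi> \<subseteq> tensor_laurent W" "\<forall>x\<in>tensor_laurent W. \<phi> (\<Psi> x) = x" "\<forall>v. \<Psi> (\<phi> v) = v"
    using tensor_model[OF W(1) \<kappa> inj] by blast
  have \<phi>_shift: "\<phi> (shift m u) = \<theta> u \<otimes>\<^sub>C tpow m" if "u \<in> U" for m u
  proof -
    have "\<theta> u \<otimes>\<^sub>C (tpow m :: 'n::{finite,linorder} laurent) \<in> tensor_laurent W"
      unfolding tensor_laurent_def using \<theta>_mem by (intro cvs.span_base) blast
    then have "\<phi> (\<Psi> (\<theta> u \<otimes>\<^sub>C tpow m)) = \<theta> u \<otimes>\<^sub>C tpow m" using \<phi>(3) by blast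
    then show ?thesis using \<Psi>(2) \<kappa>\<theta>[OF that] by simp
  qed

  define \<rho> where "\<rho> X w = \<theta> (gl_act X (\<kappa> w))" for X w
  have \<kappa>\<rho>: "\<kappa> (\<rho> X w) = gl_act X (\<kappa> w)" if "w \<in> W" for X w
    using that by (simp add: \<rho>_def \<kappa>\<theta> gl_act_mem \<kappa>_mem)
  have "lie_module UNIV commutator W \<rho>"
    unfolding lie_module_def
  proof (intro conjI ballI allI W(1))
    fix X Y :: "complex ^ 'n::{finite,linorder} ^ 'n::{finite,linorder}" and w assume w: "w \<in> W"
    show "\<rho> (X + Y) w = \<rho> X w + \<rho> Y w"
      by (simp add: \<rho>_def gl_act_def scaleC_add_left sum.distrib clinear_add[OF \<theta>(1)])
    show "\<rho> (commutator X Y) w = \<rho> X (\<rho> Y w) - \<rho> Y (\<rho> X w)"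
      unfolding \<rho>_def[of _ "\<rho> _ w"] \<kappa>\<rho>[OF w]
      by (simp add: \<rho>_def gl_act_commutator[OF \<kappa>_mem[OF w]] clinear_diff[OF \<theta>(1)])
  next
    fix c and X :: "complex ^ 'n::{finite,linorder} ^ 'n::{finite,linorder}" and w
    show "\<rho> (c *\<^sub>C X) w = c *\<^sub>C \<rho> X w"
    proof -
      have "gl_act (c *\<^sub>C X) (\<kappa> w) = c *\<^sub>C gl_act X (\<kappa> w)"
        by (simp add: gl_act_def scaleC_vec_def cvs.scale_sum_right scaleC_scaleC)
      then show ?thesis by (simp add: \<rho>_def clinear_scale[OF \<theta>(1)])
    qed
  qed (simp_all add: \<rho>_def \<theta>_mem clinear_add[OF \<kappa>(1)] clinear_add[OF gl_act_lin] clinear_add[OF \<theta>(1)]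
      clinear_scale[OF \<kappa>(1)] clinear_scale[OF gl_act_lin] clinear_scale[OF \<theta>(1)])
  moreover have "irreducible_module UNIV W \<rho>"
    unfolding irreducible_module_def
  proof (intro conjI allI impI)
    show "W \<noteq> {0}" using \<kappa>(2) U_nonzero clinear_zero[OF \<kappa>(1)] by auto
    fix N assume N: "cvs.subspace N \<and> N \<subseteq> W \<and> (\<forall>x\<in>UNIV. \<forall>v\<in>N. \<rho> x v \<in> N)"
    have "\<kappa> ` N = {0} \<or> \<kappa> ` N = U"
    proof (rule gl_act_irreducible)
      show "cvs.subspace (\<kappa> ` N)"
        using clinear_subspace_image[OF \<kappa>(1)] N by blast
      show "\<kappa> ` N \<subseteq> U" using N \<kappa>_mem by blast
      show "gl_act X u \<in> \<kappa> ` N" if u: "u \<in> \<kappa> ` N" for X u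
      proof -
        obtain w where "w \<in> N" "u = \<kappa> w" using u by blast
        then show ?thesis using \<kappa>\<rho>[of w X] N by (metis UNIV_I image_eqI subsetD)
      qed
    qed
    moreover have "N = \<theta> ` \<kappa> ` N" using N \<theta>(3) by (force simp: image_image)
    moreover have "\<theta> ` U = W" using \<theta>(3) \<kappa>(2) by (force simp: image_image)
    ultimately show "N = {0} \<or> N = W" using clinear_zero[OF \<theta>(1)] by auto
  qed
  moreover have "clinear (\<rho> X)" for X
    unfolding \<rho>_def by (intro clinear_compose[OF \<theta>(1)] clinear_compose[OF gl_act_lin] \<kappa>(1))
  ultimately interpret gl: gl_module W \<rho>
    using W(2) by (intro gl_module.intro)
  obtain \<mu> c where \<mu>: "dominant_integral \<mu>" "is_V \<mu> c W \<rho>" using gl.is_V_exists by blast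

  \<comment> \<open>Transport of structure along \<open>\<phi>\<close> makes the isomorphism
    immediate; the content lies in the two formulas of \<open>is_F\<close>.\<close>
  define actF where "actF x z = \<phi> (act x (\<Psi> z))" for x z
  have "is_F \<alpha> psi W \<rho> actF"
    unfolding is_F_def
  proof (intro conjI allI ballI)
    show "lie_module UNIV lie_bracket (tensor_laurent W) actF"
      unfolding lie_module_def actF_def
      using \<phi>(2,4)
      by (auto simp: tensor_laurent_def clinear_add[OF \<Psi>(1)] clinear_scale[OF \<Psi>(1)] clinear_add[OF \<phi>(1)]
          clinear_scale[OF \<phi>(1)] clinear_diff[OF \<phi>(1)] clinear_add[OF act_lin] clinear_scale[OF act_lin]
          clinear_add[OF act_alg] clinear_scale[OF act_alg] act_bracket)
    fix r b w m assume w: "w \<in> W"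
    show "actF (tau_t r b) (w \<otimes>\<^sub>C tpow m) = psi b *\<^sub>C (w \<otimes>\<^sub>C tpow (r + m))"
      using w \<theta>(3) by (simp add: actF_def \<Psi>(2) act_tau_t_psi shift_shift clinear_scale[OF \<phi>(1)] \<phi>_shift \<kappa>_mem)
    fix u
    show "actF (tau_D u r b) (w \<otimes>\<^sub>C tpow m) = psi b *\<^sub>C (cdot u (cvec m + \<alpha>) *\<^sub>C (w \<otimes>\<^sub>C tpow (m + r))
        + (\<Sum>i\<in>UNIV. \<Sum>j\<in>UNIV. (u $ i * of_int (r $ j)) *\<^sub>C (\<rho> (matrix_unit j i) w \<otimes>\<^sub>C tpow (m + r))))"
      using w \<theta>(3)
      by (simp add: actF_def \<Psi>(2) act_D_formula \<kappa>_mem clinear_scale[OF \<phi>(1)] clinear_add[OF \<phi>(1)]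
          clinear_sum[OF \<phi>(1)] \<phi>_shift rho_mem \<rho>_def gl_act_unit)
  qed
  moreover have "module_iso UNIV UNIV act (tensor_laurent W) actF \<phi>"
    unfolding module_iso_def
  proof (intro conjI allI ballI)
    show "bij_betw \<phi> UNIV (tensor_laurent W)"
      using \<phi>(2,3,4) by (intro bij_betw_byWitness[of _ \<Psi>]) auto
  qed (simp_all add: actF_def \<phi>(4) clinear_add[OF \<phi>(1)] clinear_scale[OF \<phi>(1)])
  ultimately show ?thesis using \<mu> algebra_hom_psi by blast
qed

end
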